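(* Let $\ell,m,n$ be positive integers. Let $f:N\to U$ be a $C^r$ injection of a $C^r$ manifold $N$ of dimension $n$ into an open subset $U$ of $\mathbb{R}^m$. Let $F:U\to\mathbb{R}^\ell$ be a $C^r$ mapping. Put $$s_0=\max\{s(n-\ell)+\ell\mid 2\le s\le s_f\}.$$ If $r>\max\{s_0,0\}$, then there exists a subset $\Sigma$ of $\mathcal{L}(\mathbb{R}^m,\mathbb{R}^\ell)$ with Lebesgue measure zero such that for any $\pi\in\mathcal{L}(\mathbb{R}^m,\mathbb{R}^\ell)-\Sigma$ and for any integer $s$ with $2\le s\le s_f$, the $C^r$ mapping $(F_\pi\circ f)^{(s)}:N^{(s)}\to(\mathbb{R}^\ell)^s$ is transverse to the submanifold $\Delta_s$. Moreover, for such $\pi$, if the mapping $F_\pi$ satisfies $|F_\pi^{-1}(y)|\le s_f$ for any $y\in\mathbb{R}^\ell$, then $F_\pi\circ f:N\to\mathbb{R}^\ell$ is a $C^r$ mapping with normal crossings.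
   Context: All manifolds are without boundary and have countable bases; differentiability classes are $C^r$ with $r\ge 1$ ($r=\infty$ allowed). A $C^r$ injection is an injective $C^r$ mapping (not necessarily an immersion). $\mathcal{L}(\mathbb{R}^m,\mathbb{R}^\ell)$ is the space of all linear mappings $\mathbb{R}^m\to\mathbb{R}^\ell$, naturally identified with $(\mathbb{R}^m)^\ell$, which gives the meaning of Lebesgue measure zero. For $\pi\in\mathcal{L}(\mathbb{R}^m,\mathbb{R}^\ell)$, $F_\pi=F+\pi|_U:U\to\mathbb{R}^\ell$. For a set $X$, $|X|$ is its cardinality. $N^{(s)}=\{(q_1,\ldots,q_s)\in N^s\mid q_i\ne q_j\ (i\ne j)\}$, an open submanifold of $N^s$. For $g:N\to\mathbb{R}^\ell$, $g^{(s)}:N^{(s)}\to(\mathbb{R}^\ell)^s$ is $g^{(s)}(q_1,\ldots,q_s)=(g(q_1),\ldots,g(q_s))$. $\Delta_s=\{(y,\ldots,y)\in(\mathbb{R}^\ell)^s\mid y\in\mathbb{R}^\ell\}$, a submanifold of codimension $\ell(s-1)$. For an injection $f:N\to\mathbb{R}^m$, $$s_f=\max\Bigl\{s\;\Big|\;\forall(q_1,\ldots,q_s)\in N^{(s)},\ \dim\sum_{i=2}^s\mathbb{R}\,\overrightarrow{f(q_1)f(q_i)}=s-1\Bigr\},$$ where $\overrightarrow{f(q_1)f(q_i)}=f(q_i)-f(q_1)$. One has $2\le s_f\le m+1$. Transversality: a $C^1$ mapping $g:N\to P$ is transverse to a submanifold $Z\subset P$ if for every $q\in N$ with $g(q)\in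 Z$ one has $dg_q(T_qN)+T_{g(q)}Z=T_{g(q)}P$. A $C^1$ mapping $g:N\to\mathbb{R}^\ell$ is a mapping with normal crossings if for every integer $s\ge2$ the mapping $g^{(s)}:N^{(s)}\to(\mathbb{R}^\ell)^s$ is transverse to $\Delta_s$. *)

theory Defs
  imports "HOL-Analysis.Analysis" "HOL-Library.Extended_Nat"
begin

section \<open>Functions of class C^r in coordinates\<close>

text \<open>
  Tuples are indexed by an arbitrary finite set \<open>I\<close>; the coordinate space \<open>\<real>^I\<close> is
  \<^term>\<open>powertop_real I\<close>, whose points are the functions that are extensional on \<open>I\<close>.
  Index sets, rather than index types, are needed because the dimension of the \<open>s\<close>-fold product
  of a manifold depends on \<open>s\<close>.
\<close>

definition partial :: "'i \<Rightarrow> (('i \<Rightarrow> real) \<Rightarrow> real) \<Rightarrow> ('i \<Rightarrow> real) \<Rightarrow> real"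
  where "partial i h x = deriv (\<lambda>t. h (x(i := t))) (x i)"

text \<open>\<open>W\<close> is meant to be open in \<open>\<real>^I\<close>: all partial derivatives of order at most \<open>k\<close> exist and are
  continuous on \<open>W\<close>.\<close>

primrec C_nat_on :: "nat \<Rightarrow> 'i set \<Rightarrow> ('i \<Rightarrow> real) set \<Rightarrow> (('i \<Rightarrow> real) \<Rightarrow> real) \<Rightarrow> bool"
  where
    "C_nat_on 0 I W h \<longleftrightarrow>
      continuous_map (subtopology (powertop_real I) W) euclideanreal h"
  | "C_nat_on (Suc k) I W h \<longleftrightarrow>
      continuous_map (subtopology (powertop_real I) W) euclideanreal h \<and>
      (\<forall>i\<in>I. (\<forall>x\<in>W. (\<lambda>t. h (x(i := t))) field_differentiable at (x i)) \<and>
             C_nat_on k I W (partial i h))"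

definition C_on ::
    "enat \<Rightarrow> 'i set \<Rightarrow> 'j set \<Rightarrow> ('i \<Rightarrow> real) set \<Rightarrow> (('i \<Rightarrow> real) \<Rightarrow> 'j \<Rightarrow> real) \<Rightarrow> bool"
  where "C_on r I J W h \<longleftrightarrow> (\<forall>k. enat k \<le> r \<longrightarrow> (\<forall>j\<in>J. C_nat_on k I W (\<lambda>x. h x j)))"


section \<open>Manifolds and mappings of class C^r\<close>

type_synonym ('a, 'i) chart = "'a set \<times> ('a \<Rightarrow> 'i \<Rightarrow> real)"

record ('a, 'i) mfd =
  mtop :: "'a topology"
  idx :: "'i set"
  atlas :: "('a, 'i) chart set"

abbreviation mpoints :: "('a, 'i) mfd \<Rightarrow> 'a set"
  where "mpoints M \<equiv> topspace (mtop M)"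

definition is_chart :: "'a topology \<Rightarrow> 'i set \<Rightarrow> ('a, 'i) chart \<Rightarrow> bool"
  where "is_chart X I c \<longleftrightarrow> (case c of (D, \<phi>) \<Rightarrow>
    openin X D \<and> openin (powertop_real I) (\<phi> ` D) \<and>
    homeomorphic_map (subtopology X D) (subtopology (powertop_real I) (\<phi> ` D)) \<phi>)"

definition C_manifold :: "enat \<Rightarrow> nat \<Rightarrow> ('a, 'i) mfd \<Rightarrow> bool"
  where "C_manifold r n M \<longleftrightarrow>
    finite (idx M) \<and> card (idx M) = n \<and>
    Hausdorff_space (mtop M) \<and> second_countable (mtop M) \<and>
    (\<forall>c\<in>atlas M. is_chart (mtop M) (idx M) c) \<and>
    (\<Union>(D, \<phi>)\<in>atlas M. D) = mpoints M \<and>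
    (\<forall>(D, \<phi>)\<in>atlas M. \<forall>(D', \<phi>')\<in>atlas M.
       C_on r (idx M) (idx M) (\<phi> ` (D \<inter> D')) (\<phi>' \<circ> inv_into D \<phi>))"

definition C_map :: "enat \<Rightarrow> ('a, 'i) mfd \<Rightarrow> ('b, 'j) mfd \<Rightarrow> ('a \<Rightarrow> 'b) \<Rightarrow> bool"
  where "C_map r M P g \<longleftrightarrow>
    continuous_map (mtop M) (mtop P) g \<and>
    (\<forall>(D, \<phi>)\<in>atlas M. \<forall>(E, \<psi>)\<in>atlas P.
       C_on r (idx M) (idx P) (\<phi> ` {x\<in>D. g x \<in> E}) (\<psi> \<circ> g \<circ> inv_into D \<phi>))"

definition open_submanifold :: "('a, 'i) mfd \<Rightarrow> 'a set \<Rightarrow> ('a, 'i) mfd"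
  where "open_submanifold M W =
    \<lparr>mtop = subtopology (mtop M) W, idx = idx M, atlas = (\<lambda>(D, \<phi>). (D \<inter> W, \<phi>)) ` atlas M\<rparr>"

definition euclid :: "(real ^ 'k, 'k::finite) mfd"
  where "euclid = \<lparr>mtop = euclidean, idx = UNIV, atlas = {(UNIV, vec_nth)}\<rparr>"

text \<open>The \<open>s\<close>-fold product \<open>M^s\<close>, with the charts \<open>c\<^sub>1 \<times> \<dots> \<times> c\<^sub>s\<close>.\<close>

definition power_mfd :: "nat \<Rightarrow> ('a, 'i) mfd \<Rightarrow> (nat \<Rightarrow> 'a, nat \<times> 'i) mfd"
  where "power_mfd s M =
    \<lparr>mtop = product_topology (\<lambda>_. mtop M) {1..s},
     idx = {1..s} \<times> idx M,
     atlas = (\<lambda>c. (\<Pi>\<^sub>E k\<in>{1..s}. fst (c k),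
                   \<lambda>q. restrict (\<lambda>(k, i). snd (c k) (q k) i) ({1..s} \<times> idx M)))
             ` ({1..s} \<rightarrow>\<^sub>E atlas M)\<rparr>"


section \<open>Tangent spaces and transversality\<close>

text \<open>
  A tangent vector at \<open>p\<close> is the class of a \<open>C^1\<close> curve through \<open>p\<close>, two curves being equivalent
  if they have the same velocity at time 0 in the charts at \<open>p\<close>. The class is represented by
  the family of these velocities, indexed by the charts at \<open>p\<close>.
\<close>

definition charts_at :: "('a, 'i) mfd \<Rightarrow> 'a \<Rightarrow> ('a, 'i) chart set"
  where "charts_at M p = {c\<in>atlas M. p \<in> fst c}"

type_synonym ('a, 'i) tvec = "('a, 'i) chart \<Rightarrow> 'i \<Rightarrow> real"

definition curve_at :: "('a, 'i) mfd \<Rightarrow> 'a set \<Rightarrow> 'a \<Rightarrow> (real \<Rightarrow> 'a) \<Rightarrow> bool"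
  where "curve_at M Z p \<gamma> \<longleftrightarrow> \<gamma> 0 = p \<and>
    (\<exists>\<epsilon>>0. continuous_map (top_of_set {-\<epsilon><..<\<epsilon>}) (mtop M) \<gamma> \<and> \<gamma> ` {-\<epsilon><..<\<epsilon>} \<subseteq> Z \<and>
       (\<forall>(D, \<phi>)\<in>atlas M. \<forall>i\<in>idx M.
          (\<lambda>t. \<phi> (\<gamma> t) i) C1_differentiable_on {t\<in>{-\<epsilon><..<\<epsilon>}. \<gamma> t \<in> D}))"

definition velocity :: "('a, 'i) mfd \<Rightarrow> 'a \<Rightarrow> (real \<Rightarrow> 'a) \<Rightarrow> ('a, 'i) tvec"
  where "velocity M p \<gamma> =
    (\<lambda>c\<in>charts_at M p. \<lambda>i\<in>idx M. deriv (\<lambda>t. snd c (\<gamma> t) i) 0)"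

text \<open>For a submanifold \<open>Z\<close> of \<open>M\<close> the following is \<open>T\<^sub>p Z\<close>, as a subspace of \<open>T\<^sub>p M\<close>.\<close>

definition tangent_to :: "('a, 'i) mfd \<Rightarrow> 'a set \<Rightarrow> 'a \<Rightarrow> ('a, 'i) tvec set"
  where "tangent_to M Z p = velocity M p ` {\<gamma>. curve_at M Z p \<gamma>}"

abbreviation tangent_space :: "('a, 'i) mfd \<Rightarrow> 'a \<Rightarrow> ('a, 'i) tvec set"
  where "tangent_space M p \<equiv> tangent_to M (mpoints M) p"

definition tvec_add :: "('a, 'i) mfd \<Rightarrow> 'a \<Rightarrow> ('a, 'i) tvec \<Rightarrow> ('a, 'i) tvec \<Rightarrow> ('a, 'i) tvec"
  where "tvec_add M p v w = (\<lambda>c\<in>charts_at M p. \<lambda>i\<in>idx M. v c i + w c i)"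

text \<open>The class of \<open>\<gamma>\<close> is mapped to the class of \<open>g \<circ> \<gamma>\<close>; for a \<open>C^1\<close> mapping \<open>g\<close> this does not
  depend on the curve that is chosen.\<close>

definition differential ::
    "('a, 'i) mfd \<Rightarrow> ('b, 'j) mfd \<Rightarrow> ('a \<Rightarrow> 'b) \<Rightarrow> 'a \<Rightarrow> ('a, 'i) tvec \<Rightarrow> ('b, 'j) tvec"
  where "differential M P g p v =
    velocity P (g p) (g \<circ> (SOME \<gamma>. curve_at M (mpoints M) p \<gamma> \<and> velocity M p \<gamma> = v))"

definition transverse :: "('a, 'i) mfd \<Rightarrow> ('b, 'j) mfd \<Rightarrow> 'b set \<Rightarrow> ('a \<Rightarrow> 'b) \<Rightarrow> bool"
  where "transverse M P Z g \<longleftrightarrow> C_map 1 M P g \<and>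
    (\<forall>q\<in>mpoints M. g q \<in> Z \<longrightarrow>
       {tvec_add P (g q) v w | v w.
          v \<in> differential M P g q ` tangent_space M q \<and> w \<in> tangent_to P Z (g q)}
       = tangent_space P (g q))"


section \<open>Normal crossings\<close>

definition distinct_tuples :: "nat \<Rightarrow> 'a set \<Rightarrow> (nat \<Rightarrow> 'a) set"
  where "distinct_tuples s A = {q \<in> {1..s} \<rightarrow>\<^sub>E A. inj_on q {1..s}}"

definition config_mfd :: "nat \<Rightarrow> ('a, 'i) mfd \<Rightarrow> (nat \<Rightarrow> 'a, nat \<times> 'i) mfd"
  where "config_mfd s N = open_submanifold (power_mfd s N) (distinct_tuples s (mpoints N))"

definition tuple_map :: "nat \<Rightarrow> ('a \<Rightarrow> 'b) \<Rightarrow> (nat \<Rightarrow> 'a) \<Rightarrow> nat \<Rightarrow> 'b"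
  where "tuple_map s g q = (\<lambda>k\<in>{1..s}. g (q k))"

definition diagonal :: "nat \<Rightarrow> (nat \<Rightarrow> 'b) set"
  where "diagonal s = {(\<lambda>k\<in>{1..s}. y) | y. True}"

definition normal_crossings :: "('a, 'i) mfd \<Rightarrow> ('a \<Rightarrow> real ^ 'l) \<Rightarrow> bool"
  where "normal_crossings N g \<longleftrightarrow> C_map 1 N euclid g \<and>
    (\<forall>s\<ge>2. transverse (config_mfd s N) (power_mfd s euclid) (diagonal s) (tuple_map s g))"

text \<open>For a nonempty manifold of positive dimension, the set below is finite and contains 2.\<close>

definition s_inj :: "('a, 'i) mfd \<Rightarrow> ('a \<Rightarrow> real ^ 'm) \<Rightarrow> nat"
  where "s_inj N f = Max {s. 1 \<le> s \<and> (\<forall>q\<in>distinct_tuples s (mpoints N).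
    dim (span {f (q i) - f (q 1) | i. i \<in> {2..s}}) = s - 1)}"

end

theory Submission
  imports Defs
begin

text \<open>
  For \<open>s \<le> s\<^sub>f\<close> the vectors \<open>f q\<^sub>k - f q\<^sub>1\<close> are linearly independent, so the equations
  \<open>F\<^sub>\<pi> (f q\<^sub>k) = F\<^sub>\<pi> (f q\<^sub>1)\<close> (\<open>2 \<le> k \<le> s\<close>) in the unknowns \<open>(q, \<pi>)\<close> have rank \<open>\<ell> (s - 1)\<close> already with
  respect to \<open>\<pi>\<close>. The mapping for a given \<open>\<pi>\<close> fails to be transverse to the diagonal exactly if \<open>\<pi>\<close> is
  a critical value of the projection of the solution set to the parameters. The difference of
  dimensions is \<open>s (n - \<ell>) + \<ell>\<close>, hence these values are negligible by Sard's theorem in the sharp class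
  \<open>C^r\<close>, \<open>r > max (s (n - \<ell>) + \<ell>, 0)\<close>. If the fibres of \<open>F\<^sub>\<pi>\<close> have at most \<open>s\<^sub>f\<close> points, no tuple of more
  than \<open>s\<^sub>f\<close> distinct points is mapped to the diagonal, which yields normal crossings.

  Both the solution set and the reduction of Sard's theorem to mappings of rank 0 are treated by
  repeatedly replacing one variable \<open>x\<^sub>i\<close> by a function \<open>g x\<close> with \<open>\<partial>g/\<partial>x\<^sub>i \<noteq> 0\<close>.
\<close>

section \<open>Calculus on a finite set of active coordinates\<close>

text \<open>In one chart the unknowns are the s n coordinates of a tuple and the \<ell>m entries of
  the matrix of \<pi>; there are \<ell>(s - 1) equations, and the projection to the matrix has
  \<ell>m components. The excess s n - \<ell>(s - 1) = s(n - \<ell>) + \<ell> has to be paid for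
  with derivatives in Sard's theorem, and its maximum over s is \<open>s0\<close>. The rank
  statement is elementary: component a of the k-th equation, differentiated by the matrix entry (a,
  b), gives coordinate b of \<open>f (q k) - f (q 1)\<close>. Two obstacles shape the rest. A
  variable eliminated by a C^k function leaves the restricted mapping of class C^k only, which
  destroys the usual hierarchy of vanishing higher derivatives; a notion of vanishing order stable
  under such substitutions replaces it. And Fubini's theorem wants measurable sets, whereas critical
  values arise as images; hence the passage to compact cubes, whose critical values are measurable,
  and a notion of negligible set that asks only for a null superset. A countable atlas then
  assembles the local exceptional sets.\<close>

text \<open>
  Points are functions on the whole index type, and only the coordinates in \<open>I\<close> vary: openness,
  continuity and differentiability are taken within the affine slices \<open>x + \<real>^I\<close>. Restricting
  a mapping to a coordinate hyperplane then amounts to removing an index from \<open>I\<close>.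
\<close>

definition near :: "'i set \<Rightarrow> real \<Rightarrow> ('i \<Rightarrow> real) \<Rightarrow> ('i \<Rightarrow> real) \<Rightarrow> bool"
  where "near I d x y \<longleftrightarrow> (\<forall>k. k \<notin> I \<longrightarrow> y k = x k) \<and> (\<forall>k\<in>I. \<bar>y k - x k\<bar> < d)"

definition nbhd :: "'i set \<Rightarrow> ('i \<Rightarrow> real) \<Rightarrow> ('i \<Rightarrow> real) filter"
  where "nbhd I x = (INF d\<in>{0<..}. principal {y. near I d x y})"

definition iopen :: "'i set \<Rightarrow> ('i \<Rightarrow> real) set \<Rightarrow> bool"
  where "iopen I W \<longleftrightarrow> (\<forall>x\<in>W. \<forall>\<^sub>F y in nbhd I x. y \<in> W)"

definition icont :: "'i set \<Rightarrow> ('i \<Rightarrow> real) set \<Rightarrow> (('i \<Rightarrow> real) \<Rightarrow> real) \<Rightarrow> bool"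
  where "icont I W h \<longleftrightarrow> (\<forall>x\<in>W. (h \<longlongrightarrow> h x) (nbhd I x))"

definition idiff :: "'i set \<Rightarrow> ('i \<Rightarrow> real) set \<Rightarrow> (('i \<Rightarrow> real) \<Rightarrow> real) \<Rightarrow> bool"
  where "idiff I W h \<longleftrightarrow> (\<forall>i\<in>I. \<forall>x\<in>W. (\<lambda>t. h (x(i := t))) field_differentiable at (x i))"

primrec Ck :: "nat \<Rightarrow> 'i set \<Rightarrow> ('i \<Rightarrow> real) set \<Rightarrow> (('i \<Rightarrow> real) \<Rightarrow> real) \<Rightarrow> bool"
  where
    "Ck 0 I W h \<longleftrightarrow> icont I W h"
  | "Ck (Suc k) I W h \<longleftrightarrow> icont I W h \<and> idiff I W h \<and> (\<forall>i\<in>I. Ck k I W (partial i h))"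

lemma near_mono: "near I d x y \<Longrightarrow> d \<le> e \<Longrightarrow> near I e x y"
  unfolding near_def by fastforce

lemma near_refl [simp]: "0 < d \<Longrightarrow> near I d x x"
  unfolding near_def by auto

lemma near_subset: "near I d x y \<Longrightarrow> I \<subseteq> J \<Longrightarrow> 0 < d \<Longrightarrow> near J d x y"
  unfolding near_def by (metis abs_zero diff_self subsetD)

lemma eventually_nbhd: "eventually P (nbhd I x) \<longleftrightarrow> (\<exists>d>0. \<forall>y. near I d x y \<longrightarrow> P y)"
proof -
  have "eventually P (nbhd I x) \<longleftrightarrow> (\<exists>d\<in>{0<..}. eventually P (principal {y. near I d x y}))"
    unfolding nbhd_def
  proof (rule eventually_INF_base)
    fix a b :: real assume "a \<in> {0<..}" "b \<in> {0<..}"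
    then show "\<exists>c\<in>{0<..}. principal {y. near I c x y} \<le>
        inf (principal {y. near I a x y}) (principal {y. near I b x y})"
      by (intro bexI[of _ "min a b"]) (auto intro: near_mono)
  qed auto
  then show ?thesis by (auto simp: eventually_principal)
qed

lemma eventually_near: "0 < d \<Longrightarrow> \<forall>\<^sub>F y in nbhd I x. near I d x y"
  by (auto simp: eventually_nbhd)

lemma eventually_off: "\<forall>\<^sub>F y in nbhd I x. \<forall>k. k \<notin> I \<longrightarrow> y k = x k"
  unfolding eventually_nbhd near_def by (rule exI[of _ 1]) auto

lemma nbhd_mono: "I \<subseteq> J \<Longrightarrow> nbhd I x \<le> nbhd J x"
proof (rule filter_leI)
  fix P assume "I \<subseteq> J" "eventually P (nbhd J x)"
  then obtain d where "d > 0" "\<forall>y. near J d x y \<longrightarrow> P y" unfolding eventually_nbhd by auto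
  then show "eventually P (nbhd I x)"
    unfolding eventually_nbhd by (metis \<open>I \<subseteq> J\<close> near_subset)
qed

lemma iopen_mono: "I \<subseteq> J \<Longrightarrow> iopen J W \<Longrightarrow> iopen I W"
  unfolding iopen_def using filter_leD[OF nbhd_mono] by blast

lemma iopenD: "iopen I W \<Longrightarrow> x \<in> W \<Longrightarrow> \<exists>d>0. \<forall>y. near I d x y \<longrightarrow> y \<in> W"
  unfolding iopen_def eventually_nbhd by auto

lemma near_upd: "i \<in> I \<Longrightarrow> 0 < d \<Longrightarrow> near I d x (x(i := t)) \<longleftrightarrow> \<bar>t - x i\<bar> < d"
  unfolding near_def by auto

lemma iopen_near:
  assumes "finite I"
  shows "iopen I {y. near I d x y}"
  unfolding iopen_def eventually_nbhd
proof clarify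
  fix y assume y: "near I d x y"
  \<comment> \<open>The distance from \<open>y\<close> to the nearest face of the box; the inserted
    1 keeps \<open>Min\<close> meaningful when \<open>I\<close> is empty.\<close>
  define e where "e = Min (insert 1 ((\<lambda>k. d - \<bar>y k - x k\<bar>) ` I))"
  have fin: "finite (insert 1 ((\<lambda>k. d - \<bar>y k - x k\<bar>) ` I))" using assms by auto
  have pos: "e > 0" unfolding e_def using fin y by (subst Min_gr_iff) (auto simp: near_def)
  have le: "e \<le> d - \<bar>y k - x k\<bar>" if "k \<in> I" for k
    unfolding e_def using fin that by (intro Min_le) auto
  have "near I d x z" if z: "near I e y z" for z
    unfolding near_def
  proof (intro conjI allI ballI impI)
    fix k assume "k \<in> I"
    then show "\<bar>z k - x k\<bar> < d" using le[of k] z unfolding near_def by fastforce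
  qed (use y z in \<open>auto simp: near_def\<close>)
  then show "\<exists>da>0. \<forall>z. near I da y z \<longrightarrow> z \<in> {y. near I d x y}" using pos by auto
qed

lemma tendsto_nbhd: "(h \<longlongrightarrow> h x) (nbhd I x) \<longleftrightarrow>
    (\<forall>e>0. \<exists>d>0. \<forall>y. near I d x y \<longrightarrow> \<bar>h y - h x\<bar> < e)" for h :: "_ \<Rightarrow> real"
  unfolding tendsto_iff eventually_nbhd dist_real_def by auto

lemma icont_mono: "icont J W h \<Longrightarrow> I \<subseteq> J \<Longrightarrow> V \<subseteq> W \<Longrightarrow> icont I V h"
  unfolding icont_def using tendsto_mono[OF nbhd_mono] by blast

lemma Ck_mono: "Ck k J W h \<Longrightarrow> I \<subseteq> J \<Longrightarrow> V \<subseteq> W \<Longrightarrow> Ck k I V h"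
proof (induction k arbitrary: h)
  case 0 then show ?case using icont_mono by auto
next
  case (Suc k)
  then show ?case using icont_mono[of J W h I V] by (auto simp: idiff_def subset_iff)
qed

lemma icont_cong:
  assumes "iopen I W" "\<forall>x\<in>W. g x = h x" "icont I W g"
  shows "icont I W h"
  unfolding icont_def
proof
  fix x assume x: "x \<in> W"
  with assms(1) have "\<forall>\<^sub>F y in nbhd I x. y \<in> W" unfolding iopen_def by blast
  then have "\<forall>\<^sub>F y in nbhd I x. g y = h y" by (rule eventually_mono) (use assms(2) in blast)
  then show "(h \<longlongrightarrow> h x) (nbhd I x)"
    using Lim_transform_eventually[of g "g x" "nbhd I x" h] assms(2,3) x unfolding icont_def by simp
qed

lemma eventually_upd:
  assumes "iopen I W" "x \<in> W" "i \<in> I"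
  shows "\<forall>\<^sub>F t in nhds (x i). x(i := t) \<in> W"
proof -
  obtain d where d: "d > 0" "\<And>y. near I d x y \<Longrightarrow> y \<in> W" using iopenD assms by metis
  show ?thesis unfolding eventually_nhds_metric dist_real_def
    using d near_upd[OF assms(3) d(1)] by (metis)
qed

lemma has_deriv_cong:
  fixes g h :: "('i \<Rightarrow> real) \<Rightarrow> real"
  assumes "iopen I W" "\<forall>x\<in>W. g x = h x" "x \<in> W" "i \<in> I"
  shows "((\<lambda>t. g (x(i := t))) has_real_derivative D) (at (x i)) \<longleftrightarrow>
    ((\<lambda>t. h (x(i := t))) has_real_derivative D) (at (x i))"
proof (rule DERIV_cong_ev)
  show "\<forall>\<^sub>F t in nhds (x i). g (x(i := t)) = h (x(i := t))"
    using eventually_upd[OF assms(1,3,4)] by (rule eventually_mono) (use assms(2) in auto)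
qed auto

lemma partial_cong:
  assumes "iopen I W" "\<forall>x\<in>W. g x = h x" "x \<in> W" "i \<in> I"
  shows "partial i g x = partial i h x"
  unfolding partial_def deriv_def using has_deriv_cong[OF assms] by simp

lemma idiff_cong:
  assumes "iopen I W" "\<forall>x\<in>W. g x = h x" "idiff I W g"
  shows "idiff I W h"
  using assms(3) has_deriv_cong[OF assms(1,2)] unfolding idiff_def field_differentiable_def by blast

text \<open>\<open>partial\<close> is computed from a function on the whole space; openness of
  \<open>W\<close> in the slices makes agreement on \<open>W\<close> pass to the derivatives of
  every order. A function may thus be replaced by any formula valid on \<open>W\<close>.\<close>

lemma Ck_cong:
  assumes "iopen I W" "\<forall>x\<in>W. g x = h x" "Ck k I W g"
  shows "Ck k I W h"
  using assms(2,3)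
proof (induction k arbitrary: g h)
  case 0 then show ?case using icont_cong[OF assms(1)] by auto
next
  case (Suc k)
  have "Ck k I W (partial i h)" if "i \<in> I" for i
  proof (rule Suc.IH)
    show "\<forall>x\<in>W. partial i g x = partial i h x"
      using partial_cong[OF assms(1) Suc.prems(1) _ that] by blast
    show "Ck k I W (partial i g)" using Suc.prems(2) that by simp
  qed
  with Suc show ?case
    using icont_cong[OF assms(1) Suc.prems(1)] idiff_cong[OF assms(1) Suc.prems(1)] by auto
qed

lemma Ck_icont: "Ck k I W h \<Longrightarrow> icont I W h"
  by (cases k) auto

lemma Ck_Suc_D: "Ck (Suc k) I W h \<Longrightarrow> Ck k I W h"
  by (induction k arbitrary: h) auto

lemma Ck_le: "l \<le> k \<Longrightarrow> Ck k I W h \<Longrightarrow> Ck l I W h"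
  by (induction k rule: dec_induct) (auto dest: Ck_Suc_D simp del: Ck.simps)

lemma idiff_partial:
  assumes "idiff I W h" "i \<in> I" "x \<in> W"
  shows "((\<lambda>t. h (x(i := t))) has_real_derivative partial i h x) (at (x i))"
  using assms unfolding idiff_def partial_def by (simp add: DERIV_deriv_iff_field_differentiable)

lemma partialI:
  "((\<lambda>t. h (x(i := t))) has_real_derivative D) (at (x i)) \<Longrightarrow> partial i h x = D"
  unfolding partial_def by (rule DERIV_imp_deriv)

text \<open>The way to climb one order: the derivatives are supplied as explicit formulas
  \<open>D i\<close>, whose class is then settled by an induction hypothesis.\<close>

lemma Ck_SucI:
  assumes "iopen I W" "icont I W h"
    and "\<And>i x. i \<in> I \<Longrightarrow> x \<in> W \<Longrightarrow> ((\<lambda>t. h (x(i := t))) has_real_derivative D i x) (at (x i))"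
    and "\<And>i. i \<in> I \<Longrightarrow> Ck k I W (D i)"
  shows "Ck (Suc k) I W h"
proof -
  have "Ck k I W (partial i h)" if i: "i \<in> I" for i
  proof (rule Ck_cong[OF assms(1) _ assms(4)[OF i]], rule ballI)
    fix x assume "x \<in> W"
    show "D i x = partial i h x" using partialI[OF assms(3)[OF i \<open>x \<in> W\<close>]] by simp
  qed
  moreover have "idiff I W h" using assms(3) unfolding idiff_def field_differentiable_def by blast
  ultimately show ?thesis using assms(2) by simp
qed

section \<open>Algebra of functions of class C^k\<close>

lemma Ck_const [simp]: "Ck k I W (\<lambda>x. c)"
proof (induction k arbitrary: c)
  case 0 show ?case by (simp add: icont_def)
next
  case (Suc k)
  have "partial i (\<lambda>x. c) = (\<lambda>x. 0)" for i :: 'a by (auto simp: partial_def)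
  then show ?case using Suc by (auto simp: icont_def idiff_def)
qed

lemma icont_coord: "icont I W (\<lambda>x. x i)"
  unfolding icont_def
proof (intro ballI iffD2[OF tendsto_nbhd[of "\<lambda>x. x i"]] allI impI)
  fix x and e :: real assume "x \<in> W" "e > 0"
  then have "\<bar>y i - x i\<bar> < e" if "near I e x y" for y
    using that by (cases "i \<in> I") (auto simp: near_def)
  then show "\<exists>d>0. \<forall>y. near I d x y \<longrightarrow> \<bar>y i - x i\<bar> < e" using \<open>e > 0\<close> by blast
qed

lemma Ck_coord: "Ck k I W (\<lambda>x. x i)"
proof (cases k)
  case 0 then show ?thesis by (simp add: icont_coord)
next
  case (Suc l)
  have "partial j (\<lambda>x. x i) = (\<lambda>x. if j = i then 1 else 0)" for j
    by (auto simp: partial_def fun_eq_iff fun_upd_apply)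
  moreover have "(\<lambda>t. (x(j := t)) i) field_differentiable at (x j)" for x and j
    by (cases "j = i") auto
  ultimately show ?thesis using Suc by (auto simp: icont_coord idiff_def)
qed

lemma icont_add: "icont I W g \<Longrightarrow> icont I W h \<Longrightarrow> icont I W (\<lambda>x. g x + h x)"
  unfolding icont_def by (auto intro: tendsto_add)

lemma icont_mult: "icont I W g \<Longrightarrow> icont I W h \<Longrightarrow> icont I W (\<lambda>x. g x * h x)"
  unfolding icont_def by (auto intro: tendsto_mult)

lemma Ck_add:
  assumes "iopen I W"
  shows "Ck k I W g \<Longrightarrow> Ck k I W h \<Longrightarrow> Ck k I W (\<lambda>x. g x + h x)"
proof (induction k arbitrary: g h)
  case 0 then show ?case by (simp add: icont_add)
next
  case (Suc k)
  show ?case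
  proof (rule Ck_SucI[OF assms, where D = "\<lambda>i x. partial i g x + partial i h x"])
    show "icont I W (\<lambda>x. g x + h x)" using Suc.prems by (simp add: icont_add)
  next
    fix i x assume "i \<in> I" "x \<in> W"
    then show "((\<lambda>t. g (x(i := t)) + h (x(i := t))) has_real_derivative
        partial i g x + partial i h x) (at (x i))"
      using Suc.prems by (intro DERIV_add idiff_partial) auto
  next
    fix i assume "i \<in> I"
    then show "Ck k I W (\<lambda>x. partial i g x + partial i h x)" using Suc by simp
  qed
qed

lemma Ck_mult:
  assumes "iopen I W"
  shows "Ck k I W g \<Longrightarrow> Ck k I W h \<Longrightarrow> Ck k I W (\<lambda>x. g x * h x)"
proof (induction k arbitrary: g h)
  case 0 then show ?case by (simp add: icont_mult)
next
  case (Suc k)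
  show ?case
  proof (rule Ck_SucI[OF assms, where D = "\<lambda>i x. partial i g x * h x + partial i h x * g x"])
    show "icont I W (\<lambda>x. g x * h x)" using Suc.prems by (simp add: icont_mult)
  next
    fix i x assume "i \<in> I" "x \<in> W"
    then show "((\<lambda>t. g (x(i := t)) * h (x(i := t))) has_real_derivative
        partial i g x * h x + partial i h x * g x) (at (x i))"
      using Suc.prems DERIV_mult[OF idiff_partial[of I W g i x] idiff_partial[of I W h i x]] by auto
  next
    fix i assume "i \<in> I"
    then show "Ck k I W (\<lambda>x. partial i g x * h x + partial i h x * g x)"
      using Suc by (intro Ck_add[OF assms] Suc.IH) (auto intro: Ck_Suc_D)
  qed
qed

lemma Ck_uminus: "iopen I W \<Longrightarrow> Ck k I W g \<Longrightarrow> Ck k I W (\<lambda>x. - g x)"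
  using Ck_mult[of I W k "\<lambda>x. -1" g] by simp

lemma Ck_diff:
  "iopen I W \<Longrightarrow> Ck k I W g \<Longrightarrow> Ck k I W h \<Longrightarrow> Ck k I W (\<lambda>x. g x - h x)"
  using Ck_add[of I W k g "\<lambda>x. - h x"] Ck_uminus[of I W k h] by simp

lemma Ck_sum:
  "iopen I W \<Longrightarrow> (\<And>a. a \<in> A \<Longrightarrow> Ck k I W (g a)) \<Longrightarrow> Ck k I W (\<lambda>x. \<Sum>a\<in>A. g a x)"
  by (induction A rule: infinite_finite_induct) (auto intro: Ck_add)

lemma Ck_inverse:
  assumes "iopen I W" "\<And>x. x \<in> W \<Longrightarrow> g x \<noteq> 0"
  shows "Ck k I W g \<Longrightarrow> Ck k I W (\<lambda>x. inverse (g x))"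
proof (induction k)
  case 0 then show ?case using assms(2) by (auto simp: icont_def intro!: tendsto_inverse)
next
  case (Suc k)
  show ?case
  proof (rule Ck_SucI[OF assms(1), where D = "\<lambda>i x. - (partial i g x * (inverse (g x) * inverse (g x)))"])
    show "icont I W (\<lambda>x. inverse (g x))"
      using Suc.prems assms(2) by (auto simp: icont_def intro!: tendsto_inverse)
  next
    fix i x assume "i \<in> I" "x \<in> W"
    then show "((\<lambda>t. inverse (g (x(i := t)))) has_real_derivative
        - (partial i g x * (inverse (g x) * inverse (g x)))) (at (x i))"
      using Suc.prems DERIV_inverse_fun[OF idiff_partial[of I W g i x]] assms(2)
      by (auto simp: power2_eq_square)
  next
    fix i assume "i \<in> I"
    then show "Ck k I W (\<lambda>x. - (partial i g x * (inverse (g x) * inverse (g x))))"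
      using Suc Ck_Suc_D[OF Suc.prems]
      by (intro Ck_uminus[OF assms(1)] Ck_mult[OF assms(1)] Suc.IH) auto
  qed
qed

section \<open>Chain rule\<close>

lemma mvt_between:
  fixes \<phi> \<phi>' :: "real \<Rightarrow> real"
  assumes "\<And>t. min a b \<le> t \<Longrightarrow> t \<le> max a b \<Longrightarrow> (\<phi> has_real_derivative \<phi>' t) (at t)"
  shows "\<exists>\<xi>. min a b \<le> \<xi> \<and> \<xi> \<le> max a b \<and> \<phi> b - \<phi> a = (b - a) * \<phi>' \<xi>"
proof (cases a b rule: linorder_cases)
  case less
  obtain z where "a < z" "z < b" "\<phi> b - \<phi> a = (b - a) * \<phi>' z"
    using MVT2[OF less, of \<phi> \<phi>'] assms less by auto
  then show ?thesis by (intro exI[of _ z]) auto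
next
  case equal then show ?thesis by auto
next
  case greater
  obtain z where "b < z" "z < a" "\<phi> a - \<phi> b = (a - b) * \<phi>' z"
    using MVT2[OF greater, of \<phi> \<phi>'] assms greater by auto
  then show ?thesis by (intro exI[of _ z]) (auto simp: algebra_simps)
qed

text \<open>The path from \<open>x\<close> to \<open>y\<close> changes one coordinate at a time. On
  each leg the mean value theorem produces a partial derivative at an intermediate point, which
  differs from the one at \<open>x\<close> by less than \<open>e\<close>.\<close>

lemma total_differential:
  assumes fin: "finite I" and W: "iopen I W" "x \<in> W" and d: "idiff I W h"
    and c: "\<forall>i\<in>I. icont I W (partial i h)" and "0 < e"
  shows "\<forall>\<^sub>F y in nbhd I x. \<bar>h y - h x - (\<Sum>i\<in>I. partial i h x * (y i - x i))\<bar>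
    \<le> e * (\<Sum>i\<in>I. \<bar>y i - x i\<bar>)"
proof -
  have "\<forall>\<^sub>F y in nbhd I x. \<forall>i\<in>I. \<bar>partial i h y - partial i h x\<bar> < e"
  proof (rule eventually_ball_finite[OF fin], rule ballI)
    fix i assume "i \<in> I"
    then have "(partial i h \<longlongrightarrow> partial i h x) (nbhd I x)" using c W(2) by (auto simp: icont_def)
    then show "\<forall>\<^sub>F y in nbhd I x. \<bar>partial i h y - partial i h x\<bar> < e"
      using \<open>0 < e\<close> by (auto simp: tendsto_iff dist_real_def)
  qed
  moreover have "\<forall>\<^sub>F y in nbhd I x. y \<in> W" using W by (auto simp: iopen_def)
  ultimately have "\<forall>\<^sub>F y in nbhd I x. (\<forall>i\<in>I. \<bar>partial i h y - partial i h x\<bar> < e) \<and> y \<in> W"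
    by (rule eventually_conj)
  then obtain d where "d > 0" and W': "\<And>y. near I d x y \<Longrightarrow> y \<in> W"
    and c': "\<And>y i. near I d x y \<Longrightarrow> i \<in> I \<Longrightarrow> \<bar>partial i h y - partial i h x\<bar> < e"
    unfolding eventually_nbhd by auto
  have "\<bar>h y - h x - (\<Sum>i\<in>I. partial i h x * (y i - x i))\<bar> \<le> e * (\<Sum>i\<in>I. \<bar>y i - x i\<bar>)"
    if y: "near I d x y" for y
  proof -
    \<comment> \<open>The corner of the path at which the coordinates in \<open>S\<close> have
      already moved to \<open>y\<close>.\<close>
    define p where "p S = (\<lambda>k. if k \<in> S then y k else x k)" for S
    have "\<bar>h (p S) - h x - (\<Sum>i\<in>S. partial i h x * (y i - x i))\<bar> \<le> e * (\<Sum>i\<in>S. \<bar>y i - x i\<bar>)"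
      if "finite S" "S \<subseteq> I" for S using that
    proof (induction S)
      case empty show ?case by (simp add: p_def)
    next
      case (insert i S)
      define \<phi> where "\<phi> = (\<lambda>t. h ((p S)(i := t)))"
      have pn: "near I d x ((p S)(i := t))" if "min (x i) (y i) \<le> t" "t \<le> max (x i) (y i)" for t
      proof -
        have "\<bar>t - x i\<bar> \<le> \<bar>y i - x i\<bar>" using that by (auto simp: min_def max_def split: if_splits)
        with y insert.prems \<open>d > 0\<close> show ?thesis by (auto simp: near_def p_def)
      qed
      have der: "(\<phi> has_real_derivative partial i h ((p S)(i := t))) (at t)"
        if "min (x i) (y i) \<le> t" "t \<le> max (x i) (y i)" for t
        using idiff_partial[OF d, of i "(p S)(i := t)"] W'[OF pn[OF that]] insert.prems
        by (simp add: \<phi>_def)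
      from mvt_between[OF der] obtain \<xi> where \<xi>: "min (x i) (y i) \<le> \<xi>" "\<xi> \<le> max (x i) (y i)"
        "\<phi> (y i) - \<phi> (x i) = (y i - x i) * partial i h ((p S)(i := \<xi>))" by blast
      have 1: "\<phi> (y i) = h (p (insert i S))" "\<phi> (x i) = h (p S)"
        unfolding \<phi>_def p_def using insert.hyps by (auto intro!: arg_cong[of _ _ h])
      have "\<bar>h (p (insert i S)) - h (p S) - partial i h x * (y i - x i)\<bar>
          = \<bar>y i - x i\<bar> * \<bar>partial i h ((p S)(i := \<xi>)) - partial i h x\<bar>"
        using \<xi>(3) unfolding 1 by (simp add: abs_mult[symmetric] algebra_simps)
      also have "\<dots> \<le> \<bar>y i - x i\<bar> * e"
        using c'[OF pn[OF \<xi>(1,2)], of i] insert.prems by (intro mult_left_mono) auto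
      finally have "\<bar>h (p (insert i S)) - h (p S) - partial i h x * (y i - x i)\<bar> \<le> e * \<bar>y i - x i\<bar>"
        by (simp add: mult.commute)
      with insert show ?case by (simp add: distrib_left)
    qed
    from this[OF fin order_refl] have "\<bar>h (p I) - h x - (\<Sum>i\<in>I. partial i h x * (y i - x i))\<bar>
      \<le> e * (\<Sum>i\<in>I. \<bar>y i - x i\<bar>)" .
    moreover have "p I = y" using y by (auto simp: p_def near_def)
    ultimately show ?thesis by simp
  qed
  then show ?thesis using \<open>d > 0\<close> unfolding eventually_nbhd by blast
qed

lemma filterlim_nbhd:
  assumes "finite I" "\<forall>i\<in>I. ((\<lambda>t. c t i) \<longlongrightarrow> x i) F" "\<forall>\<^sub>F t in F. \<forall>k. k \<notin> I \<longrightarrow> c t k = x k"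
  shows "filterlim c (nbhd I x) F"
  unfolding filterlim_iff
proof (intro allI impI)
  fix P assume "eventually P (nbhd I x)"
  then obtain d where d: "d > 0" "\<And>y. near I d x y \<Longrightarrow> P y" unfolding eventually_nbhd by auto
  have "\<forall>\<^sub>F t in F. \<forall>i\<in>I. \<bar>c t i - x i\<bar> < d"
    using assms(2) d(1) by (intro eventually_ball_finite[OF assms(1)]) (auto simp: tendsto_iff dist_real_def)
  with assms(3) have "\<forall>\<^sub>F t in F. near I d x (c t)"
    unfolding near_def by (rule eventually_conj)
  then show "\<forall>\<^sub>F t in F. P (c t)" by (rule eventually_mono) (rule d(2))
qed

text \<open>The remainder in the total differential is small compared with the increment of the
  curve, and this increment is O(t - t0) because the components are differentiable at
  \<open>t0\<close>.\<close>

lemma chain_rule_curve: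
  assumes fin: "finite I" and W: "iopen I W" "c t0 \<in> W" and d: "idiff I W h"
    and ct: "\<forall>i\<in>I. icont I W (partial i h)"
    and off: "\<forall>\<^sub>F t in at t0. \<forall>k. k \<notin> I \<longrightarrow> c t k = c t0 k"
    and v: "\<forall>i\<in>I. ((\<lambda>t. c t i) has_real_derivative v i) (at t0)"
  shows "((\<lambda>t. h (c t)) has_real_derivative (\<Sum>i\<in>I. partial i h (c t0) * v i)) (at t0)"
proof -
  have lim: "filterlim c (nbhd I (c t0)) (at t0)"
    using v DERIV_isCont unfolding isCont_def by (intro filterlim_nbhd[OF fin _ off]) blast
  \<comment> \<open>An eventual strict bound for the sum of the absolute difference quotients, whose
    limit is smaller by 1.\<close>
  define B where "B = (\<Sum>i\<in>I. \<bar>v i\<bar>) + 1"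
  have "B > 0" unfolding B_def by (intro add_nonneg_pos sum_nonneg) auto
  have q: "((\<lambda>t. (c t i - c t0 i) / (t - t0)) \<longlongrightarrow> v i) (at t0)" if "i \<in> I" for i
    using v that by (auto simp: has_field_derivative_iff)
  have "((\<lambda>t. \<Sum>i\<in>I. \<bar>(c t i - c t0 i) / (t - t0)\<bar>) \<longlongrightarrow> (\<Sum>i\<in>I. \<bar>v i\<bar>)) (at t0)"
    using q by (intro tendsto_sum tendsto_rabs)
  then have bd: "\<forall>\<^sub>F t in at t0. (\<Sum>i\<in>I. \<bar>(c t i - c t0 i) / (t - t0)\<bar>) < B"
    by (rule order_tendstoD) (simp add: B_def)
  define \<rho> where "\<rho> t = h (c t) - h (c t0) - (\<Sum>i\<in>I. partial i h (c t0) * (c t i - c t0 i))" for t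
  have "((\<lambda>t. \<rho> t / (t - t0)) \<longlongrightarrow> 0) (at t0)"
    unfolding tendsto_iff
  proof (intro allI impI)
    fix e :: real assume "e > 0"
    define e' where "e' = e / (2 * B)"
    have "e' > 0" using \<open>e > 0\<close> \<open>B > 0\<close> by (simp add: e'_def)
    have "\<forall>\<^sub>F t in at t0. \<bar>\<rho> t\<bar> \<le> e' * (\<Sum>i\<in>I. \<bar>c t i - c t0 i\<bar>)"
      using filterlim_iff[THEN iffD1, OF lim, rule_format,
          OF total_differential[OF fin W d ct \<open>e' > 0\<close>]]
      unfolding \<rho>_def .
    moreover note bd
    moreover have "\<forall>\<^sub>F t in at t0. t \<noteq> t0" by (simp add: eventually_at_filter)
    ultimately show "\<forall>\<^sub>F t in at t0. dist (\<rho> t / (t - t0)) 0 < e"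
    proof eventually_elim
      case (elim t)
      have "\<bar>\<rho> t / (t - t0)\<bar> \<le> e' * (\<Sum>i\<in>I. \<bar>c t i - c t0 i\<bar>) / \<bar>t - t0\<bar>"
        using elim(1) by (simp add: abs_divide divide_right_mono)
      also have "\<dots> = e' * (\<Sum>i\<in>I. \<bar>(c t i - c t0 i) / (t - t0)\<bar>)"
        by (simp add: abs_divide sum_divide_distrib[symmetric])
      also have "\<dots> \<le> e' * B" using elim(2) \<open>e' > 0\<close> by simp
      also have "\<dots> < e" using \<open>e > 0\<close> \<open>B > 0\<close> by (simp add: e'_def)
      finally show ?case by simp
    qed
  qed
  moreover have "((\<lambda>t. \<Sum>i\<in>I. partial i h (c t0) * ((c t i - c t0 i) / (t - t0)))
      \<longlongrightarrow> (\<Sum>i\<in>I. partial i h (c t0) * v i)) (at t0)"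
    using q by (intro tendsto_sum tendsto_mult_left)
  ultimately have "((\<lambda>t. \<rho> t / (t - t0) + (\<Sum>i\<in>I. partial i h (c t0) * ((c t i - c t0 i) / (t - t0))))
      \<longlongrightarrow> 0 + (\<Sum>i\<in>I. partial i h (c t0) * v i)) (at t0)"
    by (rule tendsto_add)
  moreover have "\<rho> t / (t - t0) + (\<Sum>i\<in>I. partial i h (c t0) * ((c t i - c t0 i) / (t - t0)))
      = (h (c t) - h (c t0)) / (t - t0)" for t
    unfolding \<rho>_def by (simp add: diff_divide_distrib[of "h _ - _"] diff_divide_distrib[of "h (c t)"] sum_divide_distrib)
  ultimately show ?thesis by (simp add: has_field_derivative_iff)
qed

definition C1 :: "'i set \<Rightarrow> ('i \<Rightarrow> real) set \<Rightarrow> (('i \<Rightarrow> real) \<Rightarrow> real) \<Rightarrow> bool"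
  where "C1 I W h \<longleftrightarrow> icont I W h \<and> idiff I W h \<and> (\<forall>i\<in>I. icont I W (partial i h))"

lemma Ck_Suc_C1: "Ck (Suc k) I W h \<Longrightarrow> C1 I W h"
  using Ck_icont[of k I W] unfolding C1_def by auto

lemma C1_idiff: "C1 I W h \<Longrightarrow> idiff I W h"
  by (simp add: C1_def)

text \<open>\<open>\<phi>\<close> carries the points of \<open>V\<close> in one
  \<open>I\<close>-slice into one \<open>J\<close>-slice. Without this, continuity of the components
  in \<open>J\<close> would say nothing about \<open>\<phi>\<close> with respect to slice
  neighbourhoods.\<close>

definition compat :: "'i set \<Rightarrow> ('i \<Rightarrow> real) set \<Rightarrow> 'j set \<Rightarrow> (('i \<Rightarrow> real) \<Rightarrow> 'j \<Rightarrow> real) \<Rightarrow> bool"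
  where "compat I V J \<phi> \<longleftrightarrow>
    (\<forall>x\<in>V. \<forall>y\<in>V. (\<forall>i. i \<notin> I \<longrightarrow> x i = y i) \<longrightarrow> (\<forall>k. k \<notin> J \<longrightarrow> \<phi> x k = \<phi> y k))"

lemma filterlim_map:
  assumes "finite J" "iopen I V" "compat I V J \<phi>" "\<forall>j\<in>J. icont I V (\<lambda>y. \<phi> y j)" "x \<in> V"
  shows "filterlim \<phi> (nbhd J (\<phi> x)) (nbhd I x)"
proof (rule filterlim_nbhd[OF assms(1)])
  show "\<forall>j\<in>J. ((\<lambda>t. \<phi> t j) \<longlongrightarrow> \<phi> x j) (nbhd I x)" using assms(4,5) by (auto simp: icont_def)
  have "\<forall>\<^sub>F y in nbhd I x. y \<in> V" using assms(2,5) by (auto simp: iopen_def)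
  with eventually_off show "\<forall>\<^sub>F t in nbhd I x. \<forall>k. k \<notin> J \<longrightarrow> \<phi> t k = \<phi> x k"
  proof eventually_elim
    case (elim y) then show ?case using assms(3,5) unfolding compat_def by blast
  qed
qed

lemma icont_compose:
  assumes "finite J" "iopen I V" "compat I V J \<phi>" "\<forall>j\<in>J. icont I V (\<lambda>y. \<phi> y j)"
    and "\<forall>y\<in>V. \<phi> y \<in> W" "icont J W h"
  shows "icont I V (\<lambda>y. h (\<phi> y))"
  unfolding icont_def
proof
  fix x assume x: "x \<in> V"
  then have "(h \<longlongrightarrow> h (\<phi> x)) (nbhd J (\<phi> x))" using assms(5,6) by (auto simp: icont_def)
  from filterlim_compose[OF this filterlim_map[OF assms(1-4) x]]
  show "((\<lambda>y. h (\<phi> y)) \<longlongrightarrow> h (\<phi> x)) (nbhd I x)" .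
qed

lemma iopen_vimage:
  assumes "finite J" "iopen I V" "compat I V J \<phi>" "\<forall>j\<in>J. icont I V (\<lambda>y. \<phi> y j)" "iopen J W"
  shows "iopen I {y\<in>V. \<phi> y \<in> W}"
  unfolding iopen_def
proof clarify
  fix x assume x: "x \<in> V" "\<phi> x \<in> W"
  then have "\<forall>\<^sub>F z in nbhd J (\<phi> x). z \<in> W" using assms(5) by (auto simp: iopen_def)
  then have "\<forall>\<^sub>F y in nbhd I x. \<phi> y \<in> W"
    using filterlim_map[OF assms(1-4) x(1)] unfolding filterlim_iff by blast
  moreover have "\<forall>\<^sub>F y in nbhd I x. y \<in> V" using assms(2) x by (auto simp: iopen_def)
  ultimately show "\<forall>\<^sub>F y in nbhd I x. y \<in> {y\<in>V. \<phi> y \<in> W}" by eventually_elim auto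
qed

lemma chain_rule:
  assumes "finite J" "iopen I V" "iopen J W" "compat I V J \<phi>"
    and "\<forall>j\<in>J. idiff I V (\<lambda>y. \<phi> y j)" "\<forall>y\<in>V. \<phi> y \<in> W" "C1 J W h" "x \<in> V" "i \<in> I"
  shows "((\<lambda>t. h (\<phi> (x(i := t)))) has_real_derivative
    (\<Sum>j\<in>J. partial j h (\<phi> x) * partial i (\<lambda>y. \<phi> y j) x)) (at (x i))"
proof -
  have ev: "\<forall>\<^sub>F t in at (x i). x(i := t) \<in> V"
    using eventually_upd[OF assms(2,8,9)] by (simp add: eventually_nhds_conv_at)
  have "\<forall>\<^sub>F t in at (x i). \<forall>k. k \<notin> J \<longrightarrow> \<phi> (x(i := t)) k = \<phi> (x(i := x i)) k"
    using ev
  proof eventually_elim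
    case (elim t)
    have "\<forall>k. k \<notin> I \<longrightarrow> (x(i := t)) k = x k" using assms(9) by auto
    with elim assms(4,8) show ?case unfolding compat_def fun_upd_triv by blast
  qed
  moreover have "\<forall>j\<in>J. ((\<lambda>t. \<phi> (x(i := t)) j) has_real_derivative partial i (\<lambda>y. \<phi> y j) x) (at (x i))"
  proof
    fix j assume "j \<in> J"
    then show "((\<lambda>t. \<phi> (x(i := t)) j) has_real_derivative partial i (\<lambda>y. \<phi> y j) x) (at (x i))"
      using idiff_partial[of I V "\<lambda>y. \<phi> y j", OF _ assms(9,8)] assms(5) by blast
  qed
  ultimately show ?thesis
    using chain_rule_curve[OF assms(1,3), where c = "\<lambda>t. \<phi> (x(i := t))" and ?t0.0 = "x i" and h = h
        and v = "\<lambda>j. partial i (\<lambda>y. \<phi> y j) x"] assms(6-8)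
    unfolding C1_def fun_upd_triv by blast
qed

lemma Ck_compose:
  assumes "finite J" "iopen I V" "iopen J W" "compat I V J \<phi>" "\<forall>y\<in>V. \<phi> y \<in> W"
  shows "\<forall>j\<in>J. Ck k I V (\<lambda>y. \<phi> y j) \<Longrightarrow> Ck k J W h \<Longrightarrow> Ck k I V (\<lambda>y. h (\<phi> y))"
proof (induction k arbitrary: h)
  case 0 then show ?case using icont_compose[OF assms(1,2,4) _ assms(5)] by simp
next
  case (Suc k)
  show ?case
  proof (rule Ck_SucI[OF assms(2)])
    show "icont I V (\<lambda>y. h (\<phi> y))"
      using Suc.prems by (intro icont_compose[OF assms(1,2,4) _ assms(5)]) auto
    show "((\<lambda>t. h (\<phi> (x(i := t)))) has_real_derivative
        (\<Sum>j\<in>J. partial j h (\<phi> x) * partial i (\<lambda>y. \<phi> y j) x)) (at (x i))"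
      if "i \<in> I" "x \<in> V" for i x
    proof (rule chain_rule[OF assms(1-4) _ assms(5) _ that(2,1)])
      show "\<forall>j\<in>J. idiff I V (\<lambda>y. \<phi> y j)" using Suc.prems(1) by simp
      show "C1 J W h" by (rule Ck_Suc_C1[OF Suc.prems(2)])
    qed
    show "Ck k I V (\<lambda>x. \<Sum>j\<in>J. partial j h (\<phi> x) * partial i (\<lambda>y. \<phi> y j) x)" if "i \<in> I" for i
    proof (intro Ck_sum[OF assms(2)] Ck_mult[OF assms(2)])
      fix j assume "j \<in> J"
      show "Ck k I V (\<lambda>x. partial j h (\<phi> x))"
      proof (rule Suc.IH)
        show "\<forall>j\<in>J. Ck k I V (\<lambda>y. \<phi> y j)" using Suc.prems(1) Ck_Suc_D by blast
        show "Ck k J W (partial j h)" using Suc.prems(2) \<open>j \<in> J\<close> by simp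
      qed
      show "Ck k I V (partial i (\<lambda>y. \<phi> y j))" using Suc.prems(1) that \<open>j \<in> J\<close> by simp
    qed
  qed
qed

section \<open>Inverting one coordinate\<close>

lemma compat_upd: "i \<in> I \<Longrightarrow> compat I V I (\<lambda>y. y(i := \<gamma> y))"
  unfolding compat_def by auto

lemma icont_upd:
  assumes "icont I V \<gamma>"
  shows "icont I V (\<lambda>y. (y(i := \<gamma> y)) j)"
  using assms icont_coord[of I V j] by (cases "j = i") auto

lemma Ck_upd:
  assumes "Ck k I V \<gamma>"
  shows "Ck k I V (\<lambda>y. (y(i := \<gamma> y)) j)"
  using assms Ck_coord[of k I V j] by (cases "j = i") auto

lemma Ck_substitute:
  assumes "finite I" "iopen I V" "iopen I W" "i \<in> I" "\<forall>y\<in>V. y(i := \<gamma> y) \<in> W"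
    and "Ck k I V \<gamma>" "Ck k I W h"
  shows "Ck k I V (\<lambda>y. h (y(i := \<gamma> y)))"
  by (rule Ck_compose[OF assms(1-3) compat_upd[OF assms(4)] assms(5) _ assms(7)])
    (use Ck_upd[OF assms(6)] in blast)

lemma icont_substitute:
  assumes "finite I" "iopen I V" "i \<in> I" "\<forall>y\<in>V. y(i := \<gamma> y) \<in> W"
    and "icont I V \<gamma>" "icont I W h"
  shows "icont I V (\<lambda>y. h (y(i := \<gamma> y)))"
  by (rule icont_compose[OF assms(1,2) compat_upd[OF assms(3)] _ assms(4,6)])
    (use icont_upd[OF assms(5)] in blast)

text \<open>For \<open>l = i\<close> the direct term disappears: the old value of coordinate
  \<open>i\<close> is overwritten and acts only through \<open>\<gamma>\<close>.\<close>

lemma deriv_substitute: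
  assumes "finite I" "iopen I V" "iopen I W" "i \<in> I" "\<forall>y\<in>V. y(i := \<gamma> y) \<in> W"
    and "idiff I V \<gamma>" "C1 I W h" "y \<in> V" "l \<in> I"
  shows "((\<lambda>t. h ((y(l := t))(i := \<gamma> (y(l := t))))) has_real_derivative
    (if l = i then 0 else partial l h (y(i := \<gamma> y))) + partial i h (y(i := \<gamma> y)) * partial l \<gamma> y) (at (y l))"
proof -
  let ?\<phi> = "\<lambda>y. y(i := \<gamma> y)"
  have coord: "idiff I V (\<lambda>y. y j)" for j using Ck_coord[of "Suc 0" I V j] by simp
  have d: "idiff I V (\<lambda>y. ?\<phi> y j)" for j using assms(6) coord[of j] by (cases "j = i") auto
  have cpart: "partial l (\<lambda>y. y j) y = (if j = l then 1 else 0)" for j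
    by (rule partialI) (auto simp: fun_upd_apply)
  have part: "partial l (\<lambda>y. ?\<phi> y j) y = (if j = i then partial l \<gamma> y else if j = l then 1 else 0)" for j
    using cpart[of j] by (cases "j = i") auto
  have "(\<Sum>j\<in>I. partial j h (?\<phi> y) * partial l (\<lambda>y. ?\<phi> y j) y)
      = (\<Sum>j\<in>I. (if j = i then partial i h (?\<phi> y) * partial l \<gamma> y else 0)
           + (if j = l then (if l = i then 0 else partial l h (?\<phi> y)) else 0))"
    unfolding part by (intro sum.cong) auto
  also have "\<dots> = (if l = i then 0 else partial l h (?\<phi> y)) + partial i h (?\<phi> y) * partial l \<gamma> y"
    using assms(1,4,9) by (simp add: sum.distrib)
  finally have eq: "(\<Sum>j\<in>I. partial j h (?\<phi> y) * partial l (\<lambda>y. ?\<phi> y j) y)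
      = (if l = i then 0 else partial l h (?\<phi> y)) + partial i h (?\<phi> y) * partial l \<gamma> y" .
  show ?thesis
    using chain_rule[OF assms(1,2,3) compat_upd[OF assms(4)] _ assms(5,7,8,9)] d unfolding eq by blast
qed

text \<open>The core of implicit differentiation: a linear relation between increments
  \<open>w\<close> and \<open>u\<close> with error o(\<bar>w\<bar> + \<bar>u\<bar>) determines the
  limit of w/u. The part of the error that comes from \<open>w\<close> is absorbed, giving w = O(u),
  and then the whole error is o(u).\<close>

lemma ratio_limit:
  fixes u w :: "'s \<Rightarrow> real"
  assumes "b \<noteq> 0" "\<And>e. e > 0 \<Longrightarrow> \<forall>\<^sub>F s in G. \<bar>b * w s - \<kappa> * u s\<bar> \<le> e * (\<bar>w s\<bar> + \<bar>u s\<bar>)"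
    and "\<forall>\<^sub>F s in G. u s \<noteq> 0"
  shows "((\<lambda>s. w s / u s) \<longlongrightarrow> \<kappa> / b) G"
  unfolding tendsto_iff
proof (intro allI impI)
  fix \<eta> :: real assume "\<eta> > 0"
  \<comment> \<open>The constant in \<bar>w\<bar> \<le> C \<bar>u\<bar> after half of \<bar>b\<bar>
    \<bar>w\<bar> has been absorbed.\<close>
  define C where "C = 2 * \<bar>\<kappa>\<bar> / \<bar>b\<bar> + 1"
  have "C > 0" unfolding C_def by (intro add_nonneg_pos) auto
  \<comment> \<open>The first bound permits the absorption; the second leaves an error of at most
    \<eta>/2 after division by \<bar>b\<bar> \<bar>u\<bar>.\<close>
  define e where "e = min (\<bar>b\<bar> / 2) (\<eta> * \<bar>b\<bar> / (2 * (C + 1)))"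
  have "e > 0" using \<open>\<eta> > 0\<close> \<open>b \<noteq> 0\<close> \<open>C > 0\<close> by (simp add: e_def)
  have e1: "e \<le> \<bar>b\<bar> / 2" and e2: "e * (C + 1) \<le> \<eta> * \<bar>b\<bar> / 2"
  proof -
    show "e \<le> \<bar>b\<bar> / 2" unfolding e_def by (rule min.cobounded1)
    have "e * (C + 1) \<le> (\<eta> * \<bar>b\<bar> / (2 * (C + 1))) * (C + 1)"
      using \<open>C > 0\<close> by (intro mult_right_mono) (auto simp: e_def)
    also have "\<dots> = \<eta> * \<bar>b\<bar> / 2"
      using \<open>C > 0\<close> nonzero_mult_div_cancel_right[of "C + 1" "\<eta> * \<bar>b\<bar> / 2"] by (simp add: field_simps)
    finally show "e * (C + 1) \<le> \<eta> * \<bar>b\<bar> / 2" .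
  qed
  show "\<forall>\<^sub>F s in G. dist (w s / u s) (\<kappa> / b) < \<eta>"
    using assms(2)[OF \<open>e > 0\<close>] assms(3)
  proof eventually_elim
    case (elim s)
    have "\<bar>b\<bar> * \<bar>w s\<bar> \<le> \<bar>b * w s - \<kappa> * u s\<bar> + \<bar>\<kappa>\<bar> * \<bar>u s\<bar>"
      unfolding abs_mult[symmetric] by linarith
    also have "\<dots> \<le> (\<bar>b\<bar> / 2) * (\<bar>w s\<bar> + \<bar>u s\<bar>) + \<bar>\<kappa>\<bar> * \<bar>u s\<bar>"
      using elim(1) mult_right_mono[OF e1, of "\<bar>w s\<bar> + \<bar>u s\<bar>"] by simp
    finally have "\<bar>b\<bar> / 2 * \<bar>w s\<bar> \<le> (\<bar>b\<bar> / 2 + \<bar>\<kappa>\<bar>) * \<bar>u s\<bar>" by (simp add: algebra_simps)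
    then have "\<bar>w s\<bar> \<le> C * \<bar>u s\<bar>"
      unfolding C_def using \<open>b \<noteq> 0\<close> by (simp add: field_simps)
    then have "\<bar>b * w s - \<kappa> * u s\<bar> \<le> e * ((C + 1) * \<bar>u s\<bar>)"
      using elim(1) \<open>e > 0\<close> by (smt (verit) distrib_right mult_left_mono mult_cancel_right1)
    also have "\<dots> \<le> (\<eta> * \<bar>b\<bar> / 2) * \<bar>u s\<bar>"
      using mult_right_mono[OF e2, of "\<bar>u s\<bar>"] by simp
    also have "\<dots> < \<eta> * (\<bar>b\<bar> * \<bar>u s\<bar>)"
      using \<open>\<eta> > 0\<close> \<open>b \<noteq> 0\<close> elim(2) by simp
    finally have "\<bar>b * w s - \<kappa> * u s\<bar> / (\<bar>b\<bar> * \<bar>u s\<bar>) < \<eta>"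
      using \<open>b \<noteq> 0\<close> elim(2) by (simp add: pos_divide_less_eq)
    moreover have "w s / u s - \<kappa> / b = (b * w s - \<kappa> * u s) / (b * u s)"
      using \<open>b \<noteq> 0\<close> elim(2) by (simp add: field_simps)
    ultimately show ?case by (simp add: dist_real_def abs_divide abs_mult)
  qed
qed

text \<open>Continuity of \<open>\<gamma>\<close> makes the total differential of \<open>g\<close>
  applicable along the lifted coordinate line, and the equation
  \<open>g (y(i := \<gamma> y)) = y i\<close> turns it into a relation as in
  \<open>ratio_limit\<close>. The numerator is 1 for \<open>l = i\<close> because then the
  right-hand side moves as well.\<close>

lemma implicit_deriv:
  assumes fin: "finite I" and W: "iopen I W" "iopen I W'" and "i \<in> I" "l \<in> I" and g: "C1 I W g"
    and \<gamma>: "icont I W' \<gamma>" "\<forall>y\<in>W'. y(i := \<gamma> y) \<in> W \<and> g (y(i := \<gamma> y)) = y i"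
    and y: "y \<in> W'" and nz: "partial i g (y(i := \<gamma> y)) \<noteq> 0"
  shows "((\<lambda>s. \<gamma> (y(l := s))) has_real_derivative
    (if l = i then 1 else - partial l g (y(i := \<gamma> y))) / partial i g (y(i := \<gamma> y))) (at (y l))"
proof -
  define x where "x = y(i := \<gamma> y)"
  define c where "c s = (y(l := s))(i := \<gamma> (y(l := s)))" for s
  have xW: "x \<in> W" using \<gamma> y by (simp add: x_def)
  have ev: "\<forall>\<^sub>F s in at (y l). y(l := s) \<in> W'"
    using eventually_upd[OF W(2) y \<open>l \<in> I\<close>] by (simp add: eventually_nhds_conv_at)
  have tl: "((\<lambda>s. (y(l := s)) j) \<longlongrightarrow> y j) (at (y l))" for j
    by (cases "j = l") (auto simp: tendsto_ident_at)
  have lim0: "filterlim (\<lambda>s. y(l := s)) (nbhd I y) (at (y l))"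
    using \<open>l \<in> I\<close> by (intro filterlim_nbhd[OF fin] ballI tl) auto
  have lim1: "((\<lambda>s. \<gamma> (y(l := s))) \<longlongrightarrow> \<gamma> y) (at (y l))"
    using filterlim_compose[OF _ lim0, of \<gamma> "nhds (\<gamma> y)"] \<gamma>(1) y by (auto simp: icont_def)
  have lim: "filterlim c (nbhd I x) (at (y l))"
  proof (rule filterlim_nbhd[OF fin])
    show "\<forall>j\<in>I. ((\<lambda>s. c s j) \<longlongrightarrow> x j) (at (y l))"
    proof
      fix j show "((\<lambda>s. c s j) \<longlongrightarrow> x j) (at (y l))"
        using lim1 tl[of j] by (cases "j = i") (auto simp: c_def x_def)
    qed
    show "\<forall>\<^sub>F s in at (y l). \<forall>k. k \<notin> I \<longrightarrow> c s k = x k"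
      using \<open>l \<in> I\<close> \<open>i \<in> I\<close> by (auto simp: c_def x_def)
  qed
  define b where "b = partial i g x"
  define \<kappa> where "\<kappa> = (if l = i then 1 else - partial l g x)"
  have "((\<lambda>s. (\<gamma> (y(l := s)) - \<gamma> y) / (s - y l)) \<longlongrightarrow> \<kappa> / b) (at (y l))"
  proof (rule ratio_limit)
    show "b \<noteq> 0" using nz by (simp add: b_def x_def)
    show "\<forall>\<^sub>F s in at (y l). s - y l \<noteq> 0" by (simp add: eventually_at_filter)
    fix e :: real assume "e > 0"
    have "\<forall>\<^sub>F s in at (y l). \<bar>g (c s) - g x - (\<Sum>j\<in>I. partial j g x * (c s j - x j))\<bar>
        \<le> e * (\<Sum>j\<in>I. \<bar>c s j - x j\<bar>)"
      using filterlim_iff[THEN iffD1, OF lim, rule_format,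
          OF total_differential[OF fin W(1) xW _ _ \<open>e > 0\<close>, of g]] g
      by (simp add: C1_def)
    with ev show "\<forall>\<^sub>F s in at (y l). \<bar>b * (\<gamma> (y(l := s)) - \<gamma> y) - \<kappa> * (s - y l)\<bar>
        \<le> e * (\<bar>\<gamma> (y(l := s)) - \<gamma> y\<bar> + \<bar>s - y l\<bar>)"
    proof eventually_elim
      case (elim s)
      let ?w = "\<gamma> (y(l := s)) - \<gamma> y"
      have cd: "c s j - x j = (if j = i then ?w else if j = l then s - y l else 0)" for j
        by (auto simp: c_def x_def)
      have "(\<Sum>j\<in>I. partial j g x * (c s j - x j))
        = (\<Sum>j\<in>I. (if j = i then b * ?w else 0) + (if j = l then (if l = i then 0 else partial l g x * (s - y l)) else 0))"
        unfolding cd b_def by (intro sum.cong) auto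
      also have "\<dots> = b * ?w + (if l = i then 0 else partial l g x * (s - y l))"
        using fin \<open>i \<in> I\<close> \<open>l \<in> I\<close> by (simp add: sum.distrib)
      finally have s1: "(\<Sum>j\<in>I. partial j g x * (c s j - x j))
        = b * ?w + (if l = i then 0 else partial l g x * (s - y l))" .
      have "(\<Sum>j\<in>I. \<bar>c s j - x j\<bar>)
        = (\<Sum>j\<in>I. (if j = i then \<bar>?w\<bar> else 0) + (if j = l then (if l = i then 0 else \<bar>s - y l\<bar>) else 0))"
        unfolding cd by (intro sum.cong) auto
      also have "\<dots> = \<bar>?w\<bar> + (if l = i then 0 else \<bar>s - y l\<bar>)"
        using fin \<open>i \<in> I\<close> \<open>l \<in> I\<close> by (simp add: sum.distrib)
      finally have "e * (\<Sum>j\<in>I. \<bar>c s j - x j\<bar>) \<le> e * (\<bar>?w\<bar> + \<bar>s - y l\<bar>)"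
        using \<open>e > 0\<close> by (intro mult_left_mono) auto
      moreover have "g (c s) - g x = (if l = i then s - y l else 0)"
        using \<gamma>(2) elim(1) y by (auto simp: c_def x_def)
      ultimately show ?case using elim(2) unfolding s1 \<kappa>_def
        by (cases "l = i") (auto simp: abs_minus_commute algebra_simps)
    qed
  qed
  then show ?thesis unfolding has_field_derivative_iff b_def \<kappa>_def x_def by simp
qed

text \<open>Only one coordinate is altered, so this inverse function theorem is one-dimensional with
  parameters. Strict monotonicity along the lines in direction \<open>i\<close> gives uniqueness,
  the intermediate value theorem gives existence and stability, and the formula for the derivatives
  of \<open>\<gamma>\<close> gives its class.\<close>

lemma elementary_inverse:
  assumes fin: "finite I" and W: "iopen I W" "x0 \<in> W" and i: "i \<in> I"
    and g: "Ck (Suc k) I W g" and nz: "partial i g x0 \<noteq> 0"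
  obtains V W' \<gamma> where "iopen I V" "iopen I W'" "x0 \<in> V" "V \<subseteq> W" "Ck (Suc k) I W' \<gamma>"
    "\<forall>y\<in>W'. y(i := \<gamma> y) \<in> V \<and> g (y(i := \<gamma> y)) = y i"
    "\<forall>x\<in>V. x(i := g x) \<in> W' \<and> \<gamma> (x(i := g x)) = x i"
    "\<forall>x\<in>V. partial i g x \<noteq> 0"
proof -
  \<comment> \<open>Multiplying \<open>g\<close> by \<open>a\<close> makes its derivative in
    direction \<open>i\<close> positive near \<open>x0\<close>, whatever the sign of that
    derivative.\<close>
  define a where "a = partial i g x0"
  have "a \<noteq> 0" using nz by (simp add: a_def)
  have gC: "C1 I W g" by (rule Ck_Suc_C1[OF g])
  have "((\<lambda>y. a * partial i g y) \<longlongrightarrow> a * partial i g x0) (nbhd I x0)"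
    using gC W(2) i by (intro tendsto_mult_left) (auto simp: C1_def icont_def)
  then have "\<forall>\<^sub>F y in nbhd I x0. 0 < a * partial i g y"
    by (rule order_tendstoD) (use \<open>a \<noteq> 0\<close> in \<open>auto simp: a_def zero_less_mult_iff\<close>)
  moreover have "\<forall>\<^sub>F y in nbhd I x0. y \<in> W" using W by (simp add: iopen_def)
  ultimately have "\<forall>\<^sub>F y in nbhd I x0. 0 < a * partial i g y \<and> y \<in> W" by (rule eventually_conj)
  then obtain d where "d > 0" and d: "\<And>y. near I d x0 y \<Longrightarrow> 0 < a * partial i g y \<and> y \<in> W"
    unfolding eventually_nbhd by auto
  define V where "V = {y. near I d x0 y}"
  have Vo: "iopen I V" unfolding V_def by (rule iopen_near[OF fin])
  have VW: "V \<subseteq> W" and apos: "\<And>x. x \<in> V \<Longrightarrow> 0 < a * partial i g x" using d by (auto simp: V_def)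
  \<comment> \<open>\<open>V\<close> is a box, so it meets each line in direction \<open>i\<close>
    in an interval, on which monotonicity and intermediate values can be used.\<close>
  have conv: "y(i := s) \<in> V" if "y(i := t) \<in> V" "y(i := t') \<in> V" "min t t' \<le> s" "s \<le> max t t'" for y s t t'
  proof -
    have "\<bar>t - x0 i\<bar> < d" "\<bar>t' - x0 i\<bar> < d" using that i by (auto simp: V_def near_def)
    then have "\<bar>s - x0 i\<bar> < d" using that(3,4) by (auto simp: abs_less_iff min_def max_def split: if_splits)
    then show ?thesis using that i by (auto simp: V_def near_def)
  qed
  have der: "((\<lambda>s. a * g (y(i := s))) has_real_derivative a * partial i g (y(i := t))) (at t)"
    if "y(i := t) \<in> V" for y t
    using DERIV_cmult[OF idiff_partial[OF C1_idiff[OF gC] i, of "y(i := t)"], of a] that VW by auto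
  have mono: "a * g (y(i := t)) < a * g (y(i := t'))"
    if "y(i := t) \<in> V" "y(i := t') \<in> V" "t < t'" for y t t'
  proof (rule DERIV_pos_imp_increasing[OF \<open>t < t'\<close>])
    fix s assume "t \<le> s" "s \<le> t'"
    then have "y(i := s) \<in> V" using conv[OF that(1,2)] by auto
    then show "\<exists>z. ((\<lambda>s. a * g (y(i := s))) has_real_derivative z) (at s) \<and> 0 < z"
      using der apos by blast
  qed
  have uniq: "t = t'" if "y(i := t) \<in> V" "y(i := t') \<in> V" "g (y(i := t)) = g (y(i := t'))" for y t t'
    using mono[OF that(1,2)] mono[OF that(2,1)] that(3) by (cases t t' rule: linorder_cases) auto
  define W' where "W' = {y. \<exists>t. y(i := t) \<in> V \<and> g (y(i := t)) = y i}"
  define \<gamma> where "\<gamma> y = (SOME t. y(i := t) \<in> V \<and> g (y(i := t)) = y i)" for y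
  have \<gamma>: "y(i := \<gamma> y) \<in> V \<and> g (y(i := \<gamma> y)) = y i" if "y \<in> W'" for y
    using that someI_ex[of "\<lambda>t. y(i := t) \<in> V \<and> g (y(i := t)) = y i"] by (auto simp: W'_def \<gamma>_def)
  \<comment> \<open>On the line through \<open>y\<close>, the function \<open>a * g\<close> passes
    from below \<open>a * y i\<close> to above it near height \<open>\<gamma> y\<close>. Both strict
    inequalities persist on neighbouring lines, which therefore contain a solution close by. This
    yields both the openness of \<open>W'\<close> and the continuity of
    \<open>\<gamma>\<close>.\<close>
  have key: "\<forall>\<^sub>F y' in nbhd I y. \<exists>t'. \<bar>t' - \<gamma> y\<bar> < \<epsilon> \<and> y'(i := t') \<in> V \<and> g (y'(i := t')) = y' i"
    if y: "y \<in> W'" and "\<epsilon> > 0" for y \<epsilon>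
  proof -
    have "\<forall>\<^sub>F t in nhds (\<gamma> y). y(i := t) \<in> V"
      using eventually_upd[OF Vo, of "y(i := \<gamma> y)" i] \<gamma>[OF y] i by simp
    then obtain e where "e > 0" and e: "\<And>t. \<bar>t - \<gamma> y\<bar> < e \<Longrightarrow> y(i := t) \<in> V"
      unfolding eventually_nhds_metric dist_real_def by auto
    define e' where "e' = min (e / 2) (\<epsilon> / 2)"
    have e': "e' > 0" "e' < e" "e' < \<epsilon>" using \<open>e > 0\<close> \<open>\<epsilon> > 0\<close> by (auto simp: e'_def)
    have Vm: "y(i := \<gamma> y - e') \<in> V" "y(i := \<gamma> y + e') \<in> V" using e e' by auto
    have sgn: "a * g (y(i := \<gamma> y - e')) < a * y i" "a * y i < a * g (y(i := \<gamma> y + e'))"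
      using mono[of y "\<gamma> y - e'" "\<gamma> y"] mono[of y "\<gamma> y" "\<gamma> y + e'"] Vm \<gamma>[OF y] e' by auto
    have const: "icont I S (\<lambda>_. c)" for S c by (simp add: icont_def)
    define S where "S c = {y'\<in>UNIV. y'(i := c) \<in> V}" for c
    have op: "iopen I (S c)" for c
      unfolding S_def
    proof (rule iopen_vimage[OF fin _ compat_upd[OF i] _ Vo])
      show "\<forall>j\<in>I. icont I UNIV (\<lambda>y'. (y'(i := c)) j)" using icont_upd[OF const] by blast
    qed (simp add: iopen_def)
    have ct: "((\<lambda>y'. a * g (y'(i := c)) - a * y' i) \<longlongrightarrow> a * g (y(i := c)) - a * y i) (nbhd I y)"
      if "y(i := c) \<in> V" for c
    proof -
      have "icont I V g" using gC VW icont_mono[of I W g I V] by (simp add: C1_def)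
      then have "icont I (S c) (\<lambda>y'. g (y'(i := c)))"
        by (intro icont_substitute[OF fin op i _ const]) (auto simp: S_def)
      then have "((\<lambda>y'. g (y'(i := c))) \<longlongrightarrow> g (y(i := c))) (nbhd I y)"
        using that unfolding icont_def S_def by blast
      moreover have "((\<lambda>y'. y' i) \<longlongrightarrow> y i) (nbhd I y)"
        using icont_coord[of I UNIV i] unfolding icont_def by blast
      ultimately show ?thesis by (intro tendsto_diff tendsto_mult_left)
    qed
    have "\<forall>\<^sub>F y' in nbhd I y. a * g (y'(i := \<gamma> y - e')) - a * y' i < 0"
      by (rule order_tendstoD(2)[OF ct[OF Vm(1)]]) (use sgn in simp)
    moreover have "\<forall>\<^sub>F y' in nbhd I y. 0 < a * g (y'(i := \<gamma> y + e')) - a * y' i"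
      by (rule order_tendstoD(1)[OF ct[OF Vm(2)]]) (use sgn in simp)
    moreover have "\<forall>\<^sub>F y' in nbhd I y. y'(i := c) \<in> V" if "y(i := c) \<in> V" for c
      using op[of c] that unfolding iopen_def S_def by simp
    note this[OF Vm(1)] this[OF Vm(2)]
    ultimately show ?thesis
    proof eventually_elim
      case (elim y')
      let ?f = "\<lambda>s. a * g (y'(i := s))"
      have "\<exists>s. \<gamma> y - e' \<le> s \<and> s \<le> \<gamma> y + e' \<and> ?f s = a * y' i"
      proof (rule IVT')
        show "continuous_on {\<gamma> y - e'..\<gamma> y + e'} ?f"
        proof (rule DERIV_continuous_on)
          fix s assume "s \<in> {\<gamma> y - e'..\<gamma> y + e'}"
          then have "y'(i := s) \<in> V" using conv[OF elim(3,4)] by auto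
          from der[OF this] show "(?f has_real_derivative a * partial i g (y'(i := s))) (at s within {\<gamma> y - e'..\<gamma> y + e'})"
            by (rule DERIV_subset) auto
        qed
      qed (use elim e' in auto)
      then obtain s where s: "\<gamma> y - e' \<le> s" "s \<le> \<gamma> y + e'" "?f s = a * y' i" by auto
      have "y'(i := s) \<in> V" using conv[OF elim(3,4)] s by auto
      moreover have "\<bar>s - \<gamma> y\<bar> < \<epsilon>" using s e' by auto
      ultimately show ?case using s(3) \<open>a \<noteq> 0\<close> by auto
    qed
  qed
  have Wo: "iopen I W'"
    unfolding iopen_def
  proof
    fix y assume "y \<in> W'"
    show "\<forall>\<^sub>F y' in nbhd I y. y' \<in> W'"
      by (rule eventually_mono[OF key[OF \<open>y \<in> W'\<close> zero_less_one]]) (auto simp: W'_def)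
  qed
  have \<gamma>c: "icont I W' \<gamma>"
    unfolding icont_def tendsto_iff
  proof (intro ballI allI impI)
    fix y \<epsilon> assume "y \<in> W'" "(0::real) < \<epsilon>"
    from key[OF this] show "\<forall>\<^sub>F y' in nbhd I y. dist (\<gamma> y') (\<gamma> y) < \<epsilon>"
    proof eventually_elim
      case (elim y')
      then obtain t' where t': "\<bar>t' - \<gamma> y\<bar> < \<epsilon>" "y'(i := t') \<in> V" "g (y'(i := t')) = y' i" by auto
      then have "y' \<in> W'" unfolding W'_def by blast
      then have y'V: "y'(i := \<gamma> y') \<in> V" "g (y'(i := \<gamma> y')) = y' i" using \<gamma> by blast+
      have "t' = \<gamma> y'" by (rule uniq[OF t'(2) y'V(1)]) (simp add: t'(3) y'V(2))
      with t'(1) show ?case by (simp add: dist_real_def)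
    qed
  qed
  have nzV: "\<forall>x\<in>V. partial i g x \<noteq> 0" using apos by force
  \<comment> \<open>Bootstrapping: the first derivatives of \<open>\<gamma>\<close> are quotients of
    partial derivatives of \<open>g\<close> taken at \<open>y(i := \<gamma> y)\<close>, so class C^l
    gives class C^(l + 1) as long as \<open>l \<le> k\<close>.\<close>
  have "Ck l I W' \<gamma>" if "l \<le> Suc k" for l
    using that
  proof (induction l)
    case 0 show ?case using \<gamma>c by simp
  next
    case (Suc l)
    have sub: "Ck l I W' (\<lambda>y. partial j g (y(i := \<gamma> y)))" if "j \<in> I" for j
    proof (rule Ck_substitute[OF fin Wo Vo i])
      show "\<forall>y\<in>W'. y(i := \<gamma> y) \<in> V" using \<gamma> by auto
      show "Ck l I W' \<gamma>" using Suc by simp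
      show "Ck l I V (partial j g)"
        using g that Suc.prems Ck_le[of l k I W] VW Ck_mono[of l I W _ I V] by auto
    qed
    show ?case
    proof (rule Ck_SucI[OF Wo \<gamma>c])
      fix j y assume "j \<in> I" "y \<in> W'"
      then show "((\<lambda>s. \<gamma> (y(j := s))) has_real_derivative
        (if j = i then 1 else - partial j g (y(i := \<gamma> y))) * inverse (partial i g (y(i := \<gamma> y)))) (at (y j))"
        using implicit_deriv[OF fin W(1) Wo i _ gC \<gamma>c, of j y] \<gamma> VW nzV
        unfolding divide_inverse by blast
    next
      fix j assume "j \<in> I"
      have "Ck l I W' (\<lambda>y. if j = i then 1 else - partial j g (y(i := \<gamma> y)))"
        using Ck_uminus[OF Wo sub[OF \<open>j \<in> I\<close>]] by (cases "j = i") auto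
      moreover have "Ck l I W' (\<lambda>y. inverse (partial i g (y(i := \<gamma> y))))"
        using \<gamma> nzV by (intro Ck_inverse[OF Wo _ sub[OF i]]) auto
      ultimately show "Ck l I W' (\<lambda>y. (if j = i then 1 else - partial j g (y(i := \<gamma> y)))
          * inverse (partial i g (y(i := \<gamma> y))))"
        by (rule Ck_mult[OF Wo])
    qed
  qed
  then have \<gamma>k: "Ck (Suc k) I W' \<gamma>" by blast
  have inv: "\<forall>x\<in>V. x(i := g x) \<in> W' \<and> \<gamma> (x(i := g x)) = x i"
  proof
    fix x assume x: "x \<in> V"
    then have xW: "x(i := g x) \<in> W'" unfolding W'_def by (auto intro!: exI[of _ "x i"])
    moreover have "\<gamma> (x(i := g x)) = x i"
      using uniq[of x "\<gamma> (x(i := g x))" "x i"] \<gamma>[OF xW] x by simp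
    ultimately show "x(i := g x) \<in> W' \<and> \<gamma> (x(i := g x)) = x i" by blast
  qed
  have "x0 \<in> V" using \<open>d > 0\<close> by (simp add: V_def)
  with that[OF Vo Wo _ VW \<gamma>k _ inv nzV] \<gamma> show ?thesis by blast
qed

section \<open>Functions that are flat along a set\<close>

text \<open>Containment in a null set, because the images to be considered are not assumed
  measurable. The measure lives on extensional functions on an index set, so that Fubini's theorem
  can split off one coordinate inside an induction.\<close>

definition prod_null :: "'j set \<Rightarrow> ('j \<Rightarrow> real) set \<Rightarrow> bool"
  where "prod_null J E \<longleftrightarrow> (\<exists>Z\<in>null_sets (PiM J (\<lambda>_. lborel)). E \<subseteq> Z)"

lemma prod_null_subset: "prod_null J F \<Longrightarrow> E \<subseteq> F \<Longrightarrow> prod_null J E"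
  unfolding prod_null_def by blast

lemma prod_null_UN:
  assumes "countable T" "\<And>t. t \<in> T \<Longrightarrow> prod_null J (E t)"
  shows "prod_null J (\<Union>t\<in>T. E t)"
proof -
  have "\<forall>t\<in>T. \<exists>Z. Z \<in> null_sets (PiM J (\<lambda>_. lborel)) \<and> E t \<subseteq> Z"
    using assms(2) unfolding prod_null_def by blast
  from bchoice[OF this] obtain Z
    where Z: "\<And>t. t \<in> T \<Longrightarrow> Z t \<in> null_sets (PiM J (\<lambda>_. lborel)) \<and> E t \<subseteq> Z t" by blast
  have "(\<Union>t\<in>T. Z t) \<in> null_sets (PiM J (\<lambda>_. lborel))"
    using Z by (intro null_sets_UN'[OF assms(1)]) auto
  moreover have "(\<Union>t\<in>T. E t) \<subseteq> (\<Union>t\<in>T. Z t)" using Z by (intro UN_mono) auto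
  ultimately show ?thesis unfolding prod_null_def by (rule bexI[rotated])
qed

lemma prod_null_Un: "prod_null J E \<Longrightarrow> prod_null J F \<Longrightarrow> prod_null J (E \<union> F)"
  using prod_null_UN[of "UNIV :: bool set" J "\<lambda>b. if b then E else F"] by (auto simp: UNIV_bool Un_commute)

lemma rational_box:
  assumes "finite I" "d > (0::real)"
  shows "\<exists>q\<in>I \<rightarrow>\<^sub>E \<rat>. \<exists>n::nat. 2 / real (Suc n) < d \<and> (\<forall>k\<in>I. \<bar>x k - q k\<bar> < 1 / real (Suc n))"
proof -
  obtain n :: nat where n: "inverse (real (Suc n)) < d / 2"
    using reals_Archimedean[of "d / 2"] assms(2) by auto
  have "\<forall>k. \<exists>q\<in>\<rat>. \<bar>x k - q\<bar> < 1 / real (Suc n)"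
  proof
    fix k
    obtain q where "q \<in> \<rat>" "x k < q" "q < x k + 1 / real (Suc n)"
      using Rats_dense_in_real[of "x k" "x k + 1 / real (Suc n)"] by auto
    then show "\<exists>q\<in>\<rat>. \<bar>x k - q\<bar> < 1 / real (Suc n)" by (intro bexI[of _ q]) auto
  qed
  then obtain q where q: "\<And>k. q k \<in> \<rat>" "\<And>k. \<bar>x k - q k\<bar> < 1 / real (Suc n)" by metis
  have "2 / real (Suc n) < d" using n by (simp add: field_simps)
  with q show ?thesis by (intro bexI[of _ "restrict q I"] exI[of _ n]) auto
qed

text \<open>A Lindelof argument with the countably many boxes of rational centre and radius 1/(n +
  1). Since the boxes constrain the coordinates in \<open>I\<close> only, \<open>A\<close> has to
  lie in one slice.\<close>

lemma prod_null_local: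
  assumes fin: "finite I" and slice: "\<forall>x\<in>A. \<forall>k. k \<notin> I \<longrightarrow> x k = z k"
    and loc: "\<And>x. x \<in> A \<Longrightarrow> \<exists>d>0. prod_null J (f ` {y\<in>A. near I d x y})"
  shows "prod_null J (f ` A)"
proof -
  define S where "S = (\<lambda>(q, n). {y\<in>A. \<forall>k\<in>I. \<bar>y k - q k\<bar> < 1 / real (Suc n)})"
  define T where "T = {p \<in> (I \<rightarrow>\<^sub>E \<rat>) \<times> (UNIV :: nat set). prod_null J (f ` S p)}"
  have "countable ((I \<rightarrow>\<^sub>E \<rat>) \<times> (UNIV :: nat set))"
    using fin by (intro countable_SIGMA countable_PiE) (auto simp: countable_rat)
  then have "countable T" unfolding T_def by (rule countable_subset[rotated]) auto
  then have "prod_null J (\<Union>p\<in>T. f ` S p)" by (rule prod_null_UN) (simp add: T_def)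
  moreover have "f ` A \<subseteq> (\<Union>p\<in>T. f ` S p)"
  proof -
    have "\<exists>p\<in>T. x \<in> S p" if x: "x \<in> A" for x
    proof -
      obtain d where d: "d > 0" "prod_null J (f ` {y\<in>A. near I d x y})" using loc[OF x] by auto
      obtain q n where q: "q \<in> I \<rightarrow>\<^sub>E \<rat>" "2 / real (Suc n) < d" "\<forall>k\<in>I. \<bar>x k - q k\<bar> < 1 / real (Suc n)"
        using rational_box[OF fin d(1), of x] by auto
      \<comment> \<open>Two points of the box differ by less than 2/(n + 1) < d in each
        coordinate.\<close>
      have "S (q, n) \<subseteq> {y\<in>A. near I d x y}"
      proof
        fix y assume "y \<in> S (q, n)"
        then have y: "y \<in> A" "\<forall>k\<in>I. \<bar>y k - q k\<bar> < 1 / real (Suc n)" by (auto simp: S_def)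
        have "\<bar>y k - x k\<bar> < d" if "k \<in> I" for k
        proof -
          have "\<bar>y k - q k\<bar> < 1 / real (Suc n)" "\<bar>x k - q k\<bar> < 1 / real (Suc n)" using y q that by auto
          moreover have "1 / real (Suc n) + 1 / real (Suc n) < d" using q(2) by (simp add: field_simps)
          ultimately show ?thesis by linarith
        qed
        moreover have "y k = x k" if "k \<notin> I" for k
          using bspec[OF slice y(1)] bspec[OF slice x] that by simp
        ultimately show "y \<in> {y\<in>A. near I d x y}" using y(1) by (simp add: near_def)
      qed
      then have "prod_null J (f ` S (q, n))" by (rule prod_null_subset[OF d(2) image_mono])
      then have "(q, n) \<in> T" using q by (auto simp: T_def)
      moreover have "x \<in> S (q, n)" using x q by (auto simp: S_def)
      ultimately show ?thesis by blast
    qed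
    then show ?thesis by blast
  qed
  ultimately show ?thesis by (rule prod_null_subset)
qed

section \<open>Bounds on compact cubes\<close>

definition cube :: "'i set \<Rightarrow> real \<Rightarrow> ('i \<Rightarrow> real) \<Rightarrow> ('i \<Rightarrow> real) set"
  where "cube I d x = {y. (\<forall>k. k \<notin> I \<longrightarrow> y k = x k) \<and> (\<forall>k\<in>I. \<bar>y k - x k\<bar> \<le> d)}"

text \<open>In the full function space the inactive coordinates are frozen as singletons, and
  Tychonoff's theorem applies.\<close>

lemma compact_cube: "compact (cube I d x)"
proof -
  have "cube I d x = (\<Pi>\<^sub>E k\<in>UNIV. if k \<in> I then cball (x k) d else {x k})"
    unfolding cube_def PiE_UNIV_domain Pi_def
    by (auto simp: dist_real_def abs_minus_commute split: if_splits)
  moreover have "compactin (product_topology (\<lambda>_. euclidean) UNIV) (\<Pi>\<^sub>E k\<in>UNIV. if k \<in> I then cball (x k) d else {x k})"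
    unfolding compactin_PiE by auto
  ultimately show ?thesis by (simp add: euclidean_product_topology)
qed

lemma open_box: "finite I \<Longrightarrow> open {y :: 'i \<Rightarrow> real. \<forall>k\<in>I. \<bar>y k - x k\<bar> < d}"
proof -
  assume "finite I"
  have "{y. \<forall>k\<in>I. \<bar>y k - x k\<bar> < d} = (\<Inter>k\<in>I. (\<lambda>y. y k) -` ball (x k) d)"
    by (auto simp: dist_real_def abs_minus_commute)
  also have "open \<dots>"
    using \<open>finite I\<close> by (intro open_INT ballI open_vimage) auto
  finally show ?thesis .
qed

text \<open>Inside one slice the \<open>near\<close>-neighbourhoods are traces of open sets of the
  function space; this makes compactness arguments available for \<open>icont\<close>.\<close>

lemma icont_continuous_on:
  assumes "finite I" "icont I W h" "Q \<subseteq> W" "\<forall>x\<in>Q. \<forall>k. k \<notin> I \<longrightarrow> x k = z k"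
  shows "continuous_on Q h"
  unfolding continuous_on_topological
proof (intro ballI allI impI)
  fix x B assume x: "x \<in> Q" and B: "open B" "h x \<in> B"
  have "(h \<longlongrightarrow> h x) (nbhd I x)" using assms(2,3) x by (auto simp: icont_def)
  then have "\<forall>\<^sub>F y in nbhd I x. h y \<in> B" using B by (rule topological_tendstoD)
  then obtain d where d: "d > 0" "\<And>y. near I d x y \<Longrightarrow> h y \<in> B" unfolding eventually_nbhd by auto
  have "\<forall>y\<in>Q. y \<in> {y. \<forall>k\<in>I. \<bar>y k - x k\<bar> < d} \<longrightarrow> h y \<in> B"
  proof (intro ballI impI d(2))
    fix y assume "y \<in> Q" "y \<in> {y. \<forall>k\<in>I. \<bar>y k - x k\<bar> < d}"
    then show "near I d x y" using bspec[OF assms(4) x] bspec[OF assms(4), of y] by (simp add: near_def)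
  qed
  then show "\<exists>A. open A \<and> x \<in> A \<and> (\<forall>y\<in>Q. y \<in> A \<longrightarrow> h y \<in> B)"
    using open_box[OF assms(1), of x d] d(1)
    by (intro exI[of _ "{y. \<forall>k\<in>I. \<bar>y k - x k\<bar> < d}"]) auto
qed

lemma cube_bounded:
  assumes "finite I" "icont I W h" "cube I d x0 \<subseteq> W"
  shows "\<exists>B>0. \<forall>x\<in>cube I d x0. \<bar>h x\<bar> \<le> B"
proof -
  have "continuous_on (cube I d x0) h"
    by (rule icont_continuous_on[OF assms, of x0]) (auto simp: cube_def)
  then have "bounded (h ` cube I d x0)"
    by (intro compact_imp_bounded compact_continuous_image compact_cube)
  then show ?thesis unfolding bounded_pos by auto
qed

lemma cube_uniform:
  assumes "finite I" "icont I W h" "cube I d x0 \<subseteq> W" "e > 0"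
  shows "\<exists>\<delta>>0. \<forall>x\<in>cube I d x0. \<forall>y\<in>cube I d x0. (\<forall>k\<in>I. \<bar>x k - y k\<bar> \<le> \<delta>) \<longrightarrow> \<bar>h x - h y\<bar> \<le> e"
proof -
  let ?Q = "cube I d x0"
  have "\<exists>\<eta>>0. \<forall>y\<in>?Q. (\<forall>k\<in>I. \<bar>y k - x k\<bar> < \<eta>) \<longrightarrow> \<bar>h y - h x\<bar> < e / 2" if x: "x \<in> ?Q" for x
  proof -
    have "(h \<longlongrightarrow> h x) (nbhd I x)" using assms(2,3) x by (auto simp: icont_def)
    then obtain \<eta> where "\<eta> > 0" "\<forall>y. near I \<eta> x y \<longrightarrow> \<bar>h y - h x\<bar> < e / 2"
      unfolding tendsto_nbhd using \<open>e > 0\<close> half_gt_zero by blast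
    with x show ?thesis by (intro exI[of _ \<eta>]) (auto simp: near_def cube_def)
  qed
  then obtain \<eta> where \<eta>: "\<And>x. x \<in> ?Q \<Longrightarrow> \<eta> x > 0"
    "\<And>x y. x \<in> ?Q \<Longrightarrow> y \<in> ?Q \<Longrightarrow> \<forall>k\<in>I. \<bar>y k - x k\<bar> < \<eta> x \<Longrightarrow> \<bar>h y - h x\<bar> < e / 2" by metis
  define ob where "ob p = {y. \<forall>k\<in>I. \<bar>y k - p k\<bar> < \<eta> p / 2}" for p
  have "?Q \<subseteq> (\<Union>p\<in>?Q. ob p)"
  proof
    fix x assume "x \<in> ?Q"
    then show "x \<in> (\<Union>p\<in>?Q. ob p)" using \<eta>(1)[of x] by (intro UN_I[of x]) (auto simp: ob_def)
  qed
  moreover have "open (ob p)" for p unfolding ob_def by (rule open_box[OF assms(1)])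
  ultimately obtain P where P: "P \<subseteq> ?Q" "finite P" "?Q \<subseteq> (\<Union>p\<in>P. ob p)"
    using compactE_image[OF compact_cube, of ?Q ob I d x0] by metis
  \<comment> \<open>As \<open>x\<close> is within half of \<open>\<eta> p\<close> of the centre
    \<open>p\<close>, a further quarter keeps \<open>y\<close> within \<open>\<eta> p\<close>. The 1
    covers an empty \<open>P\<close>.\<close>
  define \<delta> where "\<delta> = Min (insert 1 ((\<lambda>p. \<eta> p / 4) ` P))"
  have "\<delta> > 0" unfolding \<delta>_def using P \<eta>(1) by (subst Min_gr_iff) auto
  have \<delta>: "\<delta> \<le> \<eta> p / 4" if "p \<in> P" for p unfolding \<delta>_def using P that by (intro Min_le) auto
  have "\<bar>h x - h y\<bar> \<le> e" if x: "x \<in> ?Q" and y: "y \<in> ?Q" and xy: "\<forall>k\<in>I. \<bar>x k - y k\<bar> \<le> \<delta>" for x y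
  proof -
    obtain p where p: "p \<in> P" "x \<in> ob p" using P x by auto
    have \<eta>p: "\<eta> p > 0" using \<eta> P p by auto
    have "\<bar>x k - p k\<bar> < \<eta> p" "\<bar>y k - p k\<bar> < \<eta> p" if k: "k \<in> I" for k
    proof -
      have 1: "\<bar>x k - p k\<bar> < \<eta> p / 2" using p k by (simp add: ob_def)
      have 2: "\<bar>x k - y k\<bar> \<le> \<eta> p / 4" using xy k \<delta>[OF p(1)] by force
      show "\<bar>x k - p k\<bar> < \<eta> p" "\<bar>y k - p k\<bar> < \<eta> p" using 1 2 \<eta>p by linarith+
    qed
    then have "\<bar>h x - h p\<bar> < e / 2" "\<bar>h y - h p\<bar> < e / 2" using \<eta>(2)[of p] P p x y by blast+
    then show ?thesis by linarith
  qed
  with \<open>\<delta> > 0\<close> show ?thesis by blast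
qed

text \<open>The same one-coordinate-at-a-time path as for the total differential; it runs inside the
  box spanned by \<open>x\<close> and \<open>y\<close>, where \<open>b\<close> controls the
  derivatives.\<close>

lemma increment_bound:
  assumes fin: "finite I" and d: "idiff I W h" and off: "\<forall>k. k \<notin> I \<longrightarrow> x k = y k"
    and b: "\<And>\<xi>. (\<forall>k. min (x k) (y k) \<le> \<xi> k \<and> \<xi> k \<le> max (x k) (y k)) \<Longrightarrow>
      \<xi> \<in> W \<and> (\<forall>i\<in>I. \<bar>partial i h \<xi>\<bar> \<le> M)"
    and \<rho>: "\<forall>k\<in>I. \<bar>x k - y k\<bar> \<le> \<rho>" and "M \<ge> 0"
  shows "\<bar>h x - h y\<bar> \<le> real (card I) * (\<rho> * M)"
proof -
  define p where "p S = (\<lambda>k. if k \<in> S then x k else y k)" for S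
  have "\<bar>h (p S) - h y\<bar> \<le> real (card S) * (\<rho> * M)" if "finite S" "S \<subseteq> I" for S using that
  proof (induction S)
    case empty show ?case by (simp add: p_def)
  next
    case (insert i S)
    define \<phi> where "\<phi> = (\<lambda>t. h ((p S)(i := t)))"
    have bt: "(p S)(i := t) \<in> W \<and> (\<forall>j\<in>I. \<bar>partial j h ((p S)(i := t))\<bar> \<le> M)"
      if "min (y i) (x i) \<le> t" "t \<le> max (y i) (x i)" for t
      by (rule b) (use that in \<open>auto simp: p_def min.commute max.commute\<close>)
    have der: "(\<phi> has_real_derivative partial i h ((p S)(i := t))) (at t)"
      if "min (y i) (x i) \<le> t" "t \<le> max (y i) (x i)" for t
      using idiff_partial[OF d, of i "(p S)(i := t)"] bt[OF that] insert.prems by (simp add: \<phi>_def)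
    from mvt_between[OF der] obtain \<xi> where \<xi>: "min (y i) (x i) \<le> \<xi>" "\<xi> \<le> max (y i) (x i)"
      "\<phi> (x i) - \<phi> (y i) = (x i - y i) * partial i h ((p S)(i := \<xi>))" by blast
    have 1: "\<phi> (x i) = h (p (insert i S))" "\<phi> (y i) = h (p S)"
      unfolding \<phi>_def p_def using insert.hyps by (auto intro!: arg_cong[of _ _ h])
    have "\<bar>h (p (insert i S)) - h (p S)\<bar> = \<bar>x i - y i\<bar> * \<bar>partial i h ((p S)(i := \<xi>))\<bar>"
      using \<xi>(3) unfolding 1 by (simp add: abs_mult)
    also have "\<dots> \<le> \<rho> * M"
      using bt[OF \<xi>(1,2)] \<rho> insert.prems by (intro mult_mono) (auto intro: order_trans[OF abs_ge_zero])
    finally have "\<bar>h (p (insert i S)) - h (p S)\<bar> \<le> \<rho> * M" .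
    with insert show ?case by (simp add: distrib_right)
  qed
  from this[OF fin order_refl] have "\<bar>h (p I) - h y\<bar> \<le> real (card I) * (\<rho> * M)" .
  moreover have "p I = x" using off by (auto simp: p_def)
  ultimately show ?thesis by simp
qed

text \<open>
  The functions \<open>flat m k\<close> arise from \<open>C^k\<close> functions vanishing on \<open>A\<close> by \<open>m\<close> integrations, and a
  function that is \<open>flat m 0\<close> varies by \<open>o(|x - y|^m)\<close> for \<open>y \<in> A\<close>. Unlike the condition of being
  \<open>C^(m + k)\<close>, flatness survives a substitution that is only \<open>C^k\<close> (for \<open>k \<ge> 1\<close>). This replaces
  Morse's decomposition lemma and is what makes the sharp differentiability class suffice in
  Sard's theorem.
\<close>

inductive C0_comb :: "'i set \<Rightarrow> ('i \<Rightarrow> real) set \<Rightarrow> ((('i \<Rightarrow> real) \<Rightarrow> real) \<Rightarrow> bool) \<Rightarrow>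
    (('i \<Rightarrow> real) \<Rightarrow> real) \<Rightarrow> bool" for I W S
  where
    gen: "S p \<Longrightarrow> icont I W q \<Longrightarrow> \<forall>x\<in>W. u x = p x * q x \<Longrightarrow> C0_comb I W S u"
  | add: "C0_comb I W S u \<Longrightarrow> C0_comb I W S v \<Longrightarrow> \<forall>x\<in>W. w x = u x + v x \<Longrightarrow> C0_comb I W S w"

primrec flat :: "nat \<Rightarrow> nat \<Rightarrow> 'i set \<Rightarrow> ('i \<Rightarrow> real) set \<Rightarrow> ('i \<Rightarrow> real) set \<Rightarrow>
    (('i \<Rightarrow> real) \<Rightarrow> real) \<Rightarrow> bool"
  where
    "flat 0 k I W A g \<longleftrightarrow> Ck k I W g"
  | "flat (Suc m) k I W A g \<longleftrightarrow> icont I W g \<and> idiff I W g \<and>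
      (\<forall>i\<in>I. C0_comb I W (\<lambda>p. flat m k I W A p \<and> (\<forall>x\<in>A. p x = 0)) (partial i g))"

lemma flat_icont: "flat m k I W A g \<Longrightarrow> icont I W g"
  by (cases m) (auto intro: Ck_icont)

lemma C0_comb_icont:
  assumes "C0_comb I W S u" "iopen I W" "\<And>p. S p \<Longrightarrow> icont I W p"
  shows "icont I W u"
  using assms(1)
proof induction
  case (gen p q u)
  show ?case by (rule icont_cong[OF assms(2) _ icont_mult[OF assms(3)[OF gen(1)] gen(2)]]) (use gen in simp)
next
  case (add u v w)
  show ?case by (rule icont_cong[OF assms(2) _ icont_add[OF add.IH]]) (use add.hyps(3) in simp)
qed

lemma flat_C1: "iopen I W \<Longrightarrow> flat (Suc m) k I W A g \<Longrightarrow> C1 I W g"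
  unfolding C1_def using C0_comb_icont[of I W] flat_icont by fastforce

lemma C0_comb_mono:
  assumes "C0_comb I W S u" "I' \<subseteq> I" "W' \<subseteq> W" "\<And>p. S p \<Longrightarrow> S' p"
  shows "C0_comb I' W' S' u"
  using assms(1)
proof induction
  case (gen p q u)
  show ?case by (rule C0_comb.gen[where S = S', OF assms(4)[OF gen(1)] icont_mono[OF gen(2) assms(2,3)]]) (use gen(3) assms(3) in auto)
next
  case (add u v w)
  show ?case by (rule C0_comb.add[OF add.IH]) (use add.hyps(3) assms(3) in auto)
qed

lemma flat_mono:
  assumes "I' \<subseteq> I" "W' \<subseteq> W" "A' \<subseteq> A"
  shows "flat m k I W A g \<Longrightarrow> flat m k I' W' A' g"
proof (induction m arbitrary: g)
  case 0 then show ?case using Ck_mono[OF _ assms(1,2)] by simp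
next
  case (Suc m)
  have "C0_comb I' W' (\<lambda>p. flat m k I' W' A' p \<and> (\<forall>x\<in>A'. p x = 0)) (partial i g)" if "i \<in> I'" for i
  proof (rule C0_comb_mono[OF _ assms(1,2)])
    show "C0_comb I W (\<lambda>p. flat m k I W A p \<and> (\<forall>x\<in>A. p x = 0)) (partial i g)"
      using Suc.prems that assms(1) by auto
  qed (use Suc.IH assms(3) in auto)
  moreover have "idiff I' W' g"
    using Suc.prems assms(1,2) unfolding flat.simps idiff_def by (meson subsetD)
  ultimately show ?case using Suc.prems icont_mono[OF _ assms(1,2)] by simp
qed

lemma C0_comb_cong:
  assumes "C0_comb I W S u" "\<forall>x\<in>W. u x = v x"
  shows "C0_comb I W S v"
  using assms
proof (cases rule: C0_comb.cases)
  case (gen p q)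
  show ?thesis by (rule C0_comb.gen[where S = S, OF gen(1,2)]) (use gen(3) assms(2) in simp)
next
  case (add u' v')
  show ?thesis by (rule C0_comb.add[OF add(1,2)]) (use add(3) assms(2) in simp)
qed

lemma C0_comb_mult:
  assumes "C0_comb I W S u" "icont I W q"
  shows "C0_comb I W S (\<lambda>x. u x * q x)"
  using assms(1)
proof induction
  case (gen p r u)
  show ?case by (rule C0_comb.gen[where S = S, OF gen(1) icont_mult[OF gen(2) assms(2)]]) (use gen(3) in auto)
next
  case (add u v w)
  show ?case by (rule C0_comb.add[OF add.IH]) (use add.hyps(3) in \<open>auto simp: distrib_right\<close>)
qed

lemma C0_comb_substitute:
  assumes "C0_comb I W S u" "finite I" "iopen I V" "i \<in> I" "\<forall>y\<in>V. y(i := \<gamma> y) \<in> W" "icont I V \<gamma>"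
    and "\<And>p. S p \<Longrightarrow> S' (\<lambda>y. p (y(i := \<gamma> y)))"
  shows "C0_comb I V S' (\<lambda>y. u (y(i := \<gamma> y)))"
  using assms(1)
proof induction
  case (gen p q u)
  show ?case
    by (rule C0_comb.gen[where S = S', OF assms(7)[OF gen(1)] icont_substitute[OF assms(2-6) gen(2)]]) (use gen(3) assms(5) in \<open>simp add: fun_upd_def\<close>)
next
  case (add u v w)
  show ?case by (rule C0_comb.add[OF add.IH]) (use add.hyps(3) assms(5) in \<open>simp add: fun_upd_def\<close>)
qed

text \<open>The chain rule gives derivatives of \<open>g\<close> at the substituted point, treated
  by induction on their generators, and such a derivative times a partial derivative of
  \<open>\<gamma>\<close>. That factor has lost an order of differentiability, which is harmless
  because \<open>C0_comb\<close> admits merely continuous coefficients.\<close>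

lemma flat_substitute:
  assumes "finite I" "iopen I V" "iopen I W" "i \<in> I" "\<forall>y\<in>V. y(i := \<gamma> y) \<in> W" "Ck (Suc k) I V \<gamma>"
  shows "flat m (Suc k) I W A g \<Longrightarrow> flat m (Suc k) I V {y\<in>V. y(i := \<gamma> y) \<in> A} (\<lambda>y. g (y(i := \<gamma> y)))"
proof (induction m arbitrary: g)
  case 0 then show ?case unfolding flat.simps(1) by (rule Ck_substitute[OF assms])
next
  case (Suc m)
  let ?A = "{y\<in>V. y(i := \<gamma> y) \<in> A}"
  have gC: "C1 I W g" by (rule flat_C1[OF assms(3) Suc.prems])
  have \<gamma>C: "C1 I V \<gamma>" by (rule Ck_Suc_C1[OF assms(6)])
  have ic: "icont I V (\<lambda>y. g (y(i := \<gamma> y)))"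
    using gC \<gamma>C by (intro icont_substitute[OF assms(1,2,4,5)]) (auto simp: C1_def)
  have der: "((\<lambda>t. g ((y(l := t))(i := \<gamma> (y(l := t))))) has_real_derivative
    (if l = i then 0 else partial l g (y(i := \<gamma> y))) + partial i g (y(i := \<gamma> y)) * partial l \<gamma> y) (at (y l))"
    if "y \<in> V" "l \<in> I" for y l
    by (rule deriv_substitute[OF assms(1-5) C1_idiff[OF \<gamma>C] gC that])
  have idf: "idiff I V (\<lambda>y. g (y(i := \<gamma> y)))"
    unfolding idiff_def field_differentiable_def using der by blast
  have "C0_comb I V (\<lambda>p. flat m (Suc k) I V ?A p \<and> (\<forall>x\<in>?A. p x = 0)) (partial l (\<lambda>y. g (y(i := \<gamma> y))))"
    if l: "l \<in> I" for l
  proof -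
    let ?S = "\<lambda>p. flat m (Suc k) I V ?A p \<and> (\<forall>x\<in>?A. p x = 0)"
    have sub: "C0_comb I V ?S (\<lambda>y. partial j g (y(i := \<gamma> y)))" if "j \<in> I" for j
    proof (rule C0_comb_substitute[OF _ assms(1,2,4,5)])
      show "C0_comb I W (\<lambda>p. flat m (Suc k) I W A p \<and> (\<forall>x\<in>A. p x = 0)) (partial j g)"
        using Suc.prems that by simp
      show "icont I V \<gamma>" using \<gamma>C by (simp add: C1_def)
      show "?S (\<lambda>y. p (y(i := \<gamma> y)))" if "flat m (Suc k) I W A p \<and> (\<forall>x\<in>A. p x = 0)" for p
        by (rule conjI[OF Suc.IH[OF conjunct1[OF that]]]) (use that in blast)
    qed
    have t2: "C0_comb I V ?S (\<lambda>y. partial i g (y(i := \<gamma> y)) * partial l \<gamma> y)"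
      using \<gamma>C l by (intro C0_comb_mult[OF sub[OF assms(4)]]) (auto simp: C1_def)
    have part: "partial l (\<lambda>y. g (y(i := \<gamma> y))) y =
      (if l = i then 0 else partial l g (y(i := \<gamma> y))) + partial i g (y(i := \<gamma> y)) * partial l \<gamma> y"
      if "y \<in> V" for y by (rule partialI[OF der[OF that l]])
    show ?thesis
    proof (cases "l = i")
      case True
      show ?thesis
        by (rule C0_comb_cong[OF t2]) (use part True in simp)
    next
      case False
      show ?thesis by (rule C0_comb.add[OF sub[OF l] t2]) (use part False in simp)
    qed
  qed
  with ic idf show ?case unfolding flat.simps(2) by blast
qed

text \<open>The recursion descends to the innermost functions, which are C^(k + 1) and vanish on
  \<open>A\<close>. By the choice of \<open>Astar\<close> their gradients vanish on it, so each is
  one step flatter there. For \<open>m > 0\<close> the vanishing of the innermost functions is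
  contained in flatness; for \<open>m = 0\<close> the function \<open>g\<close> is itself innermost,
  whence the extra premise.\<close>

lemma flat_star:
  assumes "iopen I W" "Astar = {x\<in>A. \<forall>p. Ck (Suc k) I W p \<longrightarrow> (\<forall>x\<in>A. p x = 0) \<longrightarrow> (\<forall>i\<in>I. partial i p x = 0)}"
  shows "flat m (Suc k) I W A g \<Longrightarrow> m = 0 \<longrightarrow> (\<forall>x\<in>A. g x = 0) \<Longrightarrow> flat (Suc m) k I W Astar g"
proof (induction m arbitrary: g)
  case 0
  have Ck: "Ck (Suc k) I W g" and van: "\<forall>x\<in>A. g x = 0" using 0 by auto
  have "C0_comb I W (\<lambda>p. flat 0 k I W Astar p \<and> (\<forall>x\<in>Astar. p x = 0)) (partial i g)" if "i \<in> I" for i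
  proof (rule C0_comb.gen)
    show "flat 0 k I W Astar (partial i g) \<and> (\<forall>x\<in>Astar. partial i g x = 0)"
      using Ck van that unfolding assms(2) by auto
    show "icont I W (\<lambda>x. 1)" by (simp add: icont_def)
  qed simp
  with Ck show ?case unfolding flat.simps(2) Ck.simps by blast
next
  case (Suc m)
  have "C0_comb I W (\<lambda>p. flat (Suc m) k I W Astar p \<and> (\<forall>x\<in>Astar. p x = 0)) (partial i g)" if "i \<in> I" for i
  proof (rule C0_comb_mono[OF _ order_refl order_refl])
    show "C0_comb I W (\<lambda>p. flat m (Suc k) I W A p \<and> (\<forall>x\<in>A. p x = 0)) (partial i g)"
      using Suc.prems(1) that unfolding flat.simps(2) by blast
    fix p assume p: "flat m (Suc k) I W A p \<and> (\<forall>x\<in>A. p x = 0)"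
    have "Astar \<subseteq> A" unfolding assms(2) by auto
    with p Suc.IH[of p] show "flat (Suc m) k I W Astar p \<and> (\<forall>x\<in>Astar. p x = 0)" by blast
  qed
  with Suc.prems(1) show ?case unfolding flat.simps(2)[of "Suc m"] flat.simps(2)[of m "Suc k"] by blast
qed

section \<open>Images of flat mappings\<close>

text \<open>Continuous coefficients are bounded on the compact cube, so a combination inherits the
  order o(\<rho>^m) of its generators.\<close>

lemma C0_comb_estimate:
  assumes u: "C0_comb I W S u" and fin: "finite I" and Q: "cube I d x0 \<subseteq> W"
    and S: "\<And>p e. S p \<Longrightarrow> e > 0 \<Longrightarrow> \<exists>\<delta>>0. \<forall>x\<in>cube I d x0. \<forall>y\<in>cube I d x0 \<inter> A. \<forall>\<rho>. 0 < \<rho> \<longrightarrow> \<rho> \<le> \<delta> \<longrightarrow>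
      (\<forall>i\<in>I. \<bar>x i - y i\<bar> \<le> \<rho>) \<longrightarrow> \<bar>p x\<bar> \<le> e * \<rho> ^ m"
    and "e > 0"
  shows "\<exists>\<delta>>0. \<forall>x\<in>cube I d x0. \<forall>y\<in>cube I d x0 \<inter> A. \<forall>\<rho>. 0 < \<rho> \<longrightarrow> \<rho> \<le> \<delta> \<longrightarrow>
      (\<forall>i\<in>I. \<bar>x i - y i\<bar> \<le> \<rho>) \<longrightarrow> \<bar>u x\<bar> \<le> e * \<rho> ^ m"
  using u \<open>e > 0\<close>
proof (induction arbitrary: e)
  case (gen p q u)
  obtain B where B: "B > 0" "\<forall>x\<in>cube I d x0. \<bar>q x\<bar> \<le> B" using cube_bounded[OF fin gen.hyps(2) Q] by blast
  have "e / B > 0" using B gen.prems by simp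
  from S[OF gen.hyps(1) this] obtain \<delta> where \<delta>: "\<delta> > 0" "\<And>x y \<rho>. x \<in> cube I d x0 \<Longrightarrow>
      y \<in> cube I d x0 \<inter> A \<Longrightarrow> 0 < \<rho> \<Longrightarrow> \<rho> \<le> \<delta> \<Longrightarrow> \<forall>i\<in>I. \<bar>x i - y i\<bar> \<le> \<rho> \<Longrightarrow> \<bar>p x\<bar> \<le> e / B * \<rho> ^ m"
    by blast
  have "\<bar>u x\<bar> \<le> e * \<rho> ^ m" if "x \<in> cube I d x0" "y \<in> cube I d x0 \<inter> A" "0 < \<rho>" "\<rho> \<le> \<delta>"
    "\<forall>i\<in>I. \<bar>x i - y i\<bar> \<le> \<rho>" for x y \<rho>
  proof -
    have "\<bar>u x\<bar> = \<bar>p x\<bar> * \<bar>q x\<bar>" using gen.hyps(3) that(1) Q by (auto simp: abs_mult)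
    also have "\<dots> \<le> (e / B * \<rho> ^ m) * B"
      using \<delta>(2)[OF that] B that(1) by (intro mult_mono) (auto intro: order_trans[OF abs_ge_zero])
    finally show ?thesis using B by simp
  qed
  with \<delta>(1) show ?case by blast
next
  case (add u v w)
  have "e / 2 > 0" using add.prems by simp
  from add.IH(1)[OF this] obtain \<delta>1 where \<delta>1: "\<delta>1 > 0" "\<And>x y \<rho>. x \<in> cube I d x0 \<Longrightarrow>
      y \<in> cube I d x0 \<inter> A \<Longrightarrow> 0 < \<rho> \<Longrightarrow> \<rho> \<le> \<delta>1 \<Longrightarrow> \<forall>i\<in>I. \<bar>x i - y i\<bar> \<le> \<rho> \<Longrightarrow> \<bar>u x\<bar> \<le> e / 2 * \<rho> ^ m"
    by blast
  from add.IH(2)[OF \<open>e / 2 > 0\<close>] obtain \<delta>2 where \<delta>2: "\<delta>2 > 0" "\<And>x y \<rho>. x \<in> cube I d x0 \<Longrightarrow>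
      y \<in> cube I d x0 \<inter> A \<Longrightarrow> 0 < \<rho> \<Longrightarrow> \<rho> \<le> \<delta>2 \<Longrightarrow> \<forall>i\<in>I. \<bar>x i - y i\<bar> \<le> \<rho> \<Longrightarrow> \<bar>v x\<bar> \<le> e / 2 * \<rho> ^ m"
    by blast
  have "\<bar>w x\<bar> \<le> e * \<rho> ^ m" if "x \<in> cube I d x0" "y \<in> cube I d x0 \<inter> A" "0 < \<rho>" "\<rho> \<le> min \<delta>1 \<delta>2"
    "\<forall>i\<in>I. \<bar>x i - y i\<bar> \<le> \<rho>" for x y \<rho>
  proof -
    have "w x = u x + v x" using add.hyps(3) that(1) Q by auto
    moreover have "\<bar>u x\<bar> \<le> e / 2 * \<rho> ^ m" "\<bar>v x\<bar> \<le> e / 2 * \<rho> ^ m"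
      using \<delta>1(2)[OF that(1-3) _ that(5)] \<delta>2(2)[OF that(1-3) _ that(5)] that(4) by auto
    moreover have "e / 2 * \<rho> ^ m + e / 2 * \<rho> ^ m = e * \<rho> ^ m" by (simp add: distrib_right[symmetric])
    ultimately show ?thesis by linarith
  qed
  with \<delta>1(1) \<delta>2(1) show ?case by (intro exI[of _ "min \<delta>1 \<delta>2"] conjI) auto
qed

text \<open>The generators of the gradient vanish at \<open>y\<close>, so by induction the gradient
  is o(\<rho>^m) on the box between \<open>x\<close> and \<open>y\<close>; integrating over that box
  gains one factor \<rho>.\<close>

lemma flat_estimate:
  assumes fin: "finite I" and Q: "cube I d x0 \<subseteq> W"
  shows "flat m 0 I W A g \<Longrightarrow> e > 0 \<Longrightarrow> \<exists>\<delta>>0. \<forall>x\<in>cube I d x0. \<forall>y\<in>cube I d x0 \<inter> A.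
    \<forall>\<rho>. 0 < \<rho> \<longrightarrow> \<rho> \<le> \<delta> \<longrightarrow> (\<forall>i\<in>I. \<bar>x i - y i\<bar> \<le> \<rho>) \<longrightarrow> \<bar>g x - g y\<bar> \<le> e * \<rho> ^ m"
proof (induction m arbitrary: g e)
  case 0
  then have "icont I W g" by simp
  from cube_uniform[OF fin this Q 0(2)] obtain \<delta> where \<delta>: "\<delta> > 0" "\<And>x y. x \<in> cube I d x0 \<Longrightarrow>
    y \<in> cube I d x0 \<Longrightarrow> \<forall>k\<in>I. \<bar>x k - y k\<bar> \<le> \<delta> \<Longrightarrow> \<bar>g x - g y\<bar> \<le> e" by blast
  have "\<bar>g x - g y\<bar> \<le> e * \<rho> ^ 0" if "x \<in> cube I d x0" "y \<in> cube I d x0 \<inter> A" "0 < \<rho>" "\<rho> \<le> \<delta>"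
    "\<forall>i\<in>I. \<bar>x i - y i\<bar> \<le> \<rho>" for x y \<rho>
    using \<delta>(2)[of x y] that by force
  with \<delta>(1) show ?case by blast
next
  case (Suc m)
  let ?Q = "cube I d x0"
  \<comment> \<open>The increment bound contributes a factor \<open>card I\<close>; the added 1
    avoids division by zero.\<close>
  define e' where "e' = e / (real (card I) + 1)"
  have "e' > 0" using Suc.prems(2) by (simp add: e'_def)
  have "\<exists>\<delta>>0. \<forall>x\<in>?Q. \<forall>y\<in>?Q \<inter> A. \<forall>\<rho>. 0 < \<rho> \<longrightarrow> \<rho> \<le> \<delta> \<longrightarrow>
      (\<forall>i\<in>I. \<bar>x i - y i\<bar> \<le> \<rho>) \<longrightarrow> \<bar>partial i g x\<bar> \<le> e' * \<rho> ^ m" if "i \<in> I" for i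
  proof (rule C0_comb_estimate[where S = "\<lambda>p. flat m 0 I W A p \<and> (\<forall>x\<in>A. p x = 0)", OF _ fin Q _ \<open>e' > 0\<close>])
    show "C0_comb I W (\<lambda>p. flat m 0 I W A p \<and> (\<forall>x\<in>A. p x = 0)) (partial i g)"
      using Suc.prems(1) that by simp
    fix p and e :: real assume "flat m 0 I W A p \<and> (\<forall>x\<in>A. p x = 0)" "e > 0"
    with Suc.IH[of p e] show "\<exists>\<delta>>0. \<forall>x\<in>?Q. \<forall>y\<in>?Q \<inter> A. \<forall>\<rho>. 0 < \<rho> \<longrightarrow> \<rho> \<le> \<delta> \<longrightarrow>
      (\<forall>i\<in>I. \<bar>x i - y i\<bar> \<le> \<rho>) \<longrightarrow> \<bar>p x\<bar> \<le> e * \<rho> ^ m" by simp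
  qed
  then have "\<forall>i\<in>I. \<exists>\<delta>>0. \<forall>x\<in>?Q. \<forall>y\<in>?Q \<inter> A. \<forall>\<rho>. 0 < \<rho> \<longrightarrow> \<rho> \<le> \<delta> \<longrightarrow>
      (\<forall>i\<in>I. \<bar>x i - y i\<bar> \<le> \<rho>) \<longrightarrow> \<bar>partial i g x\<bar> \<le> e' * \<rho> ^ m" by blast
  from bchoice[OF this] obtain \<delta> where \<delta>: "\<forall>i\<in>I. \<delta> i > 0 \<and> (\<forall>x\<in>?Q. \<forall>y\<in>?Q \<inter> A. \<forall>\<rho>. 0 < \<rho> \<longrightarrow> \<rho> \<le> \<delta> i \<longrightarrow>
      (\<forall>i\<in>I. \<bar>x i - y i\<bar> \<le> \<rho>) \<longrightarrow> \<bar>partial i g x\<bar> \<le> e' * \<rho> ^ m)" by blast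
  define D where "D = Min (insert 1 (\<delta> ` I))"
  have "D > 0" unfolding D_def using fin \<delta> by (subst Min_gr_iff) auto
  have D: "D \<le> \<delta> i" if "i \<in> I" for i unfolding D_def using fin that by (intro Min_le) auto
  have "\<bar>g x - g y\<bar> \<le> e * \<rho> ^ Suc m" if x: "x \<in> ?Q" and y: "y \<in> ?Q \<inter> A" and \<rho>: "0 < \<rho>" "\<rho> \<le> D"
    "\<forall>i\<in>I. \<bar>x i - y i\<bar> \<le> \<rho>" for x y \<rho>
  proof -
    have "\<bar>g x - g y\<bar> \<le> real (card I) * (\<rho> * (e' * \<rho> ^ m))"
    proof (rule increment_bound[where W = W and h = g and x = x and y = y, OF fin])
      show "idiff I W g" using Suc.prems(1) by simp
      show "\<forall>k. k \<notin> I \<longrightarrow> x k = y k" using x y by (auto simp: cube_def)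
      show "\<forall>k\<in>I. \<bar>x k - y k\<bar> \<le> \<rho>" by fact
      show "0 \<le> e' * \<rho> ^ m" using \<open>e' > 0\<close> \<rho> by simp
      fix \<xi> assume \<xi>: "\<forall>k. min (x k) (y k) \<le> \<xi> k \<and> \<xi> k \<le> max (x k) (y k)"
      have \<xi>Q: "\<xi> \<in> ?Q"
      proof -
        have "\<bar>\<xi> k - x0 k\<bar> \<le> d" if "k \<in> I" for k
        proof -
          have "\<bar>x k - x0 k\<bar> \<le> d" "\<bar>y k - x0 k\<bar> \<le> d" using x y that by (auto simp: cube_def)
          with \<xi>[rule_format, of k] show ?thesis by (auto simp: min_def max_def abs_le_iff split: if_splits)
        qed
        moreover have "\<xi> k = x0 k" if "k \<notin> I" for k
          using \<xi>[rule_format, of k] x y that by (auto simp: cube_def)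
        ultimately show ?thesis by (simp add: cube_def)
      qed
      have "\<forall>i\<in>I. \<bar>\<xi> i - y i\<bar> \<le> \<rho>"
      proof
        fix i assume "i \<in> I"
        then have "\<bar>x i - y i\<bar> \<le> \<rho>" using \<rho>(3) by blast
        with \<xi>[rule_format, of i] show "\<bar>\<xi> i - y i\<bar> \<le> \<rho>"
          by (auto simp: min_def max_def abs_le_iff split: if_splits)
      qed
      then have "\<bar>partial i g \<xi>\<bar> \<le> e' * \<rho> ^ m" if "i \<in> I" for i
        using \<delta> \<xi>Q y \<rho>(1,2) D[OF that] that order_trans[OF \<rho>(2) D[OF that]] by blast
      with \<xi>Q Q show "\<xi> \<in> W \<and> (\<forall>i\<in>I. \<bar>partial i g \<xi>\<bar> \<le> e' * \<rho> ^ m)" by blast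
    qed
    also have "\<dots> = (real (card I) * e') * \<rho> ^ Suc m" by simp
    also have "\<dots> \<le> e * \<rho> ^ Suc m"
    proof (rule mult_right_mono)
      show "real (card I) * e' \<le> e" unfolding e'_def using Suc.prems(2) by (simp add: field_simps)
    qed (use \<rho> in simp)
    finally show ?thesis .
  qed
  with \<open>D > 0\<close> show ?case by blast
qed

section \<open>Covering images by small boxes\<close>

interpretation lb: product_sigma_finite "\<lambda>_. lborel :: real measure"
  by standard

lemma emeasure_PiE_box:
  assumes "finite J" "c \<ge> 0"
  shows "(\<Pi>\<^sub>E j\<in>J. {a j - c..a j + c}) \<in> sets (PiM J (\<lambda>_. lborel))"
    and "emeasure (PiM J (\<lambda>_. lborel)) (\<Pi>\<^sub>E j\<in>J. {a j - c..a j + c}) = ennreal ((2 * c) ^ card J)"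
proof -
  show "(\<Pi>\<^sub>E j\<in>J. {a j - c..a j + c}) \<in> sets (PiM J (\<lambda>_. lborel))"
    using assms(1) by (intro sets_PiM_I_finite) auto
  have "emeasure (PiM J (\<lambda>_. lborel)) (\<Pi>\<^sub>E j\<in>J. {a j - c..a j + c})
      = (\<Prod>j\<in>J. emeasure lborel {a j - c..a j + c})"
    using assms(1) by (intro lb.emeasure_PiM) auto
  also have "\<dots> = (\<Prod>j\<in>J. ennreal (2 * c))"
    using assms(2) by (intro prod.cong) (auto simp: algebra_simps)
  also have "\<dots> = ennreal ((2 * c) ^ card J)" using assms(2) by (simp add: ennreal_power)
  finally show "emeasure (PiM J (\<lambda>_. lborel)) (\<Pi>\<^sub>E j\<in>J. {a j - c..a j + c}) = ennreal ((2 * c) ^ card J)" .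
qed

text \<open>The covers for e = 1/(n + 1) intersect in a measurable null set. The restriction to
  \<open>e \<le> 1\<close> lets a covering argument estimate powers of \<open>e\<close> by
  \<open>e\<close>.\<close>

lemma prod_null_smallI:
  assumes "\<And>e. 0 < e \<Longrightarrow> e \<le> 1 \<Longrightarrow> \<exists>Z\<in>sets (PiM J (\<lambda>_. lborel)). E \<subseteq> Z \<and> emeasure (PiM J (\<lambda>_. lborel)) Z \<le> ennreal (C * e)"
  shows "prod_null J E"
proof -
  have "\<forall>n::nat. \<exists>Z. Z \<in> sets (PiM J (\<lambda>_. lborel)) \<and> E \<subseteq> Z \<and>
      emeasure (PiM J (\<lambda>_. lborel)) Z \<le> ennreal (C * (1 / real (Suc n)))"
  proof
    fix n :: nat
    have "0 < 1 / real (Suc n)" "1 / real (Suc n) \<le> 1" by auto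
    from assms[OF this] show "\<exists>Z. Z \<in> sets (PiM J (\<lambda>_. lborel)) \<and> E \<subseteq> Z \<and>
      emeasure (PiM J (\<lambda>_. lborel)) Z \<le> ennreal (C * (1 / real (Suc n)))" by blast
  qed
  from choice[OF this] obtain Z where Z: "\<And>n::nat. Z n \<in> sets (PiM J (\<lambda>_. lborel)) \<and> E \<subseteq> Z n \<and>
      emeasure (PiM J (\<lambda>_. lborel)) (Z n) \<le> ennreal (C * (1 / real (Suc n)))" by blast
  define Y where "Y = (\<Inter>n. Z n)"
  have Y: "Y \<in> sets (PiM J (\<lambda>_. lborel))" unfolding Y_def by (rule sets.countable_INT) (use Z in auto)
  have "(\<lambda>n. ennreal (C * (1 / real (Suc n)))) \<longlonglongrightarrow> ennreal 0"
    using tendsto_mult_right_zero[OF LIMSEQ_Suc[OF lim_1_over_n], of C] by (intro tendsto_ennrealI) simp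
  moreover have "emeasure (PiM J (\<lambda>_. lborel)) Y \<le> ennreal (C * (1 / real (Suc n)))" for n
    using emeasure_mono[of Y "Z n" "PiM J (\<lambda>_. lborel)"] Z[of n] order_trans by (auto simp: Y_def)
  ultimately have "emeasure (PiM J (\<lambda>_. lborel)) Y \<le> ennreal 0"
    by (intro LIMSEQ_le_const) auto
  then have "Y \<in> null_sets (PiM J (\<lambda>_. lborel))" using Y by (auto simp: null_sets_def)
  moreover have "E \<subseteq> Y" unfolding Y_def using Z by auto
  ultimately show ?thesis unfolding prod_null_def by blast
qed

text \<open>The count behind Sard's theorem: about \<rho>^(- card I) cells of side \<rho>, each with
  image in a box of volume (2 e \<rho>^m)^(card J). By \<open>card I \<le> m * card J\<close> the
  powers of \<rho> cancel and a multiple of \<open>e\<close> remains.\<close>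

lemma prod_null_grid:
  assumes fin: "finite I" "finite J" "J \<noteq> {}" and "d > 0" and A: "A \<subseteq> cube I d x0"
    and est: "\<And>e. e > 0 \<Longrightarrow> \<exists>\<delta>>0. \<forall>x\<in>A. \<forall>y\<in>A. \<forall>\<rho>. 0 < \<rho> \<longrightarrow> \<rho> \<le> \<delta> \<longrightarrow>
      (\<forall>i\<in>I. \<bar>x i - y i\<bar> \<le> \<rho>) \<longrightarrow> (\<forall>j\<in>J. \<bar>f j x - f j y\<bar> \<le> e * \<rho> ^ m)"
    and card: "card I \<le> m * card J"
  shows "prod_null J ((\<lambda>x. \<lambda>j\<in>J. f j x) ` A)"
proof (rule prod_null_smallI)
  fix e :: real assume e: "0 < e" "e \<le> 1"
  let ?M = "PiM J (\<lambda>_. lborel) :: ('b \<Rightarrow> real) measure"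
  obtain \<delta> where "\<delta> > 0" and \<delta>: "\<And>x y \<rho> j. x \<in> A \<Longrightarrow> y \<in> A \<Longrightarrow> 0 < \<rho> \<Longrightarrow> \<rho> \<le> \<delta> \<Longrightarrow>
      \<forall>i\<in>I. \<bar>x i - y i\<bar> \<le> \<rho> \<Longrightarrow> j \<in> J \<Longrightarrow> \<bar>f j x - f j y\<bar> \<le> e * \<rho> ^ m"
    using est[OF e(1)] by blast
  \<comment> \<open>The mesh is at most \<delta> for the estimate, and at most 1 so that a larger
    exponent of \<rho> gives a smaller power.\<close>
  obtain n :: nat where n: "2 * d / min \<delta> 1 < real n" using reals_Archimedean2 by blast
  have "0 < 2 * d / min \<delta> 1" using \<open>d > 0\<close> \<open>\<delta> > 0\<close> by simp
  with n have "n > 0" by (metis less_trans of_nat_0_less_iff)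
  define \<rho> where "\<rho> = 2 * d / real n"
  have \<rho>: "0 < \<rho>" "\<rho> \<le> \<delta>" "\<rho> \<le> 1"
  proof -
    show "0 < \<rho>" using \<open>n > 0\<close> \<open>d > 0\<close> by (simp add: \<rho>_def)
    have "\<mu> > 0 \<Longrightarrow> 2 * d / \<mu> < real n \<Longrightarrow> \<rho> < \<mu>" for \<mu>
      using \<open>n > 0\<close> by (simp add: \<rho>_def field_simps)
    from this[OF _ n] have "\<rho> < min \<delta> 1" using \<open>\<delta> > 0\<close> by simp
    then show "\<rho> \<le> \<delta>" "\<rho> \<le> 1" by auto
  qed
  define \<kappa> where "\<kappa> x = (\<lambda>i\<in>I. nat \<lfloor>(x i - (x0 i - d)) / \<rho>\<rfloor>)" for x
  have \<kappa>: "\<kappa> x \<in> I \<rightarrow>\<^sub>E {..n}" if "x \<in> A" for x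
    unfolding \<kappa>_def
  proof (rule restrict_PiE_iff[THEN iffD2], rule ballI)
    fix i assume "i \<in> I"
    then have "x i - (x0 i - d) \<le> 2 * d" using A that by (fastforce simp: cube_def)
    also have "2 * d = real n * \<rho>" using \<open>n > 0\<close> by (simp add: \<rho>_def)
    finally have "(x i - (x0 i - d)) / \<rho> \<le> real n"
      using \<rho>(1) by (simp add: pos_divide_le_eq)
    then have "\<lfloor>(x i - (x0 i - d)) / \<rho>\<rfloor> \<le> int n" by linarith
    then show "nat \<lfloor>(x i - (x0 i - d)) / \<rho>\<rfloor> \<in> {..n}" by auto
  qed
  have close: "\<bar>x i - y i\<bar> \<le> \<rho>" if "x \<in> A" "y \<in> A" "\<kappa> x = \<kappa> y" "i \<in> I" for x y i
  proof -
    have nn: "0 \<le> (x i - (x0 i - d)) / \<rho>" if "x \<in> A" for x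
    proof -
      have "\<bar>x i - x0 i\<bar> \<le> d" using A that \<open>i \<in> I\<close> by (auto simp: cube_def)
      then show ?thesis using \<rho>(1) by (auto simp: abs_le_iff)
    qed
    have "nat \<lfloor>(x i - (x0 i - d)) / \<rho>\<rfloor> = nat \<lfloor>(y i - (x0 i - d)) / \<rho>\<rfloor>"
      using fun_cong[OF that(3), of i] that(4) by (simp add: \<kappa>_def)
    then have "\<lfloor>(x i - (x0 i - d)) / \<rho>\<rfloor> = \<lfloor>(y i - (x0 i - d)) / \<rho>\<rfloor>"
      using nn[OF that(1)] nn[OF that(2)] by (metis int_nat_eq zero_le_floor)
    then have "\<bar>(x i - (x0 i - d)) / \<rho> - (y i - (x0 i - d)) / \<rho>\<bar> \<le> 1" by linarith
    moreover have "(x i - (x0 i - d)) / \<rho> - (y i - (x0 i - d)) / \<rho> = (x i - y i) / \<rho>"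
      by (simp add: diff_divide_distrib[symmetric])
    ultimately show ?thesis using \<rho>(1) by (simp add: abs_divide)
  qed
  define K where "K = \<kappa> ` A"
  have K: "K \<subseteq> I \<rightarrow>\<^sub>E {..n}" unfolding K_def using \<kappa> by auto
  have finP: "finite (I \<rightarrow>\<^sub>E {..n})" using fin(1) by (intro finite_PiE) auto
  have finK: "finite K" using K finP by (rule finite_subset)
  \<comment> \<open>Indices run from 0 to \<open>n\<close>, since a point on an upper face of the
    cube receives the index \<open>n\<close>.\<close>
  have cK: "card K \<le> (n + 1) ^ card I"
    using card_mono[OF finP K] card_PiE[OF fin(1), of "\<lambda>_. {..n}"] by simp
  have "\<forall>k\<in>K. \<exists>y. y \<in> A \<and> \<kappa> y = k" unfolding K_def by auto
  from bchoice[OF this] obtain y where y: "\<And>k. k \<in> K \<Longrightarrow> y k \<in> A \<and> \<kappa> (y k) = k" by blast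
  define c where "c = e * \<rho> ^ m"
  have "c \<ge> 0" using e \<rho> by (simp add: c_def)
  define B where "B k = (\<Pi>\<^sub>E j\<in>J. {f j (y k) - c..f j (y k) + c})" for k
  have Bs: "B k \<in> sets ?M" "emeasure ?M (B k) = ennreal ((2 * c) ^ card J)" for k
    unfolding B_def using emeasure_PiE_box[OF fin(2) \<open>c \<ge> 0\<close>, of "\<lambda>j. f j (y k)"] by auto
  have sub: "(\<lambda>x. \<lambda>j\<in>J. f j x) ` A \<subseteq> (\<Union>k\<in>K. B k)"
  proof (rule image_subsetI)
    fix x assume x: "x \<in> A"
    then have k: "\<kappa> x \<in> K" by (simp add: K_def)
    have "\<bar>f j x - f j (y (\<kappa> x))\<bar> \<le> c" if "j \<in> J" for j
      unfolding c_def
      using y[OF k] close[OF x, of "y (\<kappa> x)"] x \<rho> that by (intro \<delta>) auto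
    then have "(\<lambda>j\<in>J. f j x) \<in> B (\<kappa> x)" unfolding B_def by (auto simp: abs_le_iff algebra_simps)
    with k show "(\<lambda>j\<in>J. f j x) \<in> (\<Union>k\<in>K. B k)" by blast
  qed
  have ms: "(\<Union>k\<in>K. B k) \<in> sets ?M" using finK Bs by auto
  have b1: "1 \<le> card J" using fin by (simp add: Suc_leI card_gt_0_iff)
  have "emeasure ?M (\<Union>k\<in>K. B k) \<le> (\<Sum>k\<in>K. emeasure ?M (B k))"
    using finK Bs by (intro emeasure_subadditive_finite) auto
  also have "\<dots> = ennreal (real (card K) * (2 * c) ^ card J)"
    unfolding Bs(2) using \<open>c \<ge> 0\<close> by (simp add: ennreal_mult ennreal_of_nat_eq_real_of_nat)
  \<comment> \<open>The constant comes from n + 1 \<le> 2 n and n \<rho> = 2 d. It is free of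
    \<rho>, hence of the mesh that was chosen for \<open>e\<close>.\<close>
  also have "\<dots> \<le> ennreal ((4 * d) ^ card I * 2 ^ card J * e)"
  proof (rule ennreal_leI)
    have "real (card K) \<le> real ((n + 1) ^ card I)" using cK by (rule of_nat_mono)
    also have "\<dots> = (real n + 1) ^ card I" by (simp add: add.commute)
    also have "\<dots> \<le> (2 * real n) ^ card I" using \<open>n > 0\<close> by (intro power_mono) auto
    finally have 1: "real (card K) \<le> (2 * real n) ^ card I" .
    \<comment> \<open>One factor \<open>e\<close> survives because \<open>J\<close> is nonempty and
      \<open>e \<le> 1\<close>.\<close>
    have "e ^ card J \<le> e ^ 1" using e b1 by (intro power_decreasing) auto
    moreover have "(\<rho> ^ m) ^ card J \<le> \<rho> ^ card I"
      unfolding power_mult[symmetric] using \<rho> card by (intro power_decreasing) auto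
    ultimately have "(e ^ card J) * ((\<rho> ^ m) ^ card J) \<le> e ^ 1 * \<rho> ^ card I"
      using e \<rho> by (intro mult_mono) auto
    then have 2: "(2 * c) ^ card J \<le> 2 ^ card J * (e * \<rho> ^ card I)"
      unfolding c_def power_mult_distrib by simp
    have "real (card K) * (2 * c) ^ card J \<le> (2 * real n) ^ card I * (2 ^ card J * (e * \<rho> ^ card I))"
      using 1 2 \<open>c \<ge> 0\<close> by (intro mult_mono) auto
    also have "\<dots> = (2 * real n * \<rho>) ^ card I * 2 ^ card J * e" by (simp add: power_mult_distrib)
    also have "2 * real n * \<rho> = 4 * d" using \<open>n > 0\<close> by (simp add: \<rho>_def)
    finally show "real (card K) * (2 * c) ^ card J \<le> (4 * d) ^ card I * 2 ^ card J * e" .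
  qed
  finally show "\<exists>Z\<in>sets ?M. (\<lambda>x. \<lambda>j\<in>J. f j x) ` A \<subseteq> Z \<and>
      emeasure ?M Z \<le> ennreal ((4 * d) ^ card I * 2 ^ card J * e)"
    using ms sub by blast
qed

lemma near_subset_cube: "near I d x y \<Longrightarrow> d \<le> e \<Longrightarrow> y \<in> cube I e x"
  unfolding near_def cube_def by fastforce

lemma cube_subset_near: "y \<in> cube I d x \<Longrightarrow> d < e \<Longrightarrow> near I e x y"
  unfolding near_def cube_def by fastforce

text \<open>With \<open>k = 0\<close> no differentiability is left to trade, so the grid count is
  applied directly on small cubes.\<close>

lemma flat_nul_base:
  assumes fin: "finite I" "finite J" "J \<noteq> {}" and W: "iopen I W" "A \<subseteq> W"
    and slice: "\<forall>x\<in>A. \<forall>k. k \<notin> I \<longrightarrow> x k = z k"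
    and f: "\<forall>j\<in>J. flat m 0 I W A (f j)" and card: "card I \<le> m * card J"
  shows "prod_null J ((\<lambda>x. \<lambda>j\<in>J. f j x) ` A)"
proof (rule prod_null_local[OF fin(1) slice])
  fix x0 assume "x0 \<in> A"
  then obtain d where "d > 0" and d: "\<And>y. near I d x0 y \<Longrightarrow> y \<in> W" using iopenD[OF W(1)] W(2) by blast
  define h where "h = d / 2"
  have h: "0 < h" "h < d" using \<open>d > 0\<close> by (auto simp: h_def)
  have Q: "cube I h x0 \<subseteq> W" using cube_subset_near[OF _ h(2)] d by blast
  let ?A = "A \<inter> cube I h x0"
  have "prod_null J ((\<lambda>x. \<lambda>j\<in>J. f j x) ` ?A)"
  proof (rule prod_null_grid[OF fin h(1) _ _ card])
    fix e :: real assume "e > 0"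
    have "\<forall>j\<in>J. \<exists>\<delta>>0. \<forall>x\<in>cube I h x0. \<forall>y\<in>cube I h x0 \<inter> A. \<forall>\<rho>. 0 < \<rho> \<longrightarrow> \<rho> \<le> \<delta> \<longrightarrow>
        (\<forall>i\<in>I. \<bar>x i - y i\<bar> \<le> \<rho>) \<longrightarrow> \<bar>f j x - f j y\<bar> \<le> e * \<rho> ^ m"
      using flat_estimate[OF fin(1) Q _ \<open>e > 0\<close>] f by blast
    from bchoice[OF this] obtain \<delta> where \<delta>: "\<forall>j\<in>J. \<delta> j > 0 \<and> (\<forall>x\<in>cube I h x0. \<forall>y\<in>cube I h x0 \<inter> A.
        \<forall>\<rho>. 0 < \<rho> \<longrightarrow> \<rho> \<le> \<delta> j \<longrightarrow> (\<forall>i\<in>I. \<bar>x i - y i\<bar> \<le> \<rho>) \<longrightarrow> \<bar>f j x - f j y\<bar> \<le> e * \<rho> ^ m)" by blast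
    define D where "D = Min (\<delta> ` J)"
    have "D > 0" unfolding D_def using fin \<delta> by (subst Min_gr_iff) auto
    have D: "D \<le> \<delta> j" if "j \<in> J" for j unfolding D_def using fin that by (intro Min_le) auto
    have "\<bar>f j x - f j y\<bar> \<le> e * \<rho> ^ m" if "x \<in> ?A" "y \<in> ?A" "0 < \<rho>" "\<rho> \<le> D"
      "\<forall>i\<in>I. \<bar>x i - y i\<bar> \<le> \<rho>" "j \<in> J" for x y \<rho> j
      using \<delta> that order_trans[OF that(4) D[OF that(6)]] by blast
    with \<open>D > 0\<close> show "\<exists>\<delta>>0. \<forall>x\<in>?A. \<forall>y\<in>?A. \<forall>\<rho>. 0 < \<rho> \<longrightarrow> \<rho> \<le> \<delta> \<longrightarrow>
        (\<forall>i\<in>I. \<bar>x i - y i\<bar> \<le> \<rho>) \<longrightarrow> (\<forall>j\<in>J. \<bar>f j x - f j y\<bar> \<le> e * \<rho> ^ m)" by blast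
  qed auto
  then have "prod_null J ((\<lambda>x. \<lambda>j\<in>J. f j x) ` {y\<in>A. near I h x0 y})"
    by (rule prod_null_subset) (use near_subset_cube[of I h x0 _ h] in auto)
  with h(1) show "\<exists>d>0. prod_null J ((\<lambda>x. \<lambda>j\<in>J. f j x) ` {y\<in>A. near I d x0 y})" by blast
qed

text \<open>
  Where all \<open>C^(k + 1)\<close> functions vanishing on \<open>A\<close> are critical, one order of differentiability is
  traded for one order of flatness; elsewhere \<open>A\<close> lies locally in a hypersurface of class \<open>C^(k + 1)\<close>,
  so that a variable can be eliminated.
\<close>

lemma flat_nul:
  fixes I :: "'i set" and J :: "'j set"
  assumes J: "finite J" "J \<noteq> {}"
  shows "finite I \<Longrightarrow> iopen I W \<Longrightarrow> A \<subseteq> W \<Longrightarrow> \<forall>x\<in>A. \<forall>k. k \<notin> I \<longrightarrow> x k = z k \<Longrightarrow>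
    \<forall>j\<in>J. flat (Suc m) k I W A (f j) \<Longrightarrow> card I \<le> (Suc m + k) * card J \<Longrightarrow>
    prod_null J ((\<lambda>x. \<lambda>j\<in>J. f j x) ` A)"
proof (induction k arbitrary: m I W A f z)
  case 0
  show ?case by (rule flat_nul_base[OF 0(1) J 0(2-5)]) (use 0(6) in simp)
next
  case (Suc k)
  \<comment> \<open>An inner induction on the number of variables handles the part of
    \<open>A\<close> lying in hypersurfaces; there \<open>m\<close> and \<open>k\<close> stay
    fixed.\<close>
  show ?case using Suc.prems
  proof (induction "card I" arbitrary: I W A f z rule: less_induct)
    case less
    define Astar where "Astar = {x\<in>A. \<forall>p. Ck (Suc k) I W p \<longrightarrow> (\<forall>x\<in>A. p x = 0) \<longrightarrow> (\<forall>i\<in>I. partial i p x = 0)}"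
    have "Astar \<subseteq> A" unfolding Astar_def by auto
    have 1: "prod_null J ((\<lambda>x. \<lambda>j\<in>J. f j x) ` Astar)"
    proof (rule Suc.IH[OF less.prems(1,2), of Astar z "Suc m" f])
      show "Astar \<subseteq> W" "\<forall>x\<in>Astar. \<forall>k. k \<notin> I \<longrightarrow> x k = z k"
        using \<open>Astar \<subseteq> A\<close> less.prems(3,4) by blast+
      show "\<forall>j\<in>J. flat (Suc (Suc m)) k I W Astar (f j)"
        using flat_star[OF less.prems(2) Astar_def, of "Suc m"] less.prems(5) by blast
      \<comment> \<open>The trade preserves the sum of the two orders, hence the dimension
        bound.\<close>
      show "card I \<le> (Suc (Suc m) + k) * card J" using less.prems(6) by simp
    qed
    have 2: "prod_null J ((\<lambda>x. \<lambda>j\<in>J. f j x) ` (A - Astar))"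
    proof (rule prod_null_local[OF less.prems(1)])
      show "\<forall>x\<in>A - Astar. \<forall>k. k \<notin> I \<longrightarrow> x k = z k" using less.prems(4) by blast
      fix x0 assume x0: "x0 \<in> A - Astar"
      then obtain p i where p: "Ck (Suc k) I W p" "\<forall>x\<in>A. p x = 0" and i: "i \<in> I" "partial i p x0 \<noteq> 0"
        unfolding Astar_def by blast
      have x0W: "x0 \<in> W" using x0 less.prems(3) by blast
      obtain V W' \<gamma> where V: "iopen I V" "iopen I W'" "x0 \<in> V" "V \<subseteq> W" and \<gamma>: "Ck (Suc k) I W' \<gamma>"
        and \<gamma>1: "\<forall>y\<in>W'. y(i := \<gamma> y) \<in> V \<and> p (y(i := \<gamma> y)) = y i"
        and \<gamma>2: "\<forall>x\<in>V. x(i := p x) \<in> W' \<and> \<gamma> (x(i := p x)) = x i"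
        by (rule elementary_inverse[OF less.prems(1,2) x0W i(1) p(1) i(2)]) blast
      \<comment> \<open>Since \<open>p\<close> vanishes on \<open>A\<close>, the new coordinates put
        \<open>A\<close> near \<open>x0\<close> into the hyperplane where coordinate
        \<open>i\<close> is 0. Removing \<open>i\<close> from the active indices makes this
        hyperplane the slice through \<open>z(i := 0)\<close>.\<close>
      define B where "B = {y\<in>W'. y i = 0 \<and> y(i := \<gamma> y) \<in> A}"
      have "prod_null J ((\<lambda>x. \<lambda>j\<in>J. (\<lambda>j y. f j (y(i := \<gamma> y))) j x) ` B)"
      proof (rule less.hyps[of "I - {i}" W' B "z(i := 0)"])
        show "card (I - {i}) < card I" using i(1) less.prems(1) by (rule card_Diff1_less[rotated])
        show "finite (I - {i})" using less.prems(1) by simp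
        show "iopen (I - {i}) W'" by (rule iopen_mono[OF _ V(2)]) auto
        show "B \<subseteq> W'" unfolding B_def by auto
        show "\<forall>x\<in>B. \<forall>k. k \<notin> I - {i} \<longrightarrow> x k = (z(i := 0)) k"
        proof (intro ballI allI impI)
          fix x k assume x: "x \<in> B" "k \<notin> I - {i}"
          show "x k = (z(i := 0)) k"
          proof (cases "k = i")
            case True then show ?thesis using x(1) by (simp add: B_def)
          next
            case False
            then have "k \<notin> I" using x(2) by blast
            moreover have "x(i := \<gamma> x) \<in> A" using x(1) by (simp add: B_def)
            ultimately have "(x(i := \<gamma> x)) k = z k" using less.prems(4) by blast
            with False show ?thesis by simp
          qed
        qed
        show "\<forall>j\<in>J. flat (Suc m) (Suc k) (I - {i}) W' B (\<lambda>y. f j (y(i := \<gamma> y)))"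
        proof
          fix j assume "j \<in> J"
          then have fj: "flat (Suc m) (Suc k) I W A (f j)" using less.prems(5) by blast
          have m: "\<forall>y\<in>W'. y(i := \<gamma> y) \<in> W" using \<gamma>1 V(4) by blast
          show "flat (Suc m) (Suc k) (I - {i}) W' B (\<lambda>y. f j (y(i := \<gamma> y)))"
            by (rule flat_mono[OF _ order_refl _ flat_substitute[OF less.prems(1) V(2) less.prems(2) i(1) m \<gamma> fj]])
              (auto simp: B_def)
        qed
        have "card (I - {i}) \<le> card I" using less.prems(1) by (simp add: card_mono)
        then show "card (I - {i}) \<le> (Suc m + Suc k) * card J" using less.prems(6) by (rule order_trans)
      qed
      moreover have "(\<lambda>x. \<lambda>j\<in>J. f j x) ` (A \<inter> V) \<subseteq> (\<lambda>x. \<lambda>j\<in>J. (\<lambda>j y. f j (y(i := \<gamma> y))) j x) ` B"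
      proof (rule image_subsetI)
        fix x assume x: "x \<in> A \<inter> V"
        define y where "y = x(i := p x)"
        have y: "y \<in> W'" "y(i := \<gamma> y) = x" "y i = 0" using x \<gamma>2 p(2) by (auto simp: y_def)
        then have "y \<in> B" using x by (simp add: B_def)
        then show "(\<lambda>j\<in>J. f j x) \<in> (\<lambda>x. \<lambda>j\<in>J. (\<lambda>j y. f j (y(i := \<gamma> y))) j x) ` B"
          by (rule rev_image_eqI) (simp only: y(2))
      qed
      ultimately have nV: "prod_null J ((\<lambda>x. \<lambda>j\<in>J. f j x) ` (A \<inter> V))" by (rule prod_null_subset)
      obtain d where d: "d > 0" "\<And>y. near I d x0 y \<Longrightarrow> y \<in> V" using iopenD[OF V(1,3)] by blast
      have "prod_null J ((\<lambda>x. \<lambda>j\<in>J. f j x) ` {y\<in>A - Astar. near I d x0 y})"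
        by (rule prod_null_subset[OF nV image_mono]) (use d(2) in blast)
      with d(1) show "\<exists>d>0. prod_null J ((\<lambda>x. \<lambda>j\<in>J. f j x) ` {y\<in>A - Astar. near I d x0 y})" by blast
    qed
    have "(\<lambda>x. \<lambda>j\<in>J. f j x) ` A \<subseteq> (\<lambda>x. \<lambda>j\<in>J. f j x) ` Astar \<union> (\<lambda>x. \<lambda>j\<in>J. f j x) ` (A - Astar)"
      by blast
    then show ?case by (rule prod_null_subset[OF prod_null_Un[OF 1 2]])
  qed
qed

section \<open>Sard's theorem\<close>

text \<open>For a Jacobian matrix this is criticality: rank below the number of rows. A relation
  between rows makes sense for arbitrary index sets, so that removing a variable or a function only
  changes \<open>I\<close> or \<open>J\<close>.\<close>

definition row_dep :: "'i set \<Rightarrow> 'j set \<Rightarrow> ('j \<Rightarrow> 'i \<Rightarrow> real) \<Rightarrow> bool"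
  where "row_dep I J a \<longleftrightarrow> (\<exists>c. (\<exists>j\<in>J. c j \<noteq> 0) \<and> (\<forall>i\<in>I. (\<Sum>j\<in>J. c j * a j i) = 0))"

text \<open>A unit row decouples: column \<open>i\<close> merely determines the coefficient of row
  \<open>j0\<close>, and the other columns do not see that row.\<close>

lemma row_dep_drop:
  assumes "finite J" "j0 \<in> J" "i \<in> I" "\<And>l. l \<in> I \<Longrightarrow> a j0 l = (if l = i then 1 else 0)"
  shows "row_dep I J a \<longleftrightarrow> row_dep (I - {i}) (J - {j0}) a"
proof
  assume "row_dep I J a"
  then obtain c where c: "\<exists>j\<in>J. c j \<noteq> 0" "\<forall>l\<in>I. (\<Sum>j\<in>J. c j * a j l) = 0" unfolding row_dep_def by auto
  have s: "c j0 * a j0 l + (\<Sum>j\<in>J - {j0}. c j * a j l) = 0" if "l \<in> I" for l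
    using c(2) that sum.remove[OF assms(1,2), of "\<lambda>j. c j * a j l"] by simp
  have "\<forall>l\<in>I - {i}. (\<Sum>j\<in>J - {j0}. c j * a j l) = 0"
  proof
    fix l assume "l \<in> I - {i}"
    then show "(\<Sum>j\<in>J - {j0}. c j * a j l) = 0" using s[of l] assms(4)[of l] by simp
  qed
  moreover have "\<exists>j\<in>J - {j0}. c j \<noteq> 0"
  proof (rule ccontr)
    assume n: "\<not> (\<exists>j\<in>J - {j0}. c j \<noteq> 0)"
    then have "(\<Sum>j\<in>J - {j0}. c j * a j i) = 0" by (intro sum.neutral) auto
    with s[OF assms(3)] assms(3,4) have "c j0 = 0" by simp
    with n c(1) show False by auto
  qed
  ultimately show "row_dep (I - {i}) (J - {j0}) a" unfolding row_dep_def by blast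
next
  assume "row_dep (I - {i}) (J - {j0}) a"
  then obtain c where c: "\<exists>j\<in>J - {j0}. c j \<noteq> 0" "\<forall>l\<in>I - {i}. (\<Sum>j\<in>J - {j0}. c j * a j l) = 0"
    unfolding row_dep_def by auto
  define c' where "c' = c(j0 := - (\<Sum>j\<in>J - {j0}. c j * a j i))"
  have e: "(\<Sum>j\<in>J. c' j * a j l) = c' j0 * a j0 l + (\<Sum>j\<in>J - {j0}. c j * a j l)" for l
    unfolding sum.remove[OF assms(1,2)] by (auto simp: c'_def intro!: sum.cong)
  have "(\<Sum>j\<in>J. c' j * a j l) = 0" if "l \<in> I" for l
    unfolding e using that c(2) assms(3,4) by (cases "l = i") (auto simp: c'_def)
  moreover have "\<exists>j\<in>J. c' j \<noteq> 0" using c(1) by (auto simp: c'_def)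
  ultimately show "row_dep I J a" unfolding row_dep_def by blast
qed

text \<open>Gaussian elimination with pivot \<open>a j0 i\<close>, by induction on the rows,
  followed by back substitution for the unknown \<open>i\<close>.\<close>

lemma indep_surj:
  assumes "finite J"
  shows "finite I \<Longrightarrow> \<not> row_dep I J a \<Longrightarrow> \<exists>\<xi>. \<forall>j\<in>J. (\<Sum>i\<in>I. a j i * \<xi> i) = u j"
  using assms
proof (induction J arbitrary: I a u rule: finite_induct)
  case empty show ?case by simp
next
  case (insert j0 J)
  have "\<exists>i\<in>I. a j0 i \<noteq> 0"
  proof (rule ccontr)
    assume "\<not> (\<exists>i\<in>I. a j0 i \<noteq> 0)"
    then have "row_dep I (insert j0 J) a"
      unfolding row_dep_def using insert.hyps by (intro exI[of _ "\<lambda>j. if j = j0 then 1 else 0"]) (auto intro!: sum.neutral)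
    with insert.prems show False by blast
  qed
  then obtain i where i: "i \<in> I" "a j0 i \<noteq> 0" by blast
  define r where "r j = a j i / a j0 i" for j
  define a' where "a' j l = a j l - r j * a j0 l" for j l
  have a'i: "a' j i = 0" for j using i by (simp add: a'_def r_def)
  have "\<not> row_dep (I - {i}) J a'"
  proof
    assume "row_dep (I - {i}) J a'"
    then obtain c where c: "\<exists>j\<in>J. c j \<noteq> 0" "\<forall>l\<in>I - {i}. (\<Sum>j\<in>J. c j * a' j l) = 0" unfolding row_dep_def by auto
    \<comment> \<open>The reduced rows are \<open>a j - r j * a j0\<close>; a relation between them
      is one between the original rows with this coefficient at \<open>j0\<close>.\<close>
    define c' where "c' = c(j0 := - (\<Sum>j\<in>J. c j * r j))"
    have "(\<Sum>j\<in>insert j0 J. c' j * a j l) = 0" if "l \<in> I" for l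
    proof -
      have "(\<Sum>j\<in>insert j0 J. c' j * a j l) = c' j0 * a j0 l + (\<Sum>j\<in>J. c j * a j l)"
        using insert.hyps by (auto simp: c'_def intro!: sum.cong)
      also have "\<dots> = (\<Sum>j\<in>J. c j * a' j l)"
        by (simp add: c'_def a'_def right_diff_distrib sum_subtractf sum_distrib_right mult.assoc)
      also have "\<dots> = 0" using c(2) that a'i by (cases "l = i") auto
      finally show ?thesis .
    qed
    moreover have "\<exists>j\<in>insert j0 J. c' j \<noteq> 0" using c(1) insert.hyps by (auto simp: c'_def)
    ultimately show False using insert.prems unfolding row_dep_def by blast
  qed
  from insert.IH[OF _ this, of "\<lambda>j. u j - r j * u j0"] insert.prems(1)
  obtain \<xi> where \<xi>: "\<forall>j\<in>J. (\<Sum>l\<in>I - {i}. a' j l * \<xi> l) = u j - r j * u j0" by auto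
  define \<zeta> where "\<zeta> = \<xi>(i := (u j0 - (\<Sum>l\<in>I - {i}. a j0 l * \<xi> l)) / a j0 i)"
  have s: "(\<Sum>l\<in>I. b l * \<zeta> l) = b i * \<zeta> i + (\<Sum>l\<in>I - {i}. b l * \<xi> l)" for b
    unfolding sum.remove[OF insert.prems(1) i(1)] by (auto simp: \<zeta>_def intro!: sum.cong)
  have 0: "(\<Sum>l\<in>I. a j0 l * \<zeta> l) = u j0" unfolding s using i by (simp add: \<zeta>_def)
  have "(\<Sum>l\<in>I. a j l * \<zeta> l) = u j" if "j \<in> J" for j
  proof -
    have "(\<Sum>l\<in>I. a j l * \<zeta> l) = (\<Sum>l\<in>I. a' j l * \<zeta> l) + r j * (\<Sum>l\<in>I. a j0 l * \<zeta> l)"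
      by (simp add: a'_def sum_distrib_left sum.distrib[symmetric] algebra_simps)
    also have "(\<Sum>l\<in>I. a' j l * \<zeta> l) = u j - r j * u j0" unfolding s using \<xi> that a'i by simp
    finally show ?thesis using 0 by simp
  qed
  with 0 show ?case by auto
qed

text \<open>A right inverse \<open>\<xi>\<close> of \<open>a\<close> is almost a right inverse of
  every nearby \<open>b\<close>. Testing a relation \<open>c\<close> between the rows of
  \<open>b\<close> against the column of \<open>\<xi>\<close> at an index where \<bar>c\<bar>
  attains its maximum \<open>m\<close> would yield \<open>m < m\<close>.\<close>

lemma indep_open:
  assumes fin: "finite I" "finite J" and a: "\<not> row_dep I J a"
  shows "\<exists>\<eta>>0. \<forall>b. (\<forall>j\<in>J. \<forall>i\<in>I. \<bar>b j i - a j i\<bar> < \<eta>) \<longrightarrow> \<not> row_dep I J b"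
proof -
  have "\<forall>j'. \<exists>\<xi>. \<forall>j\<in>J. (\<Sum>i\<in>I. a j i * \<xi> i) = (if j = j' then 1 else 0)"
    by (intro allI indep_surj[OF fin(2,1) a])
  from choice[OF this] obtain \<xi> where
    \<xi>: "\<And>j' j. j \<in> J \<Longrightarrow> (\<Sum>i\<in>I. a j i * \<xi> j' i) = (if j = j' then 1 else 0)" by blast
  define M where "M = (\<Sum>j\<in>J. \<Sum>i\<in>I. \<bar>\<xi> j i\<bar>) + 1"
  have M: "(\<Sum>i\<in>I. \<bar>\<xi> j i\<bar>) \<le> M" if "j \<in> J" for j
  proof -
    have "(\<Sum>i\<in>I. \<bar>\<xi> j i\<bar>) \<le> (\<Sum>j\<in>J. \<Sum>i\<in>I. \<bar>\<xi> j i\<bar>)"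
      using fin(2) that by (intro member_le_sum sum_nonneg) auto
    then show ?thesis by (simp add: M_def)
  qed
  have "M > 0" unfolding M_def by (intro add_nonneg_pos sum_nonneg) auto
  \<comment> \<open>Chosen so that \<open>real (card J) * (\<eta> * M) < 1\<close>.\<close>
  define \<eta> where "\<eta> = 1 / ((real (card J) + 1) * M)"
  have "\<eta> > 0" using \<open>M > 0\<close> by (simp add: \<eta>_def)
  have "\<not> row_dep I J b" if b: "\<forall>j\<in>J. \<forall>i\<in>I. \<bar>b j i - a j i\<bar> < \<eta>" for b
  proof
    assume "row_dep I J b"
    then obtain c where c: "\<exists>j\<in>J. c j \<noteq> 0" "\<forall>i\<in>I. (\<Sum>j\<in>J. c j * b j i) = 0" unfolding row_dep_def by auto
    define m where "m = Max ((\<lambda>j. \<bar>c j\<bar>) ` J)"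
    have "J \<noteq> {}" using c by auto
    have "m \<in> (\<lambda>j. \<bar>c j\<bar>) ` J" unfolding m_def using fin \<open>J \<noteq> {}\<close> by (intro Max_in) auto
    then obtain j' where j': "j' \<in> J" "m = \<bar>c j'\<bar>" by auto
    have m: "\<bar>c j\<bar> \<le> m" if "j \<in> J" for j unfolding m_def using fin that by (intro Max_ge) auto
    have "m > 0" using c(1) m by (meson abs_ge_zero less_le_trans zero_less_abs_iff)
    have "(\<Sum>j\<in>J. c j * (\<Sum>i\<in>I. b j i * \<xi> j' i)) = (\<Sum>i\<in>I. \<Sum>j\<in>J. (c j * b j i) * \<xi> j' i)"
      by (subst sum.swap) (simp add: sum_distrib_left mult.assoc)
    also have "\<dots> = (\<Sum>i\<in>I. (\<Sum>j\<in>J. c j * b j i) * \<xi> j' i)" by (simp add: sum_distrib_right)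
    also have "\<dots> = 0" using c(2) by simp
    finally have 1: "(\<Sum>j\<in>J. c j * (\<Sum>i\<in>I. b j i * \<xi> j' i)) = 0" .
    have "(\<Sum>j\<in>J. c j * (\<Sum>i\<in>I. a j i * \<xi> j' i)) = (\<Sum>j\<in>J. if j = j' then c j' else 0)"
      using \<xi> by (intro sum.cong) auto
    then have "c j' = (\<Sum>j\<in>J. c j * (\<Sum>i\<in>I. a j i * \<xi> j' i))"
      using fin(2) j'(1) by simp
    also have "\<dots> = (\<Sum>j\<in>J. c j * (\<Sum>i\<in>I. (a j i - b j i) * \<xi> j' i))"
      using 1 by (simp add: left_diff_distrib sum_subtractf right_diff_distrib)
    finally have "m \<le> (\<Sum>j\<in>J. \<bar>c j * (\<Sum>i\<in>I. (a j i - b j i) * \<xi> j' i)\<bar>)"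
      unfolding j'(2) by (simp add: sum_abs)
    also have "\<dots> \<le> (\<Sum>j\<in>J. m * (\<eta> * M))"
    proof (rule sum_mono)
      fix j assume j: "j \<in> J"
      have "\<bar>\<Sum>i\<in>I. (a j i - b j i) * \<xi> j' i\<bar> \<le> (\<Sum>i\<in>I. \<bar>(a j i - b j i) * \<xi> j' i\<bar>)" by (rule sum_abs)
      also have "\<dots> \<le> (\<Sum>i\<in>I. \<eta> * \<bar>\<xi> j' i\<bar>)"
        unfolding abs_mult using b j by (intro sum_mono mult_right_mono) (auto simp: abs_minus_commute less_imp_le)
      also have "\<dots> \<le> \<eta> * M" using M[OF j'(1)] \<open>\<eta> > 0\<close> by (simp add: sum_distrib_left[symmetric])
      finally show "\<bar>c j * (\<Sum>i\<in>I. (a j i - b j i) * \<xi> j' i)\<bar> \<le> m * (\<eta> * M)"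
        unfolding abs_mult using m[OF j] by (intro mult_mono) auto
    qed
    also have "\<dots> = m * (real (card J) * (\<eta> * M))" by simp
    also have "\<dots> < m * 1"
    proof (rule mult_strict_left_mono)
      have "real (card J) * (\<eta> * M) = real (card J) / (real (card J) + 1)" using \<open>M > 0\<close> by (simp add: \<eta>_def)
      also have "\<dots> < 1" by simp
      finally show "real (card J) * (\<eta> * M) < 1" .
    qed (use \<open>m > 0\<close> in simp)
    finally show False by simp
  qed
  with \<open>\<eta> > 0\<close> show ?thesis by blast
qed

text \<open>Tonelli's theorem for the indicator of \<open>E\<close>. The slices inherit
  measurability from \<open>E\<close>, so containment in null sets makes them null.\<close>

lemma prod_null_fubini:
  assumes "finite J" "j \<in> J" and E: "E \<in> sets (PiM J (\<lambda>_. lborel))"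
    and slices: "\<And>t. prod_null (J - {j}) {w \<in> (J - {j}) \<rightarrow>\<^sub>E UNIV. w(j := t) \<in> E}"
  shows "prod_null J E"
proof -
  let ?M = "\<lambda>J. PiM J (\<lambda>_. lborel :: real measure)"
  define K where "K = J - {j}"
  have J: "J = insert j K" "finite K" "j \<notin> K" using assms(1,2) by (auto simp: K_def)
  have ind: "(indicator E :: _ \<Rightarrow> ennreal) \<in> borel_measurable (?M (insert j K))" using E J(1) by simp
  have meas: "(\<lambda>w. w(j := t)) \<in> measurable (?M K) (?M J)" for t
    by (rule measurable_fun_upd[of _ K]) (auto simp: J(1))
  have slice0: "(\<integral>\<^sup>+w. indicator E (w(j := t)) \<partial>?M K) = 0" for t
  proof -
    have m: "{w \<in> space (?M K). w(j := t) \<in> E} \<in> sets (?M K)"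
      using measurable_sets[OF meas E, of t] by (simp add: vimage_def Int_def conj_commute)
    obtain Z where Z: "Z \<in> null_sets (?M K)" "{w \<in> K \<rightarrow>\<^sub>E UNIV. w(j := t) \<in> E} \<subseteq> Z"
      using slices[of t] unfolding prod_null_def K_def by blast
    have "{w \<in> space (?M K). w(j := t) \<in> E} \<subseteq> Z" using Z(2) by (simp add: space_PiM)
    with Z(1) m have n: "{w \<in> space (?M K). w(j := t) \<in> E} \<in> null_sets (?M K)"
      by (rule null_sets_subset)
    have "(\<integral>\<^sup>+w. indicator E (w(j := t)) \<partial>?M K) = (\<integral>\<^sup>+w. indicator {w \<in> space (?M K). w(j := t) \<in> E} w \<partial>?M K)"
      by (intro nn_integral_cong) (auto simp: indicator_def)
    also have "\<dots> = 0" using n m by (simp add: null_sets_def)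
    finally show ?thesis .
  qed
  have "emeasure (?M J) E = (\<integral>\<^sup>+w. indicator E w \<partial>?M J)" using E by simp
  also have "\<dots> = (\<integral>\<^sup>+t. (\<integral>\<^sup>+w. indicator E (w(j := t)) \<partial>?M K) \<partial>lborel)"
    unfolding J(1) using lb.product_nn_integral_insert_rev[OF J(2,3) ind] .
  also have "\<dots> = 0" unfolding slice0 by simp
  finally have "E \<in> null_sets (?M J)" using E by (auto simp: null_sets_def)
  then show ?thesis unfolding prod_null_def by blast
qed

text \<open>Supplies the measurability that slicing requires. A point outside the image has positive
  distance from it, so the complement is the union of the countably many rational boxes that miss
  the image.\<close>

lemma compact_image_sets:
  fixes h :: "'j \<Rightarrow> ('i \<Rightarrow> real) \<Rightarrow> real"
  assumes fin: "finite J" and D: "compact D" and h: "\<And>j. j \<in> J \<Longrightarrow> continuous_on D (h j)"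
  shows "(\<lambda>y. \<lambda>j\<in>J. h j y) ` D \<in> sets (PiM J (\<lambda>_. lborel))"
proof -
  let ?E = "(\<lambda>y. \<lambda>j\<in>J. h j y) ` D"
  let ?M = "PiM J (\<lambda>_. lborel) :: ('j \<Rightarrow> real) measure"
  define bx where "bx = (\<lambda>(q, n). {w \<in> J \<rightarrow>\<^sub>E (UNIV :: real set). \<forall>k\<in>J. \<bar>w k - q k\<bar> < 1 / real (Suc n)})"
  have bxs: "bx p \<in> sets ?M" for p
  proof -
    have "bx p = (\<Pi>\<^sub>E k\<in>J. {fst p k - 1 / real (Suc (snd p))<..<fst p k + 1 / real (Suc (snd p))})"
      unfolding bx_def case_prod_beta PiE_iff[abs_def] set_eq_iff
      by (simp add: PiE_iff abs_less_iff algebra_simps conj_commute cong: conj_cong)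
    then show ?thesis using fin by (auto intro!: sets_PiM_I_finite)
  qed
  define T where "T = {p \<in> (J \<rightarrow>\<^sub>E \<rat>) \<times> (UNIV :: nat set). bx p \<inter> ?E = {}}"
  have "countable ((J \<rightarrow>\<^sub>E \<rat>) \<times> (UNIV :: nat set))"
    using fin by (intro countable_SIGMA countable_PiE) (auto simp: countable_rat)
  then have cT: "countable T" unfolding T_def by (rule countable_subset[rotated]) auto
  have "(\<Union>p\<in>T. bx p) = space ?M - ?E"
  proof (intro equalityI subsetI)
    fix w assume "w \<in> (\<Union>p\<in>T. bx p)"
    then show "w \<in> space ?M - ?E" by (auto simp: T_def bx_def space_PiM)
  next
    fix w assume w: "w \<in> space ?M - ?E"
    then have wP: "w \<in> J \<rightarrow>\<^sub>E UNIV" by (simp add: space_PiM)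
    \<comment> \<open>The l1-distance from \<open>w\<close> attains its minimum on the compact
      \<open>D\<close>, and a minimum of 0 would put \<open>w\<close> into the image.\<close>
    have "\<exists>\<mu>>0. \<forall>y\<in>D. \<mu> \<le> (\<Sum>j\<in>J. \<bar>h j y - w j\<bar>)"
    proof (cases "D = {}")
      case True then show ?thesis by (intro exI[of _ 1]) auto
    next
      case False
      have "continuous_on D (\<lambda>y. \<Sum>j\<in>J. \<bar>h j y - w j\<bar>)" using h by (intro continuous_intros) auto
      then obtain y where y: "y \<in> D" "\<forall>y'\<in>D. (\<Sum>j\<in>J. \<bar>h j y - w j\<bar>) \<le> (\<Sum>j\<in>J. \<bar>h j y' - w j\<bar>)"
        using continuous_attains_inf[OF D False] by blast
      have "(\<Sum>j\<in>J. \<bar>h j y - w j\<bar>) \<noteq> 0"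
      proof
        assume "(\<Sum>j\<in>J. \<bar>h j y - w j\<bar>) = 0"
        then have "\<forall>j\<in>J. h j y = w j" using fin by (subst (asm) sum_nonneg_eq_0_iff) auto
        then have "w = (\<lambda>j\<in>J. h j y)" using wP by (auto simp: PiE_iff extensional_def fun_eq_iff)
        with y(1) w show False by blast
      qed
      moreover have "0 \<le> (\<Sum>j\<in>J. \<bar>h j y - w j\<bar>)" by (intro sum_nonneg) auto
      ultimately have "(\<Sum>j\<in>J. \<bar>h j y - w j\<bar>) > 0" by linarith
      with y(2) show ?thesis by blast
    qed
    then obtain \<mu> where \<mu>: "\<mu> > 0" "\<And>y. y \<in> D \<Longrightarrow> \<mu> \<le> (\<Sum>j\<in>J. \<bar>h j y - w j\<bar>)" by blast
    \<comment> \<open>If a point of the image were within \<open>d\<close> of \<open>w\<close> in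
      every coordinate, its l1-distance would be at most card J times \<open>d\<close>, which is
      below \<mu>.\<close>
    define d where "d = \<mu> / (real (card J) + 1)"
    have "d > 0" using \<mu> by (simp add: d_def)
    obtain q n where q: "q \<in> J \<rightarrow>\<^sub>E \<rat>" "2 / real (Suc n) < d" "\<forall>k\<in>J. \<bar>w k - q k\<bar> < 1 / real (Suc n)"
      using rational_box[OF fin \<open>d > 0\<close>, of w] by auto
    have "(\<lambda>j\<in>J. h j y) \<notin> bx (q, n)" if y: "y \<in> D" for y
    proof
      assume "(\<lambda>j\<in>J. h j y) \<in> bx (q, n)"
      then have b: "\<forall>k\<in>J. \<bar>h k y - q k\<bar> < 1 / real (Suc n)" by (auto simp: bx_def)
      have "(\<Sum>j\<in>J. \<bar>h j y - w j\<bar>) \<le> (\<Sum>j\<in>J. d)"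
      proof (rule sum_mono)
        fix k assume "k \<in> J"
        then have "\<bar>h k y - q k\<bar> < 1 / real (Suc n)" "\<bar>w k - q k\<bar> < 1 / real (Suc n)" using b q by auto
        moreover have "1 / real (Suc n) + 1 / real (Suc n) < d" using q(2) by (simp add: field_simps)
        ultimately show "\<bar>h k y - w k\<bar> \<le> d" by linarith
      qed
      also have "\<dots> < \<mu>" using \<mu>(1) by (simp add: d_def field_simps)
      finally show False using \<mu>(2)[OF y] by simp
    qed
    then have "(q, n) \<in> T" using q(1) by (auto simp: T_def)
    moreover have "w \<in> bx (q, n)" using wP q(3) by (auto simp: bx_def)
    ultimately show "w \<in> (\<Union>p\<in>T. bx p)" by blast
  qed
  moreover have "(\<Union>p\<in>T. bx p) \<in> sets ?M" using cT bxs by (intro sets.countable_UN') auto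
  ultimately have "space ?M - ?E \<in> sets ?M" by simp
  then have "space ?M - (space ?M - ?E) \<in> sets ?M" by (rule sets.compl_sets)
  moreover have "?E \<subseteq> space ?M" by (auto simp: space_PiM)
  ultimately show ?thesis by (simp add: double_diff)
qed

abbreviation (input) jac :: "('j \<Rightarrow> ('i \<Rightarrow> real) \<Rightarrow> real) \<Rightarrow> ('i \<Rightarrow> real) \<Rightarrow> 'j \<Rightarrow> 'i \<Rightarrow> real"
  where "jac f x \<equiv> \<lambda>j i. partial i (f j) x"

text \<open>Independence of rows persists under small changes (\<open>indep_open\<close>) and the
  partial derivatives are continuous, so the critical points form a relatively closed subset of the
  cube.\<close>

lemma compact_critical:
  fixes h :: "'j \<Rightarrow> ('i \<Rightarrow> real) \<Rightarrow> real"
  assumes fin: "finite I" "finite J" and h: "\<forall>j\<in>J. C1 I W (h j)" and Q: "cube I d y0 \<subseteq> W"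
  shows "compact {y\<in>cube I d y0. row_dep I J (jac h y)}"
proof (rule closedin_compact[OF compact_cube])
  let ?Q = "cube I d y0" and ?D = "{y\<in>cube I d y0. row_dep I J (jac h y)}"
  have "openin (top_of_set ?Q) (?Q - ?D)"
    unfolding openin_subopen[of _ "?Q - ?D"]
  proof
    fix y assume y: "y \<in> ?Q - ?D"
    then obtain \<eta> where \<eta>: "\<eta> > 0" "\<And>b. \<forall>j\<in>J. \<forall>i\<in>I. \<bar>b j i - jac h y j i\<bar> < \<eta> \<Longrightarrow> \<not> row_dep I J b"
      using indep_open[OF fin, of "jac h y"] by blast
    have "\<forall>\<^sub>F z in nbhd I y. \<forall>j\<in>J. \<forall>i\<in>I. \<bar>jac h z j i - jac h y j i\<bar> < \<eta>"
    proof (intro eventually_ball_finite[OF fin(2)] ballI eventually_ball_finite[OF fin(1)])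
      fix j i assume "j \<in> J" "i \<in> I"
      then have "(partial i (h j) \<longlongrightarrow> partial i (h j) y) (nbhd I y)"
        using h y Q by (auto simp: C1_def icont_def)
      then show "\<forall>\<^sub>F z in nbhd I y. \<bar>jac h z j i - jac h y j i\<bar> < \<eta>"
        using \<eta>(1) by (auto simp: tendsto_iff dist_real_def)
    qed
    then obtain \<delta> where \<delta>: "\<delta> > 0" "\<And>z. near I \<delta> y z \<Longrightarrow> \<forall>j\<in>J. \<forall>i\<in>I. \<bar>jac h z j i - jac h y j i\<bar> < \<eta>"
      unfolding eventually_nbhd by blast
    let ?O = "?Q \<inter> {z. \<forall>k\<in>I. \<bar>z k - y k\<bar> < \<delta>}"
    have "openin (top_of_set ?Q) ?O" using open_box[OF fin(1), of y \<delta>] by (rule openin_open_Int)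
    moreover have "y \<in> ?O" using y \<delta>(1) by auto
    moreover have "?O \<subseteq> ?Q - ?D"
    proof
      fix z assume z: "z \<in> ?O"
      then have "near I \<delta> y z" using y by (auto simp: near_def cube_def)
      from \<eta>(2)[OF \<delta>(2)[OF this]] z show "z \<in> ?Q - ?D" by blast
    qed
    ultimately show "\<exists>T. openin (top_of_set ?Q) T \<and> y \<in> T \<and> T \<subseteq> ?Q - ?D" by blast
  qed
  then show "closedin (top_of_set ?Q) ?D"
    unfolding closedin_def by auto
qed

text \<open>The function \<open>f j0\<close> becomes a coordinate in place of \<open>x i\<close>.
  Row \<open>j0\<close> of the new Jacobian is then a unit vector, ready for
  \<open>row_dep_drop\<close>; dependence of rows is unaffected because the Jacobian is multiplied
  by the invertible Jacobian of the coordinate change.\<close>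

lemma eliminate:
  fixes f :: "'j \<Rightarrow> ('i \<Rightarrow> real) \<Rightarrow> real"
  assumes fin: "finite I" and W: "iopen I W" "x0 \<in> W" and f: "\<forall>j\<in>J. Ck (Suc r) I W (f j)"
    and j0: "j0 \<in> J" and i: "i \<in> I" and nz: "partial i (f j0) x0 \<noteq> 0"
  obtains V W' \<gamma> where "iopen I V" "iopen I W'" "x0 \<in> V" "V \<subseteq> W"
    "\<forall>y\<in>W'. y(i := \<gamma> y) \<in> V \<and> f j0 (y(i := \<gamma> y)) = y i"
    "\<forall>x\<in>V. x(i := f j0 x) \<in> W' \<and> \<gamma> (x(i := f j0 x)) = x i"
    "\<forall>j\<in>J. Ck (Suc r) I W' (\<lambda>y. f j (y(i := \<gamma> y)))"
    "\<And>y l. y \<in> W' \<Longrightarrow> l \<in> I \<Longrightarrow> jac (\<lambda>j y. f j (y(i := \<gamma> y))) y j0 l = (if l = i then 1 else 0)"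
    "\<And>y L. y \<in> W' \<Longrightarrow> L \<subseteq> J \<Longrightarrow> row_dep I L (jac f (y(i := \<gamma> y))) \<longleftrightarrow> row_dep I L (jac (\<lambda>j y. f j (y(i := \<gamma> y))) y)"
proof -
  obtain V W' \<gamma> where V: "iopen I V" "iopen I W'" "x0 \<in> V" "V \<subseteq> W" and \<gamma>: "Ck (Suc r) I W' \<gamma>"
    and \<gamma>1: "\<forall>y\<in>W'. y(i := \<gamma> y) \<in> V \<and> f j0 (y(i := \<gamma> y)) = y i"
    and \<gamma>2: "\<forall>x\<in>V. x(i := f j0 x) \<in> W' \<and> \<gamma> (x(i := f j0 x)) = x i"
    by (rule elementary_inverse[OF fin W i bspec[OF f j0] nz]) blast
  have m: "\<forall>y\<in>W'. y(i := \<gamma> y) \<in> W" using \<gamma>1 V(4) by blast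
  let ?h = "\<lambda>j y. f j (y(i := \<gamma> y))"
  have Ckh: "\<forall>j\<in>J. Ck (Suc r) I W' (?h j)"
  proof
    fix j assume "j \<in> J"
    then show "Ck (Suc r) I W' (?h j)" by (rule Ck_substitute[OF fin V(2) W(1) i m \<gamma> bspec[OF f]])
  qed
  have part: "partial l (?h j) y =
      (if l = i then 0 else partial l (f j) (y(i := \<gamma> y))) + partial i (f j) (y(i := \<gamma> y)) * partial l \<gamma> y"
    if "y \<in> W'" "l \<in> I" "j \<in> J" for y l j
    by (rule partialI, rule deriv_substitute[OF fin V(2) W(1) i m C1_idiff[OF Ck_Suc_C1[OF \<gamma>]]
          Ck_Suc_C1[OF bspec[OF f that(3)]] that(1,2)])
  have row: "partial l (?h j0) y = (if l = i then 1 else 0)" if "y \<in> W'" "l \<in> I" for y l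
  proof -
    have "partial l (?h j0) y = partial l (\<lambda>y. y i) y"
      by (rule partial_cong[OF V(2) _ that]) (use \<gamma>1 in blast)
    also have "\<dots> = (if l = i then 1 else 0)" by (rule partialI) (auto simp: fun_upd_apply)
    finally show ?thesis .
  qed
  have depeq: "row_dep I L (jac f (y(i := \<gamma> y))) \<longleftrightarrow> row_dep I L (jac ?h y)" if y: "y \<in> W'" and L: "L \<subseteq> J" for y L
  proof -
    have s: "(\<Sum>j\<in>L. c j * partial l (?h j) y) = (if l = i then 0 else \<Sum>j\<in>L. c j * partial l (f j) (y(i := \<gamma> y)))
        + (\<Sum>j\<in>L. c j * partial i (f j) (y(i := \<gamma> y))) * partial l \<gamma> y" if "l \<in> I" for c l
    proof -
      have "(\<Sum>j\<in>L. c j * partial l (?h j) y) = (\<Sum>j\<in>L. (if l = i then 0 else c j * partial l (f j) (y(i := \<gamma> y)))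
          + c j * partial i (f j) (y(i := \<gamma> y)) * partial l \<gamma> y)"
        using part[OF y that] L by (intro sum.cong) (auto simp: algebra_simps)
      then show ?thesis by (simp add: sum.distrib sum_distrib_right)
    qed
    \<comment> \<open>In row \<open>j0\<close> and column \<open>i\<close> the chain rule reads: 1
      is the product of the partial derivatives of \<open>f j0\<close> and of
      \<open>\<gamma>\<close>.\<close>
    have nz: "partial i \<gamma> y \<noteq> 0" using part[OF y i j0] row[OF y i] by auto
    have "(\<forall>l\<in>I. (\<Sum>j\<in>L. c j * partial l (f j) (y(i := \<gamma> y))) = 0) \<longleftrightarrow> (\<forall>l\<in>I. (\<Sum>j\<in>L. c j * partial l (?h j) y) = 0)" for c
    proof
      assume "\<forall>l\<in>I. (\<Sum>j\<in>L. c j * partial l (f j) (y(i := \<gamma> y))) = 0"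
      then show "\<forall>l\<in>I. (\<Sum>j\<in>L. c j * partial l (?h j) y) = 0" using s i by simp
    next
      assume a: "\<forall>l\<in>I. (\<Sum>j\<in>L. c j * partial l (?h j) y) = 0"
      have i0: "(\<Sum>j\<in>L. c j * partial i (f j) (y(i := \<gamma> y))) = 0" using a s[OF i, of c] i nz by simp
      show "\<forall>l\<in>I. (\<Sum>j\<in>L. c j * partial l (f j) (y(i := \<gamma> y))) = 0"
      proof
        fix l assume "l \<in> I"
        then show "(\<Sum>j\<in>L. c j * partial l (f j) (y(i := \<gamma> y))) = 0"
          using a s[of l c] i0 by (cases "l = i") auto
      qed
    qed
    then show ?thesis unfolding row_dep_def by blast
  qed
  show ?thesis by (rule that[OF V \<gamma>1 \<gamma>2 Ckh row depeq])
qed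

text \<open>Induction on the number of functions. Where all derivatives vanish, the functions are
  flat of order 1 and \<open>flat_nul\<close> applies. Elsewhere one function is made a coordinate;
  each of its level slices falls under the induction hypothesis with one variable and one function
  less, and Fubini's theorem assembles them. The class is C^(r + 1) with r + 1 > card I - card
  J.\<close>

lemma sard:
  fixes f :: "'j \<Rightarrow> ('i \<Rightarrow> real) \<Rightarrow> real"
  assumes "finite J" "finite I" "iopen I W" "\<forall>j\<in>J. Ck (Suc r) I W (f j)" "card I \<le> card J + r"
  shows "prod_null J ((\<lambda>x. \<lambda>j\<in>J. f j x) ` {x\<in>W. (\<forall>k. k \<notin> I \<longrightarrow> x k = z k) \<and> row_dep I J (jac f x)})"
  using assms
proof (induction "card J" arbitrary: J I W f z rule: less_induct)
  case less
  note finJ = less.prems(1) and finI = less.prems(2) and W = less.prems(3) and f = less.prems(4)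
  define Crit where "Crit = {x\<in>W. (\<forall>k. k \<notin> I \<longrightarrow> x k = z k) \<and> row_dep I J (jac f x)}"
  show ?case
  proof (cases "J = {}")
    case True
    then have "Crit = {}" by (simp add: Crit_def row_dep_def)
    then have "prod_null J ((\<lambda>x. \<lambda>j\<in>J. f j x) ` Crit)" unfolding prod_null_def by blast
    then show ?thesis unfolding Crit_def .
  next
    case False
    have CW: "Crit \<subseteq> W" and slice: "\<forall>x\<in>Crit. \<forall>k. k \<notin> I \<longrightarrow> x k = z k" by (auto simp: Crit_def)
    define A where "A = {x\<in>Crit. \<forall>j\<in>J. \<forall>i\<in>I. partial i (f j) x = 0}"
    have c1: "1 \<le> card J" using finJ False by (simp add: Suc_leI card_gt_0_iff)
    have 1: "prod_null J ((\<lambda>x. \<lambda>j\<in>J. f j x) ` A)"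
    proof (rule flat_nul[OF finJ False finI W, where m = 0 and k = r])
      show "A \<subseteq> W" "\<forall>x\<in>A. \<forall>k. k \<notin> I \<longrightarrow> x k = z k" using CW slice by (auto simp: A_def)
      have "r * 1 \<le> r * card J" using c1 by (rule mult_le_mono2)
      \<comment> \<open>For nonempty \<open>J\<close> the given bound implies the one required for
        mappings of rank 0.\<close>
      then have "card J + r \<le> (Suc 0 + r) * card J" by simp
      with less.prems(5) show "card I \<le> (Suc 0 + r) * card J" by (rule order_trans)
      show "\<forall>j\<in>J. flat (Suc 0) r I W A (f j)"
      proof
        fix j assume j: "j \<in> J"
        then have fj: "Ck (Suc r) I W (f j)" using f by blast
        have "C0_comb I W (\<lambda>p. flat 0 r I W A p \<and> (\<forall>x\<in>A. p x = 0)) (partial i (f j))" if "i \<in> I" for i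
        proof (rule C0_comb.gen)
          show "flat 0 r I W A (partial i (f j)) \<and> (\<forall>x\<in>A. partial i (f j) x = 0)"
            using fj j that by (simp add: A_def)
          show "icont I W (\<lambda>x. 1)" by (simp add: icont_def)
        qed simp
        with fj show "flat (Suc 0) r I W A (f j)" unfolding flat.simps(2) Ck.simps(2) by blast
      qed
    qed
    have 2: "prod_null J ((\<lambda>x. \<lambda>j\<in>J. f j x) ` (Crit - A))"
    proof (rule prod_null_local[OF finI])
      show "\<forall>x\<in>Crit - A. \<forall>k. k \<notin> I \<longrightarrow> x k = z k" using slice by blast
      fix x0 assume x0: "x0 \<in> Crit - A"
      then obtain j0 i where j0: "j0 \<in> J" and i: "i \<in> I" and nz: "partial i (f j0) x0 \<noteq> 0"
        by (auto simp: A_def)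
      have x0W: "x0 \<in> W" using x0 CW by blast
      obtain V W' \<gamma> where V: "iopen I V" "iopen I W'" "x0 \<in> V" "V \<subseteq> W"
        and \<gamma>1: "\<forall>y\<in>W'. y(i := \<gamma> y) \<in> V \<and> f j0 (y(i := \<gamma> y)) = y i"
        and \<gamma>2: "\<forall>x\<in>V. x(i := f j0 x) \<in> W' \<and> \<gamma> (x(i := f j0 x)) = x i"
        and Ckh: "\<forall>j\<in>J. Ck (Suc r) I W' (\<lambda>y. f j (y(i := \<gamma> y)))"
        and row: "\<And>y l. y \<in> W' \<Longrightarrow> l \<in> I \<Longrightarrow> jac (\<lambda>j y. f j (y(i := \<gamma> y))) y j0 l = (if l = i then 1 else 0)"
        and depeq: "\<And>y L. y \<in> W' \<Longrightarrow> L \<subseteq> J \<Longrightarrow>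
          row_dep I L (jac f (y(i := \<gamma> y))) \<longleftrightarrow> row_dep I L (jac (\<lambda>j y. f j (y(i := \<gamma> y))) y)"
        by (rule eliminate[OF finI W x0W f j0 i nz]) blast
      define h where "h = (\<lambda>j y. f j (y(i := \<gamma> y)))"
      define y0 where "y0 = x0(i := f j0 x0)"
      have "y0 \<in> W'" using \<gamma>2 V(3) by (simp add: y0_def)
      then obtain d where "d > 0" and d: "\<And>y. near I d y0 y \<Longrightarrow> y \<in> W'" using iopenD[OF V(2)] by blast
      define d' where "d' = d / 2"
      have d': "0 < d'" "d' < d" using \<open>d > 0\<close> by (auto simp: d'_def)
      have Q: "cube I d' y0 \<subseteq> W'" using cube_subset_near[OF _ d'(2)] d by blast
      \<comment> \<open>All critical points of a closed cube are taken, beyond those that come from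
        \<open>Crit - A\<close>, so that \<open>D\<close> is compact and its image
        measurable.\<close>
      define D where "D = {y\<in>cube I d' y0. row_dep I J (jac h y)}"
      have hC1: "\<forall>j\<in>J. C1 I W' (h j)" using Ckh Ck_Suc_C1 unfolding h_def by blast
      have cD: "compact D" unfolding D_def by (rule compact_critical[OF finI finJ hC1 Q])
      define E where "E = (\<lambda>y. \<lambda>j\<in>J. h j y) ` D"
      have E: "E \<in> sets (PiM J (\<lambda>_. lborel))"
        unfolding E_def
      proof (rule compact_image_sets[OF finJ cD])
        fix j assume "j \<in> J"
        then have "icont I W' (h j)" using hC1 by (simp add: C1_def)
        then show "continuous_on D (h j)"
          by (rule icont_continuous_on[OF finI, of W' _ _ y0]) (use Q in \<open>auto simp: D_def cube_def\<close>)
      qed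
      have "prod_null J E"
      proof (rule prod_null_fubini[OF finJ j0 E])
        \<comment> \<open>Since \<open>h j0 y = y i\<close>, the slice of \<open>E\<close> at height
          \<open>t\<close> comes from points whose coordinate \<open>i\<close> is \<open>t\<close>.
          Dropping \<open>i\<close> and \<open>j0\<close> together preserves card I - card
          J.\<close>
        fix t :: real
        have lt: "card (J - {j0}) < card J" using finJ j0 by (rule card_Diff1_less)
        have "prod_null (J - {j0}) ((\<lambda>x. \<lambda>j\<in>J - {j0}. h j x) ` {x\<in>W'. (\<forall>k. k \<notin> I - {i} \<longrightarrow> x k = (y0(i := t)) k) \<and>
            row_dep (I - {i}) (J - {j0}) (jac h x)})"
        proof (rule less.hyps[OF lt])
          show "finite (J - {j0})" "finite (I - {i})" using finI finJ by auto
          show "iopen (I - {i}) W'" by (rule iopen_mono[OF _ V(2)]) auto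
          show "\<forall>j\<in>J - {j0}. Ck (Suc r) (I - {i}) W' (h j)"
            using Ckh Ck_mono[of "Suc r" I W' _ "I - {i}" W'] unfolding h_def by blast
          have "card (I - {i}) = card I - 1" "card (J - {j0}) = card J - 1" using i j0 by auto
          then show "card (I - {i}) \<le> card (J - {j0}) + r" using less.prems(5) c1 by linarith
        qed
        then show "prod_null (J - {j0}) {w \<in> (J - {j0}) \<rightarrow>\<^sub>E UNIV. w(j0 := t) \<in> E}"
        proof (rule prod_null_subset, intro subsetI)
          fix w assume "w \<in> {w \<in> (J - {j0}) \<rightarrow>\<^sub>E UNIV. w(j0 := t) \<in> E}"
          then obtain y where wP: "w \<in> (J - {j0}) \<rightarrow>\<^sub>E UNIV" and y: "y \<in> D" "w(j0 := t) = (\<lambda>j\<in>J. h j y)"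
            by (auto simp: E_def)
          have yW: "y \<in> W'" using y(1) Q by (auto simp: D_def)
          have "h j0 y = t" using fun_cong[OF y(2), of j0] j0 by simp
          then have yi: "y i = t" using \<gamma>1 yW by (simp add: h_def)
          have "w = (\<lambda>j\<in>J - {j0}. h j y)"
          proof
            fix j show "w j = (\<lambda>j\<in>J - {j0}. h j y) j"
              using fun_cong[OF y(2), of j] wP by (cases "j \<in> J - {j0}") (auto simp: PiE_iff extensional_def)
          qed
          moreover have "row_dep (I - {i}) (J - {j0}) (jac h y)"
            using y(1) row_dep_drop[OF finJ j0 i, of "jac h y"] row[OF yW] by (simp add: D_def h_def)
          moreover have "y k = (y0(i := t)) k" if "k \<notin> I - {i}" for k
            using y(1) that yi by (cases "k = i") (auto simp: D_def cube_def)
          ultimately show "w \<in> (\<lambda>x. \<lambda>j\<in>J - {j0}. h j x) ` {x\<in>W'. (\<forall>k. k \<notin> I - {i} \<longrightarrow> x k = (y0(i := t)) k) \<and>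
            row_dep (I - {i}) (J - {j0}) (jac h x)}" using yW by blast
        qed
      qed
      moreover have "\<exists>\<delta>>0. (\<lambda>x. \<lambda>j\<in>J. f j x) ` {x\<in>Crit - A. near I \<delta> x0 x} \<subseteq> E"
      proof -
        have "(f j0 \<longlongrightarrow> f j0 x0) (nbhd I x0)"
          using Ck_icont[OF bspec[OF f j0]] x0W by (simp add: icont_def)
        then have "\<forall>\<^sub>F x in nbhd I x0. \<bar>f j0 x - f j0 x0\<bar> < d'"
          using d'(1) by (auto simp: tendsto_iff dist_real_def)
        moreover have "\<forall>\<^sub>F x in nbhd I x0. x \<in> V" using V(1,3) by (simp add: iopen_def)
        moreover have "\<forall>\<^sub>F x in nbhd I x0. near I d' x0 x" using d'(1) by (rule eventually_near)
        ultimately have "\<forall>\<^sub>F x in nbhd I x0. \<bar>f j0 x - f j0 x0\<bar> < d' \<and> x \<in> V \<and> near I d' x0 x"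
          by eventually_elim simp
        then obtain \<delta> where \<delta>: "\<delta> > 0"
          "\<And>x. near I \<delta> x0 x \<Longrightarrow> \<bar>f j0 x - f j0 x0\<bar> < d' \<and> x \<in> V \<and> near I d' x0 x"
          unfolding eventually_nbhd by blast
        have "(\<lambda>j\<in>J. f j x) \<in> E" if x: "x \<in> Crit - A" "near I \<delta> x0 x" for x
        proof -
          define y where "y = x(i := f j0 x)"
          have x': "\<bar>f j0 x - f j0 x0\<bar> < d'" "x \<in> V" "near I d' x0 x" using \<delta>(2)[OF x(2)] by auto
          then have y: "y \<in> W'" "y(i := \<gamma> y) = x" using \<gamma>2 by (auto simp: y_def)
          have "y \<in> cube I d' y0" using x' i by (auto simp: cube_def near_def y_def y0_def)
          moreover have "row_dep I J (jac h y)"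
            using depeq[OF y(1) order_refl] x(1) unfolding y(2) h_def by (simp add: Crit_def)
          ultimately have "y \<in> D" by (simp add: D_def)
          moreover have "(\<lambda>j\<in>J. f j x) = (\<lambda>j\<in>J. h j y)" by (simp only: h_def y(2))
          ultimately show ?thesis unfolding E_def by blast
        qed
        with \<delta>(1) show ?thesis by blast
      qed
      ultimately show "\<exists>d>0. prod_null J ((\<lambda>x. \<lambda>j\<in>J. f j x) ` {x\<in>Crit - A. near I d x0 x})"
        using prod_null_subset by blast
    qed
    have "(\<lambda>x. \<lambda>j\<in>J. f j x) ` Crit \<subseteq> (\<lambda>x. \<lambda>j\<in>J. f j x) ` A \<union> (\<lambda>x. \<lambda>j\<in>J. f j x) ` (Crit - A)" by blast
    then have "prod_null J ((\<lambda>x. \<lambda>j\<in>J. f j x) ` Crit)" by (rule prod_null_subset[OF prod_null_Un[OF 1 2]])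
    then show ?thesis unfolding Crit_def .
  qed
qed

text \<open>Sard's theorem for the functions of \<open>K\<close> on the regular zero set of those of
  \<open>J\<close>, without constructing a submanifold. Each equation is made a coordinate and
  becomes the slice at 0, so that variables and equations disappear in pairs until
  \<open>sard\<close> applies. As the rows of \<open>J\<close> are independent, dependence of all
  rows together expresses criticality on the zero set.\<close>

lemma sard_fiber:
  fixes f :: "'j \<Rightarrow> ('i \<Rightarrow> real) \<Rightarrow> real"
  assumes K: "finite K" and J: "finite J"
  shows "finite I \<Longrightarrow> iopen I W \<Longrightarrow> K \<inter> J = {} \<Longrightarrow> \<forall>j\<in>K \<union> J. Ck (Suc r) I W (f j) \<Longrightarrow>
    card I \<le> card (K \<union> J) + r \<Longrightarrow>
    prod_null K ((\<lambda>x. \<lambda>j\<in>K. f j x) ` {x\<in>W. (\<forall>k. k \<notin> I \<longrightarrow> x k = z k) \<and> (\<forall>j\<in>J. f j x = 0) \<and>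
      \<not> row_dep I J (jac f x) \<and> row_dep I (K \<union> J) (jac f x)})"
  using J
proof (induction J arbitrary: I W f z rule: finite_induct)
  case empty
  have "prod_null K ((\<lambda>x. \<lambda>j\<in>K. f j x) ` {x\<in>W. (\<forall>k. k \<notin> I \<longrightarrow> x k = z k) \<and> row_dep I K (jac f x)})"
    by (rule sard[OF K]) (use empty in auto)
  then show ?case by (rule prod_null_subset[OF _ image_mono]) auto
next
  case (insert j0 J)
  let ?J = "insert j0 J"
  note finI = insert.prems(1) and W = insert.prems(2) and f = insert.prems(4)
  have finJ: "finite ?J" and finKJ: "finite (K \<union> ?J)" using insert.hyps K by auto
  show ?case
  proof (rule prod_null_local[OF finI])
    let ?S = "{x\<in>W. (\<forall>k. k \<notin> I \<longrightarrow> x k = z k) \<and> (\<forall>j\<in>?J. f j x = 0) \<and>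
      \<not> row_dep I ?J (jac f x) \<and> row_dep I (K \<union> ?J) (jac f x)}"
    show "\<forall>x\<in>?S. \<forall>k. k \<notin> I \<longrightarrow> x k = z k" by blast
    fix x0 assume x0: "x0 \<in> ?S"
    have "\<exists>i\<in>I. partial i (f j0) x0 \<noteq> 0"
    proof (rule ccontr)
      assume "\<not> (\<exists>i\<in>I. partial i (f j0) x0 \<noteq> 0)"
      then have "row_dep I ?J (jac f x0)"
        unfolding row_dep_def using insert.hyps by (intro exI[of _ "\<lambda>j. if j = j0 then 1 else 0"]) (auto intro!: sum.neutral)
      with x0 show False by blast
    qed
    then obtain i where i: "i \<in> I" and nz: "partial i (f j0) x0 \<noteq> 0" by blast
    have x0W: "x0 \<in> W" using x0 by blast
    have j0: "j0 \<in> K \<union> ?J" "j0 \<in> ?J" by auto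
    obtain V W' \<gamma> where V: "iopen I V" "iopen I W'" "x0 \<in> V" "V \<subseteq> W"
      and \<gamma>1: "\<forall>y\<in>W'. y(i := \<gamma> y) \<in> V \<and> f j0 (y(i := \<gamma> y)) = y i"
      and \<gamma>2: "\<forall>x\<in>V. x(i := f j0 x) \<in> W' \<and> \<gamma> (x(i := f j0 x)) = x i"
      and Ckh: "\<forall>j\<in>K \<union> ?J. Ck (Suc r) I W' (\<lambda>y. f j (y(i := \<gamma> y)))"
      and row: "\<And>y l. y \<in> W' \<Longrightarrow> l \<in> I \<Longrightarrow> jac (\<lambda>j y. f j (y(i := \<gamma> y))) y j0 l = (if l = i then 1 else 0)"
      and depeq: "\<And>y L. y \<in> W' \<Longrightarrow> L \<subseteq> K \<union> ?J \<Longrightarrow>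
        row_dep I L (jac f (y(i := \<gamma> y))) \<longleftrightarrow> row_dep I L (jac (\<lambda>j y. f j (y(i := \<gamma> y))) y)"
      by (rule eliminate[OF finI W x0W f j0(1) i nz]) blast
    define h where "h = (\<lambda>j y. f j (y(i := \<gamma> y)))"
    let ?B = "{y\<in>W'. (\<forall>k. k \<notin> I - {i} \<longrightarrow> y k = (z(i := 0)) k) \<and> (\<forall>j\<in>J. h j y = 0) \<and>
      \<not> row_dep (I - {i}) J (jac h y) \<and> row_dep (I - {i}) (K \<union> J) (jac h y)}"
    have nB: "prod_null K ((\<lambda>x. \<lambda>j\<in>K. h j x) ` ?B)"
    proof (rule insert.IH)
      show "finite (I - {i})" using finI by simp
      show "iopen (I - {i}) W'" by (rule iopen_mono[OF _ V(2)]) auto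
      show "K \<inter> J = {}" using insert.prems(3) by blast
      show "\<forall>j\<in>K \<union> J. Ck (Suc r) (I - {i}) W' (h j)"
        using Ckh Ck_mono[of "Suc r" I W' _ "I - {i}" W'] unfolding h_def by blast
      have "card (K \<union> ?J) = Suc (card (K \<union> J))"
        using insert.prems(3) insert.hyps K by (simp add: card_insert_if)
      moreover have "card (I - {i}) = card I - 1" using i by simp
      ultimately show "card (I - {i}) \<le> card (K \<union> J) + r" using insert.prems(5) by linarith
    qed
    obtain d where d: "d > 0" "\<And>y. near I d x0 y \<Longrightarrow> y \<in> V" using iopenD[OF V(1,3)] by blast
    have "(\<lambda>x. \<lambda>j\<in>K. f j x) ` {x\<in>?S. near I d x0 x} \<subseteq> (\<lambda>x. \<lambda>j\<in>K. h j x) ` ?B"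
    proof (rule image_subsetI)
      fix x assume x: "x \<in> {x\<in>?S. near I d x0 x}"
      define y where "y = x(i := f j0 x)"
      have xV: "x \<in> V" using x d by blast
      then have y: "y \<in> W'" "y(i := \<gamma> y) = x" using \<gamma>2 by (auto simp: y_def)
      have fh: "f j x = h j y" for j by (simp only: h_def y(2))
      have "y k = (z(i := 0)) k" if "k \<notin> I - {i}" for k
        using x that by (cases "k = i") (auto simp: y_def)
      moreover have "\<forall>j\<in>J. h j y = 0" using x fh by auto
      moreover have "\<not> row_dep (I - {i}) J (jac h y)"
      proof -
        have "\<not> row_dep I ?J (jac h y)" using depeq[OF y(1), of ?J] x unfolding y(2) h_def by auto
        moreover have "?J - {j0} = J" using insert.hyps by auto
        ultimately show ?thesis using row_dep_drop[OF finJ j0(2) i, of "jac h y"] row[OF y(1)] by (simp add: h_def)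
      qed
      moreover have "row_dep (I - {i}) (K \<union> J) (jac h y)"
      proof -
        have "row_dep I (K \<union> ?J) (jac h y)" using depeq[OF y(1), of "K \<union> ?J"] x unfolding y(2) h_def by auto
        moreover have "K \<union> ?J - {j0} = K \<union> J" using insert.hyps insert.prems(3) by auto
        ultimately show ?thesis using row_dep_drop[OF finKJ j0(1) i, of "jac h y"] row[OF y(1)] by (simp add: h_def)
      qed
      ultimately have "y \<in> ?B" using y(1) by blast
      then show "(\<lambda>j\<in>K. f j x) \<in> (\<lambda>x. \<lambda>j\<in>K. h j x) ` ?B" unfolding fh by blast
    qed
    then have "prod_null K ((\<lambda>x. \<lambda>j\<in>K. f j x) ` {x\<in>?S. near I d x0 x})" by (rule prod_null_subset[OF nB])
    with d(1) show "\<exists>d>0. prod_null K ((\<lambda>x. \<lambda>j\<in>K. f j x) ` {x\<in>?S. near I d x0 x})" by blast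
  qed
qed

section \<open>Coordinates on manifolds\<close>

lemma iopen_eventually: "iopen I W \<Longrightarrow> x \<in> W \<Longrightarrow> \<forall>\<^sub>F y in nbhd I x. y \<in> W"
  unfolding iopen_def by blast

text \<open>Extensional functions agree off \<open>I\<close>, so
  \<open>I \<rightarrow>\<^sub>E UNIV\<close> is a single slice and the product topology is its
  slice topology.\<close>

lemma openin_powertop_iff:
  assumes "finite I"
  shows "openin (powertop_real I) W \<longleftrightarrow> W \<subseteq> (I \<rightarrow>\<^sub>E UNIV) \<and> iopen I W"
proof
  assume W: "openin (powertop_real I) W"
  have "iopen I W"
    unfolding iopen_def eventually_nbhd
  proof
    fix x assume "x \<in> W"
    from product_topology_open_contains_basis[OF W this]
    obtain X where X: "x \<in> Pi\<^sub>E I X" "\<And>i. open (X i)" "Pi\<^sub>E I X \<subseteq> W" by auto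
    have "\<forall>i\<in>I. \<exists>e>0. ball (x i) e \<subseteq> X i"
      using X(1,2) by (auto simp: PiE_iff intro: openE)
    from bchoice[OF this] obtain e where e: "\<forall>i\<in>I. e i > 0 \<and> ball (x i) (e i) \<subseteq> X i" by blast
    define d where "d = Min (insert 1 (e ` I))"
    have "d > 0" unfolding d_def using assms e by (subst Min_gr_iff) auto
    have d: "d \<le> e i" if "i \<in> I" for i unfolding d_def using assms that by (intro Min_le) auto
    have "y \<in> W" if y: "near I d x y" for y
    proof -
      have "y i \<in> X i" if "i \<in> I" for i
      proof -
        have "y i \<in> ball (x i) (e i)" using y that d[OF that] by (auto simp: near_def dist_real_def abs_minus_commute)
        with e that show ?thesis by blast
      qed
      moreover have "y \<in> extensional I" using y X(1) by (auto simp: near_def PiE_iff extensional_def)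
      ultimately have "y \<in> Pi\<^sub>E I X" by (simp add: PiE_iff)
      then show ?thesis using X(3) by blast
    qed
    with \<open>d > 0\<close> show "\<exists>d>0. \<forall>y. near I d x y \<longrightarrow> y \<in> W" by blast
  qed
  moreover have "W \<subseteq> (I \<rightarrow>\<^sub>E UNIV)" using openin_subset[OF W] by simp
  ultimately show "W \<subseteq> (I \<rightarrow>\<^sub>E UNIV) \<and> iopen I W" by blast
next
  assume W: "W \<subseteq> (I \<rightarrow>\<^sub>E UNIV) \<and> iopen I W"
  show "openin (powertop_real I) W"
    unfolding openin_subopen[of _ W]
  proof
    fix x assume x: "x \<in> W"
    then obtain d where d: "d > 0" "\<And>y. near I d x y \<Longrightarrow> y \<in> W" using W iopenD by blast
    let ?T = "\<Pi>\<^sub>E i\<in>I. ball (x i) d"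
    have xP: "x \<in> (I \<rightarrow>\<^sub>E UNIV)" using x W by blast
    have "openin (powertop_real I) ?T" using assms by (intro openin_PiE[THEN iffD2]) auto
    moreover have "x \<in> ?T" using xP d(1) by (auto simp: PiE_iff)
    moreover have "?T \<subseteq> W"
    proof
      fix y assume y: "y \<in> ?T"
      have "near I d x y"
        unfolding near_def
      proof (intro conjI allI impI ballI)
        fix k assume "k \<notin> I" then show "y k = x k" using y xP by (auto simp: PiE_iff extensional_def)
      next
        fix k assume "k \<in> I" then show "\<bar>y k - x k\<bar> < d" using y by (auto simp: PiE_iff dist_real_def abs_minus_commute)
      qed
      then show "y \<in> W" by (rule d(2))
    qed
    ultimately show "\<exists>T. openin (powertop_real I) T \<and> x \<in> T \<and> T \<subseteq> W" by blast
  qed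
qed

lemma continuous_map_icont:
  assumes "finite I" "openin (powertop_real I) W"
  shows "continuous_map (subtopology (powertop_real I) W) euclideanreal h \<longleftrightarrow> icont I W h"
proof -
  have WP: "W \<subseteq> (I \<rightarrow>\<^sub>E UNIV)" and Wo: "iopen I W" using assms openin_powertop_iff by blast+
  have ts: "topspace (subtopology (powertop_real I) W) = W" using WP by auto
  have sub: "openin (subtopology (powertop_real I) W) {x\<in>W. h x \<in> B} \<longleftrightarrow> iopen I {x\<in>W. h x \<in> B}" for B
    using openin_open_subtopology[OF assms(2)] openin_powertop_iff[OF assms(1), of "{x\<in>W. h x \<in> B}"] WP by auto
  show ?thesis
    unfolding continuous_map_def ts
  proof (intro iffI conjI allI impI)
    assume c: "h \<in> W \<rightarrow> topspace euclideanreal \<and> (\<forall>B. openin euclideanreal B \<longrightarrow>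
      openin (subtopology (powertop_real I) W) {x\<in>W. h x \<in> B})"
    show "icont I W h"
      unfolding icont_def tendsto_iff
    proof (intro ballI allI impI)
      fix x and e :: real assume x: "x \<in> W" "e > 0"
      have "iopen I {y\<in>W. h y \<in> ball (h x) e}" using c sub[of "ball (h x) e"] by auto
      then have "\<forall>\<^sub>F y in nbhd I x. y \<in> {y\<in>W. h y \<in> ball (h x) e}" using x unfolding iopen_def by auto
      then show "\<forall>\<^sub>F y in nbhd I x. dist (h y) (h x) < e"
        by eventually_elim (auto simp: dist_commute)
    qed
  next
    fix B :: "real set" assume ic: "icont I W h" and B: "openin euclideanreal B"
    have "iopen I {x\<in>W. h x \<in> B}"
      unfolding iopen_def
    proof
      fix x assume x: "x \<in> {x\<in>W. h x \<in> B}"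
      then have "\<forall>\<^sub>F y in nbhd I x. h y \<in> B"
        using ic B topological_tendstoD[of h "h x" "nbhd I x" B] by (auto simp: icont_def)
      moreover have "\<forall>\<^sub>F y in nbhd I x. y \<in> W" using x Wo by (auto simp: iopen_def)
      ultimately show "\<forall>\<^sub>F y in nbhd I x. y \<in> {x\<in>W. h x \<in> B}" by eventually_elim auto
    qed
    then show "openin (subtopology (powertop_real I) W) {x\<in>W. h x \<in> B}" using sub by blast
  qed auto
qed

text \<open>The bridge from the given notion of differentiability class to the slice calculus; the
  two recursions coincide once continuity is translated.\<close>

lemma C_nat_on_iff_Ck:
  assumes "finite I" "openin (powertop_real I) W"
  shows "C_nat_on k I W h \<longleftrightarrow> Ck k I W h"
proof (induction k arbitrary: h)
  case 0 show ?case using continuous_map_icont[OF assms] by simp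
next
  case (Suc k)
  show ?case using continuous_map_icont[OF assms, of h] Suc.IH by (auto simp: idiff_def)
qed

lemma chartD:
  assumes "C_manifold r n N" "(D, \<phi>) \<in> atlas N"
  shows "finite (idx N)" "openin (mtop N) D" "openin (powertop_real (idx N)) (\<phi> ` D)"
    "homeomorphic_map (subtopology (mtop N) D) (subtopology (powertop_real (idx N)) (\<phi> ` D)) \<phi>"
    "inj_on \<phi> D" "\<phi> ` D \<subseteq> (idx N \<rightarrow>\<^sub>E UNIV)" "iopen (idx N) (\<phi> ` D)" "D \<subseteq> mpoints N"
proof -
  have c: "is_chart (mtop N) (idx N) (D, \<phi>)" using assms unfolding C_manifold_def by blast
  show fin: "finite (idx N)" using assms unfolding C_manifold_def by blast
  show D: "openin (mtop N) D" and o: "openin (powertop_real (idx N)) (\<phi> ` D)"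
    and h: "homeomorphic_map (subtopology (mtop N) D) (subtopology (powertop_real (idx N)) (\<phi> ` D)) \<phi>"
    using c unfolding is_chart_def by auto
  show DN: "D \<subseteq> mpoints N" using D by (rule openin_subset)
  have "topspace (subtopology (mtop N) D) = D" using DN by auto
  then show "inj_on \<phi> D" using homeomorphic_imp_injective_map[OF h] by (simp only:)
  show "\<phi> ` D \<subseteq> (idx N \<rightarrow>\<^sub>E UNIV)" "iopen (idx N) (\<phi> ` D)" using o unfolding openin_powertop_iff[OF fin, of "\<phi> ` D"] by auto
qed

lemma chart_open_image:
  assumes "C_manifold r n N" "(D, \<phi>) \<in> atlas N" "openin (mtop N) U"
  shows "iopen (idx N) (\<phi> ` (D \<inter> U))"
proof -
  note c = chartD[OF assms(1,2)]
  have "openin (subtopology (mtop N) D) (D \<inter> U)"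
    using assms(3) by (auto simp: openin_subtopology Int_commute)
  then have "openin (subtopology (powertop_real (idx N)) (\<phi> ` D)) (\<phi> ` (D \<inter> U))"
    using homeomorphic_imp_open_map[OF c(4)] by (simp add: open_map_def)
  then have "openin (powertop_real (idx N)) (\<phi> ` (D \<inter> U))"
    using openin_open_subtopology[OF c(3)] by blast
  then show ?thesis using openin_powertop_iff[OF c(1)] by blast
qed

lemma chart_inverse_continuous:
  assumes "C_manifold r n N" "(D, \<phi>) \<in> atlas N"
  shows "continuous_map (subtopology (powertop_real (idx N)) (\<phi> ` D)) (mtop N) (inv_into D \<phi>)"
proof -
  note c = chartD[OF assms]
  obtain g where g: "homeomorphic_maps (subtopology (mtop N) D) (subtopology (powertop_real (idx N)) (\<phi> ` D)) \<phi> g"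
    using c(4) homeomorphic_map_maps by blast
  then have cg: "continuous_map (subtopology (powertop_real (idx N)) (\<phi> ` D)) (subtopology (mtop N) D) g"
    and inv: "\<And>x. x \<in> D \<Longrightarrow> g (\<phi> x) = x"
    using c(8) unfolding homeomorphic_maps_def by auto
  have "continuous_map (subtopology (powertop_real (idx N)) (\<phi> ` D)) (mtop N) g"
    using cg continuous_map_in_subtopology by blast
  then show ?thesis
    by (rule continuous_map_eq) (use inv c(5) in auto)
qed

lemma euclid_simps [simp]:
  "mtop euclid = euclidean" "idx euclid = UNIV" "atlas euclid = {(UNIV, vec_nth)}"
  by (simp_all add: euclid_def)

lemma C_map_euclid_iff:
  fixes g :: "'a \<Rightarrow> real ^ 'l"
  assumes N: "C_manifold r0 n N"
  shows "C_map r N euclid g \<longleftrightarrow> continuous_map (mtop N) euclidean g \<and>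
    (\<forall>D \<phi> k a. (D, \<phi>) \<in> atlas N \<longrightarrow> enat k \<le> r \<longrightarrow> Ck k (idx N) (\<phi> ` D) (\<lambda>x. g (inv_into D \<phi> x) $ a))"
proof -
  have "C_on r (idx N) UNIV (\<phi> ` D) (vec_nth \<circ> g \<circ> inv_into D \<phi>) \<longleftrightarrow>
    (\<forall>k a. enat k \<le> r \<longrightarrow> Ck k (idx N) (\<phi> ` D) (\<lambda>x. g (inv_into D \<phi> x) $ a))"
    if "(D, \<phi>) \<in> atlas N" for D \<phi>
    unfolding C_on_def C_nat_on_iff_Ck[OF chartD(1,3)[OF N that]] by auto
  then show ?thesis unfolding C_map_def by fastforce
qed

section \<open>Configuration charts\<close>

definition block :: "'i set \<Rightarrow> nat \<Rightarrow> (nat \<times> 'i \<Rightarrow> real) \<Rightarrow> 'i \<Rightarrow> real"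
  where "block I k x = (\<lambda>i\<in>I. x (k, i))"

lemma compat_block: "compat ({1..s} \<times> I) V I (block I k)"
  by (auto simp: compat_def block_def)

lemma Ck_block:
  "finite I \<Longrightarrow> i \<in> I \<Longrightarrow> Ck l ({1..s} \<times> I) V (\<lambda>x. block I k x i)"
  by (simp add: block_def Ck_coord)

lemma iopen_block:
  assumes "finite I" "iopen I W"
  shows "iopen ({1..s} \<times> I) {x. block I k x \<in> W}"
proof -
  have "iopen ({1..s} \<times> I) {x\<in>UNIV. block I k x \<in> W}"
    using Ck_block[OF assms(1), of _ 0]
    by (intro iopen_vimage[OF assms(1) _ compat_block _ assms(2)]) (auto simp: iopen_def)
  then show ?thesis by simp
qed

lemma iopen_INT:
  assumes "finite T" "\<And>t. t \<in> T \<Longrightarrow> iopen I (W t)"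
  shows "iopen I (\<Inter>t\<in>T. W t)"
  unfolding iopen_def
proof
  fix x assume "x \<in> (\<Inter>t\<in>T. W t)"
  then have "\<forall>\<^sub>F y in nbhd I x. \<forall>t\<in>T. y \<in> W t"
    using assms by (intro eventually_ball_finite) (auto simp: iopen_def)
  then show "\<forall>\<^sub>F y in nbhd I x. y \<in> (\<Inter>t\<in>T. W t)" by eventually_elim auto
qed

definition cdom :: "nat \<Rightarrow> ('a, 'i) mfd \<Rightarrow> (nat \<Rightarrow> ('a, 'i) chart) \<Rightarrow> (nat \<Rightarrow> 'a) set"
  where "cdom s N c = (\<Pi>\<^sub>E k\<in>{1..s}. fst (c k)) \<inter> distinct_tuples s (mpoints N)"

definition cmap :: "nat \<Rightarrow> ('a, 'i) mfd \<Rightarrow> (nat \<Rightarrow> ('a, 'i) chart) \<Rightarrow> (nat \<Rightarrow> 'a) \<Rightarrow> nat \<times> 'i \<Rightarrow> real"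
  where "cmap s N c = (\<lambda>q. restrict (\<lambda>(k, i). snd (c k) (q k) i) ({1..s} \<times> idx N))"

text \<open>The inverse chart is written point by point: the \<open>k\<close>-th point depends on
  block \<open>k\<close> alone, which reduces its smoothness to one chart of
  \<open>N\<close>.\<close>

definition cinv :: "nat \<Rightarrow> ('a, 'i) mfd \<Rightarrow> (nat \<Rightarrow> ('a, 'i) chart) \<Rightarrow> nat \<Rightarrow> (nat \<times> 'i \<Rightarrow> real) \<Rightarrow> 'a"
  where "cinv s N c k x = inv_into (fst (c k)) (snd (c k)) (block (idx N) k x)"

lemma config_simps:
  "mtop (config_mfd s N) = subtopology (product_topology (\<lambda>_. mtop N) {1..s}) (distinct_tuples s (mpoints N))"
  "idx (config_mfd s N) = {1..s} \<times> idx N"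
  "atlas (config_mfd s N) = (\<lambda>c. (cdom s N c, cmap s N c)) ` ({1..s} \<rightarrow>\<^sub>E atlas N)"
  by (simp_all add: config_mfd_def open_submanifold_def power_mfd_def cdom_def cmap_def image_image)

lemma mpoints_config: "mpoints (config_mfd s N) = distinct_tuples s (mpoints N)"
  unfolding config_simps by (auto simp: distinct_tuples_def)

text \<open>As \<open>euclid\<close> has one chart, there is one choice of charts for the factors,
  and the power has a single global chart. Its tangent vectors are therefore plain coordinate
  vectors.\<close>

lemma power_euclid_simps:
  fixes s :: nat
  defines "P \<equiv> power_mfd s (euclid :: (real ^ 'l, 'l) mfd)"
  shows "mtop P = product_topology (\<lambda>_. euclidean) {1..s}" "idx P = {1..s} \<times> UNIV"
    "atlas P = {(\<Pi>\<^sub>E k\<in>{1..s}. UNIV, \<lambda>q. restrict (\<lambda>(k, i). q k $ i) ({1..s} \<times> UNIV))}"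
proof -
  have "({1..s} \<rightarrow>\<^sub>E atlas (euclid :: (real ^ 'l, 'l) mfd)) = {\<lambda>k\<in>{1..s}. (UNIV, vec_nth)}"
    by (auto simp: PiE_iff fun_eq_iff extensional_def)
  then show "mtop P = product_topology (\<lambda>_. euclidean) {1..s}" "idx P = {1..s} \<times> UNIV"
    "atlas P = {(\<Pi>\<^sub>E k\<in>{1..s}. UNIV, \<lambda>q. restrict (\<lambda>(k, i). q k $ i) ({1..s} \<times> UNIV))}"
    unfolding P_def power_mfd_def by (auto simp: fun_eq_iff restrict_def intro!: PiE_cong)
qed

locale config_chart =
  fixes r0 :: enat and n :: nat and N :: "('a, 'i) mfd" and s :: nat and c :: "nat \<Rightarrow> ('a, 'i) chart"
  assumes N: "C_manifold r0 n N" and c: "c \<in> {1..s} \<rightarrow>\<^sub>E atlas N"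
begin

abbreviation "I0 \<equiv> idx N"
abbreviation "I1 \<equiv> {1..s} \<times> idx N"

lemma fin0: "finite I0" using N unfolding C_manifold_def by blast

lemma fin1: "finite I1" using fin0 by simp

lemma ck: "k \<in> {1..s} \<Longrightarrow> (fst (c k), snd (c k)) \<in> atlas N"
  using c by (auto simp: PiE_iff)

lemmas ckD = chartD[OF N ck]

lemma block_cmap: "q \<in> cdom s N c \<Longrightarrow> k \<in> {1..s} \<Longrightarrow> block I0 k (cmap s N c q) = snd (c k) (q k)"
proof -
  assume q: "q \<in> cdom s N c" and k: "k \<in> {1..s}"
  then have "q k \<in> fst (c k)" by (auto simp: cdom_def PiE_iff)
  then have "snd (c k) (q k) \<in> (I0 \<rightarrow>\<^sub>E UNIV)" using ckD(6)[OF k] by blast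
  then show ?thesis using k by (auto simp: block_def cmap_def fun_eq_iff PiE_iff extensional_def)
qed

lemma cinv_cmap: "q \<in> cdom s N c \<Longrightarrow> k \<in> {1..s} \<Longrightarrow> cinv s N c k (cmap s N c q) = q k"
  unfolding cinv_def using block_cmap ckD(5) by (auto simp: cdom_def PiE_iff)

lemma inj_cmap: "inj_on (cmap s N c) (cdom s N c)"
proof (rule inj_onI)
  fix p q assume pq: "p \<in> cdom s N c" "q \<in> cdom s N c" "cmap s N c p = cmap s N c q"
  have "p k = q k" if "k \<in> {1..s}" for k using cinv_cmap[OF pq(1) that] cinv_cmap[OF pq(2) that] pq(3) by simp
  moreover have "p \<in> extensional {1..s}" "q \<in> extensional {1..s}" using pq by (auto simp: cdom_def PiE_iff)
  ultimately show "p = q" by (rule extensionalityI[rotated 2])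
qed

lemma inv_cmap: "x \<in> cmap s N c ` cdom s N c \<Longrightarrow> k \<in> {1..s} \<Longrightarrow>
    inv_into (cdom s N c) (cmap s N c) x k = cinv s N c k x"
  using cinv_cmap inj_cmap by auto

lemma cmap_image: "cmap s N c ` cdom s N c = {x \<in> I1 \<rightarrow>\<^sub>E UNIV. (\<forall>k\<in>{1..s}. block I0 k x \<in> snd (c k) ` fst (c k)) \<and>
    inj_on (\<lambda>k. cinv s N c k x) {1..s}}"
proof (intro equalityI subsetI)
  fix x assume "x \<in> cmap s N c ` cdom s N c"
  then obtain q where q: "q \<in> cdom s N c" "x = cmap s N c q" by auto
  have "inj_on (\<lambda>k. cinv s N c k x) {1..s}"
  proof (rule inj_on_cong[THEN iffD2])
    show "cinv s N c k x = q k" if "k \<in> {1..s}" for k using cinv_cmap[OF q(1) that] q(2) by simp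
    show "inj_on q {1..s}" using q(1) unfolding cdom_def distinct_tuples_def by blast
  qed
  moreover have "block I0 k x \<in> snd (c k) ` fst (c k)" if "k \<in> {1..s}" for k
    using block_cmap[OF q(1) that] q that by (auto simp: cdom_def PiE_iff)
  moreover have "x \<in> I1 \<rightarrow>\<^sub>E UNIV" unfolding q(2) cmap_def by auto
  ultimately show "x \<in> {x \<in> I1 \<rightarrow>\<^sub>E UNIV. (\<forall>k\<in>{1..s}. block I0 k x \<in> snd (c k) ` fst (c k)) \<and>
    inj_on (\<lambda>k. cinv s N c k x) {1..s}}" by blast
next
  fix x assume x: "x \<in> {x \<in> I1 \<rightarrow>\<^sub>E UNIV. (\<forall>k\<in>{1..s}. block I0 k x \<in> snd (c k) ` fst (c k)) \<and>
    inj_on (\<lambda>k. cinv s N c k x) {1..s}}"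
  define q where "q = (\<lambda>k\<in>{1..s}. cinv s N c k x)"
  have qk: "q k \<in> fst (c k)" "snd (c k) (q k) = block I0 k x" if k: "k \<in> {1..s}" for k
  proof -
    have b: "block I0 k x \<in> snd (c k) ` fst (c k)" using x k by blast
    show "q k \<in> fst (c k)" "snd (c k) (q k) = block I0 k x"
      using inv_into_into[OF b] f_inv_into_f[OF b] k by (simp_all add: q_def cinv_def)
  qed
  have "q \<in> cdom s N c"
    unfolding cdom_def distinct_tuples_def
  proof (intro IntI CollectI conjI)
    show "q \<in> (\<Pi>\<^sub>E k\<in>{1..s}. fst (c k))" using qk(1) by (auto simp: q_def)
    then show "q \<in> {1..s} \<rightarrow>\<^sub>E mpoints N" using PiE_mono[of "{1..s}" "\<lambda>k. fst (c k)" "\<lambda>_. mpoints N"] ckD(8) by blast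
    have "inj_on (\<lambda>k. cinv s N c k x) {1..s}" using x by blast
    then show "inj_on q {1..s}" by (rule inj_on_cong[THEN iffD2, rotated]) (simp add: q_def)
  qed
  moreover have "x = cmap s N c q"
  proof
    fix p show "x p = cmap s N c q p"
    proof (cases "p \<in> I1")
      case True
      then obtain k i where p: "p = (k, i)" "k \<in> {1..s}" "i \<in> I0" by auto
      have "cmap s N c q p = block I0 k x i" using p qk(2)[OF p(2)] by (simp add: cmap_def)
      then show ?thesis using p by (simp add: block_def)
    next
      case False
      have "x \<in> I1 \<rightarrow>\<^sub>E UNIV" using x by blast
      from PiE_arb[OF this False] False show ?thesis unfolding cmap_def restrict_def by simp
    qed
  qed
  ultimately show "x \<in> cmap s N c ` cdom s N c" by blast
qed

text \<open>\<open>N\<close> is Hausdorff: disjoint neighbourhoods of two points of the tuple keep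
  them distinct under small changes of the coordinates, and there are finitely many pairs.\<close>

lemma iopen_distinct: "iopen I1 {x \<in> (\<Inter>k\<in>{1..s}. {x. block I0 k x \<in> snd (c k) ` fst (c k)}).
    inj_on (\<lambda>k. cinv s N c k x) {1..s}}"
  unfolding iopen_def
proof
  let ?B = "\<Inter>k\<in>{1..s}. {x. block I0 k x \<in> snd (c k) ` fst (c k)}"
  fix x assume x: "x \<in> {x \<in> ?B. inj_on (\<lambda>k. cinv s N c k x) {1..s}}"
  have cin: "cinv s N c k y \<in> fst (c k)" "snd (c k) (cinv s N c k y) = block I0 k y"
    if "block I0 k y \<in> snd (c k) ` fst (c k)" for y k
    unfolding cinv_def using inv_into_into[OF that] f_inv_into_f[OF that] by auto
  have xB: "x \<in> ?B" and xinj: "inj_on (\<lambda>k. cinv s N c k x) {1..s}" using x by blast+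
  have "iopen I1 ?B" using ckD(7) fin0 by (intro iopen_INT iopen_block) auto
  from bspec[OF this[unfolded iopen_def] xB] have 1: "\<forall>\<^sub>F y in nbhd I1 x. y \<in> ?B" .
  have "\<forall>\<^sub>F y in nbhd I1 x. cinv s N c k y \<noteq> cinv s N c l y" if kl: "k \<in> {1..s}" "l \<in> {1..s}" "k \<noteq> l" for k l
  proof -
    have xk: "block I0 k x \<in> snd (c k) ` fst (c k)" and xl: "block I0 l x \<in> snd (c l) ` fst (c l)" using xB kl by blast+
    have "cinv s N c k x \<noteq> cinv s N c l x" using inj_onD[OF xinj _ kl(1,2)] kl(3) by blast
    moreover have "cinv s N c k x \<in> mpoints N" "cinv s N c l x \<in> mpoints N"
      using cin(1)[OF xk] cin(1)[OF xl] ckD(8) kl by blast+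
    ultimately obtain U V where UV: "openin (mtop N) U" "openin (mtop N) V"
      "cinv s N c k x \<in> U" "cinv s N c l x \<in> V" "disjnt U V"
      using N unfolding C_manifold_def Hausdorff_space_def by blast
    have ev: "\<forall>\<^sub>F y in nbhd I1 x. cinv s N c k y \<in> U"
      if U: "openin (mtop N) U" "cinv s N c k x \<in> U" and k: "k \<in> {1..s}" for U k
    proof -
      have xk: "block I0 k x \<in> snd (c k) ` fst (c k)" using xB k by blast
      have "block I0 k x \<in> snd (c k) ` (fst (c k) \<inter> U)"
        unfolding cin(2)[OF xk, symmetric] using cin(1)[OF xk] U(2) by blast
      then have "\<forall>\<^sub>F y in nbhd I1 x. y \<in> {y. block I0 k y \<in> snd (c k) ` (fst (c k) \<inter> U)}"
        by (intro iopen_eventually[OF iopen_block[OF fin0 chart_open_image[OF N ck[OF k] U(1)]]] CollectI)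
      then have "\<forall>\<^sub>F y in nbhd I1 x. block I0 k y \<in> snd (c k) ` (fst (c k) \<inter> U)" by simp
      then show ?thesis
      proof eventually_elim
        case (elim y)
        then obtain p where p: "p \<in> fst (c k)" "p \<in> U" "block I0 k y = snd (c k) p" by auto
        then have "cinv s N c k y = p" using ckD(5)[OF k] by (simp add: cinv_def)
        with p show ?case by simp
      qed
    qed
    from ev[OF UV(1,3) kl(1)] ev[OF UV(2,4) kl(2)] show ?thesis
      by eventually_elim (use UV(5) in \<open>auto simp: disjnt_def\<close>)
  qed
  then have "\<forall>\<^sub>F y in nbhd I1 x. \<forall>k\<in>{1..s}. \<forall>l\<in>{1..s}. k \<noteq> l \<longrightarrow> cinv s N c k y \<noteq> cinv s N c l y"
    by (intro eventually_ball_finite finite_atLeastAtMost ballI) auto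
  with 1 show "\<forall>\<^sub>F y in nbhd I1 x. y \<in> {x \<in> ?B. inj_on (\<lambda>k. cinv s N c k x) {1..s}}"
    by eventually_elim (auto simp: inj_on_def)
qed

lemma openin_cmap_image: "openin (powertop_real I1) (cmap s N c ` cdom s N c)"
proof -
  have "iopen I1 (cmap s N c ` cdom s N c)"
    unfolding iopen_def
  proof
    fix x assume x: "x \<in> cmap s N c ` cdom s N c"
    then have x': "x \<in> {x \<in> (\<Inter>k\<in>{1..s}. {x. block I0 k x \<in> snd (c k) ` fst (c k)}). inj_on (\<lambda>k. cinv s N c k x) {1..s}}"
      "x \<in> I1 \<rightarrow>\<^sub>E UNIV" unfolding cmap_image by auto
    have "\<forall>\<^sub>F y in nbhd I1 x. y \<in> {x \<in> (\<Inter>k\<in>{1..s}. {x. block I0 k x \<in> snd (c k) ` fst (c k)}). inj_on (\<lambda>k. cinv s N c k x) {1..s}}"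
      using bspec[OF iopen_distinct[unfolded iopen_def] x'(1)] .
    with eventually_off[of I1 x] show "\<forall>\<^sub>F y in nbhd I1 x. y \<in> cmap s N c ` cdom s N c"
    proof eventually_elim
      case (elim y)
      have "y \<in> I1 \<rightarrow>\<^sub>E UNIV"
      proof (rule PiE_I)
        fix p assume p: "p \<notin> I1"
        with elim(1) have "y p = x p" by blast
        then show "y p = undefined" using PiE_arb[OF x'(2) p] by (rule trans)
      qed simp
      with elim(2) show ?case unfolding cmap_image by blast
    qed
  qed
  moreover have "cmap s N c ` cdom s N c \<subseteq> (I1 \<rightarrow>\<^sub>E UNIV)" unfolding cmap_image by blast
  ultimately show ?thesis using openin_powertop_iff[OF fin1] by blast
qed

lemma iopen_cmap_image: "iopen I1 (cmap s N c ` cdom s N c)"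
  using openin_cmap_image openin_powertop_iff[OF fin1] by blast

lemma openin_cdom: "openin (mtop (config_mfd s N)) (cdom s N c)"
proof -
  have "openin (product_topology (\<lambda>_. mtop N) {1..s}) (\<Pi>\<^sub>E k\<in>{1..s}. fst (c k))"
    using ckD(2) by (intro openin_PiE[THEN iffD2]) auto
  then show ?thesis unfolding config_simps cdom_def by (auto simp: openin_subtopology)
qed

lemma Ck_component:
  assumes "k \<in> {1..s}" "Ck l I0 (snd (c k) ` fst (c k)) (\<lambda>x. g (inv_into (fst (c k)) (snd (c k)) x))"
    and "iopen I1 V" "\<forall>x\<in>V. block I0 k x \<in> snd (c k) ` fst (c k)"
  shows "Ck l I1 V (\<lambda>x. g (cinv s N c k x))"
  unfolding cinv_def
  by (rule Ck_compose[OF fin0 assms(3) ckD(7)[OF assms(1)] compat_block assms(4) _ assms(2)])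
    (use Ck_block[OF fin0] in blast)

end

lemma C_map_tuple:
  fixes g :: "'a \<Rightarrow> real ^ 'l"
  assumes N: "C_manifold r0 n N" and g: "C_map r N euclid g"
  shows "C_map r (config_mfd s N) (power_mfd s euclid) (tuple_map s g)"
proof -
  have gc: "continuous_map (mtop N) euclidean g"
    and gk: "\<And>D \<phi> k a. (D, \<phi>) \<in> atlas N \<Longrightarrow> enat k \<le> r \<Longrightarrow> Ck k (idx N) (\<phi> ` D) (\<lambda>x. g (inv_into D \<phi> x) $ a)"
    using g unfolding C_map_euclid_iff[OF N] by blast+
  have cont: "continuous_map (mtop (config_mfd s N)) (mtop (power_mfd s (euclid :: (real ^ 'l, 'l) mfd))) (tuple_map s g)"
    unfolding config_simps power_euclid_simps continuous_map_componentwise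
  proof (intro conjI ballI)
    show "tuple_map s g ` topspace (subtopology (product_topology (\<lambda>_. mtop N) {1..s}) (distinct_tuples s (mpoints N)))
        \<subseteq> extensional {1..s}"
      by (auto simp: tuple_map_def)
    fix k assume k: "k \<in> {1..s}"
    have "continuous_map (product_topology (\<lambda>_. mtop N) {1..s}) euclidean (g \<circ> (\<lambda>q. q k))"
      using k by (intro continuous_map_compose[OF _ gc] continuous_map_product_projection)
    then have "continuous_map (subtopology (product_topology (\<lambda>_. mtop N) {1..s}) (distinct_tuples s (mpoints N)))
        euclidean (g \<circ> (\<lambda>q. q k))"
      by (rule continuous_map_from_subtopology)
    then show "continuous_map (subtopology (product_topology (\<lambda>_. mtop N) {1..s}) (distinct_tuples s (mpoints N)))
        euclidean (\<lambda>x. tuple_map s g x k)"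
      using k by (simp add: tuple_map_def comp_def)
  qed
  have smooth: "C_on r ({1..s} \<times> idx N) ({1..s} \<times> UNIV) (cmap s N c ` {x\<in>cdom s N c. tuple_map s g x \<in> (\<Pi>\<^sub>E k\<in>{1..s}. UNIV)})
      ((\<lambda>q. restrict (\<lambda>(k, i). q k $ i) ({1..s} \<times> UNIV)) \<circ> tuple_map s g \<circ> inv_into (cdom s N c) (cmap s N c))"
    if c: "c \<in> {1..s} \<rightarrow>\<^sub>E atlas N" for c
  proof -
    interpret config_chart r0 n N s c using N c by unfold_locales
    have dom: "{x\<in>cdom s N c. tuple_map s g x \<in> (\<Pi>\<^sub>E k\<in>{1..s}. UNIV)} = cdom s N c"
      by (auto simp: tuple_map_def)
    show ?thesis
      unfolding C_on_def dom C_nat_on_iff_Ck[OF fin1 openin_cmap_image]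
    proof (intro allI impI ballI)
      fix l j assume l: "enat l \<le> r" and "j \<in> {1..s} \<times> (UNIV :: 'l set)"
      then obtain k a where j: "j = (k, a)" "k \<in> {1..s}" by auto
      have "Ck l I1 (cmap s N c ` cdom s N c) (\<lambda>x. g (cinv s N c k x) $ a)"
      proof (rule Ck_component[OF j(2) _ iopen_cmap_image])
        show "Ck l I0 (snd (c k) ` fst (c k)) (\<lambda>x. g (inv_into (fst (c k)) (snd (c k)) x) $ a)"
          by (rule gk[OF ck[OF j(2)] l])
        show "\<forall>x\<in>cmap s N c ` cdom s N c. block I0 k x \<in> snd (c k) ` fst (c k)"
          unfolding cmap_image using j(2) by blast
      qed
      then show "Ck l I1 (cmap s N c ` cdom s N c) (\<lambda>x. ((\<lambda>q. restrict (\<lambda>(k, i). q k $ i) ({1..s} \<times> UNIV)) \<circ>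
          tuple_map s g \<circ> inv_into (cdom s N c) (cmap s N c)) x j)"
        by (rule Ck_cong[OF iopen_cmap_image, rotated]) (use j inv_cmap in \<open>auto simp: tuple_map_def\<close>)
    qed
  qed
  show ?thesis
    unfolding C_map_def
    using cont smooth unfolding config_simps(2,3) power_euclid_simps(2,3) by auto
qed

section \<open>Transversality to the diagonal\<close>

lemma transition_C_on:
  assumes "C_manifold r n N" "(D, \<phi>) \<in> atlas N" "(D', \<phi>') \<in> atlas N"
  shows "C_on r (idx N) (idx N) (\<phi> ` (D \<inter> D')) (\<phi>' \<circ> inv_into D \<phi>)"
proof -
  have "\<forall>(D, \<phi>)\<in>atlas N. \<forall>(D', \<phi>')\<in>atlas N.
      C_on r (idx N) (idx N) (\<phi> ` (D \<inter> D')) (\<phi>' \<circ> inv_into D \<phi>)"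
    using assms(1) unfolding C_manifold_def by (elim conjE)
  from bspec[OF this assms(2)]
  have "\<forall>(D', \<phi>')\<in>atlas N. C_on r (idx N) (idx N) (\<phi> ` (D \<inter> D')) (\<phi>' \<circ> inv_into D \<phi>)"
    by (simp only: case_prod_conv)
  from bspec[OF this assms(3)] show ?thesis by (simp only: case_prod_conv)
qed

section \<open>Tangent vectors of powers of Euclidean space\<close>

abbreviation (input) pow_euclid :: "nat \<Rightarrow> (nat \<Rightarrow> real ^ 'l, nat \<times> 'l) mfd"
  where "pow_euclid s \<equiv> power_mfd s euclid"

definition pchart :: "nat \<Rightarrow> (nat \<Rightarrow> real ^ 'l, nat \<times> 'l) chart"
  where "pchart s = (\<Pi>\<^sub>E k\<in>{1..s}. UNIV, \<lambda>q. restrict (\<lambda>(k, i). q k $ i) ({1..s} \<times> UNIV))"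

text \<open>The tangent vector with coordinates \<open>a\<close>; the family of velocities has one
  member because there is one chart.\<close>

definition ptan :: "nat \<Rightarrow> (nat \<times> 'l \<Rightarrow> real) \<Rightarrow> (nat \<Rightarrow> real ^ 'l, nat \<times> 'l) tvec"
  where "ptan s a = (\<lambda>c\<in>{pchart s}. \<lambda>j\<in>{1..s} \<times> UNIV. a j)"

lemma ptan_cong: "(\<And>j. j \<in> {1..s} \<times> UNIV \<Longrightarrow> a j = b j) \<Longrightarrow> ptan s a = ptan s b"
  unfolding ptan_def by (intro restrict_ext) auto

lemma charts_at_pow: "p \<in> ({1..s} \<rightarrow>\<^sub>E UNIV) \<Longrightarrow> charts_at (pow_euclid s) p = {pchart s}"
  unfolding charts_at_def power_euclid_simps pchart_def by auto

lemma velocity_pow: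
  assumes "p \<in> ({1..s} \<rightarrow>\<^sub>E UNIV)"
  shows "velocity (pow_euclid s) p \<gamma> = ptan s (\<lambda>(k, i). deriv (\<lambda>t. \<gamma> t k $ i) 0)"
  unfolding velocity_def charts_at_pow[OF assms] power_euclid_simps(2) ptan_def
  by (intro restrict_ext) (auto simp: pchart_def)

lemma tvec_add_pow:
  assumes "p \<in> ({1..s} \<rightarrow>\<^sub>E UNIV)"
  shows "tvec_add (pow_euclid s) p (ptan s a) (ptan s b) = ptan s (\<lambda>j. a j + b j)"
  unfolding tvec_add_def charts_at_pow[OF assms] power_euclid_simps(2) ptan_def
  by (intro restrict_ext) auto

text \<open>A straight line realizes the velocity; in both applications, the whole space and the
  diagonal, \<open>Z\<close> contains the entire line.\<close>

lemma tangent_line: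
  fixes a :: "nat \<times> 'l::finite \<Rightarrow> real"
  assumes p: "p \<in> ({1..s} \<rightarrow>\<^sub>E UNIV)" and Z: "\<And>t. (\<lambda>k\<in>{1..s}. p k + t *\<^sub>R (\<chi> i. a (k, i))) \<in> Z"
  shows "ptan s a \<in> tangent_to (pow_euclid s) Z p"
proof -
  define \<gamma> where "\<gamma> t = (\<lambda>k\<in>{1..s}. p k + t *\<^sub>R (\<chi> i. a (k, i)))" for t
  have comp: "\<gamma> t k $ i = p k $ i + t * a (k, i)" if "k \<in> {1..s}" for t k i
    using that by (simp add: \<gamma>_def)
  have "curve_at (pow_euclid s) Z p \<gamma>"
    unfolding curve_at_def
  proof (intro conjI exI[of _ 1])
    show "\<gamma> 0 = p"
      unfolding \<gamma>_def by (rule ext) (use PiE_arb[OF p] in \<open>auto simp: restrict_def\<close>)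
    show "continuous_map (top_of_set {- 1<..<1}) (mtop (pow_euclid s)) \<gamma>"
      unfolding power_euclid_simps continuous_map_componentwise
    proof (intro conjI ballI)
      show "\<gamma> ` topspace (top_of_set {- 1<..<1}) \<subseteq> extensional {1..s}" by (auto simp: \<gamma>_def)
      fix k assume "k \<in> {1..s}"
      then show "continuous_map (top_of_set {- 1<..<1}) euclidean (\<lambda>t. \<gamma> t k)"
        unfolding \<gamma>_def by (auto intro!: continuous_intros)
    qed
    show "\<gamma> ` {- 1<..<1} \<subseteq> Z" using Z by (auto simp: \<gamma>_def)
    have C1: "(\<lambda>t. restrict (\<lambda>(k, i). \<gamma> t k $ i) ({1..s} \<times> UNIV) j) C1_differentiable_on S"
      if "j \<in> {1..s} \<times> UNIV" for S j
    proof -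
      obtain k i where j: "j = (k, i)" "k \<in> {1..s}" using \<open>j \<in> {1..s} \<times> UNIV\<close> by auto
      have "((\<lambda>t. p k $ i + t * a (k, i)) has_vector_derivative a (k, i)) (at t)" for t
        by (auto intro!: derivative_eq_intros simp: has_real_derivative_iff_has_vector_derivative[symmetric])
      then show ?thesis unfolding C1_differentiable_on_def using j comp
        by (intro exI[of _ "\<lambda>_. a (k, i)"]) auto
    qed
    show "\<forall>(D, \<phi>)\<in>atlas (pow_euclid s). \<forall>i\<in>idx (pow_euclid s).
       (\<lambda>t. \<phi> (\<gamma> t) i) C1_differentiable_on {t \<in> {- 1<..<1}. \<gamma> t \<in> D}"
      unfolding power_euclid_simps using C1 by auto
  qed auto
  moreover have "velocity (pow_euclid s) p \<gamma> = ptan s a"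
    unfolding velocity_pow[OF p]
  proof (rule ptan_cong)
    fix j :: "nat \<times> 'l" assume "j \<in> {1..s} \<times> UNIV"
    then obtain k i where j: "j = (k, i)" "k \<in> {1..s}" by auto
    have "((\<lambda>t. p k $ i + t * a (k, i)) has_real_derivative a (k, i)) (at 0)"
      by (auto intro!: derivative_eq_intros)
    then have "deriv (\<lambda>t. p k $ i + t * a (k, i)) 0 = a (k, i)" by (rule DERIV_imp_deriv)
    then show "(case j of (k, i) \<Rightarrow> deriv (\<lambda>t. \<gamma> t k $ i) 0) = a j" using j comp by simp
  qed
  ultimately show ?thesis unfolding tangent_to_def by (auto intro!: image_eqI)
qed

section \<open>Tangent vectors and differentials in a configuration chart\<close>

context config_chart
begin

definition xline :: "(nat \<times> 'i \<Rightarrow> real) \<Rightarrow> (nat \<times> 'i \<Rightarrow> real) \<Rightarrow> real \<Rightarrow> nat \<times> 'i \<Rightarrow> real"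
  where "xline x \<xi> t = (\<lambda>p. if p \<in> I1 then x p + t * \<xi> p else x p)"

lemma xline_deriv: "p \<in> I1 \<Longrightarrow> ((\<lambda>t. xline x \<xi> t p) has_real_derivative \<xi> p) (at t)"
  unfolding xline_def by (auto intro!: derivative_eq_intros)

lemma block_xline_deriv:
  assumes "k \<in> {1..s}" "i \<in> I0"
  shows "((\<lambda>t. block I0 k (xline x \<xi> t) i) has_real_derivative \<xi> (k, i)) (at t)"
  using xline_deriv[of "(k, i)" x \<xi> t] assms by (simp add: block_def)

text \<open>Every coordinate vector is realized by pulling a straight line back from the chart. A
  curve has to be C^1 in all charts of the atlas; for those other than \<open>c\<close> this is
  supplied by the C^1 transition mappings, hence \<open>1 \<le> r0\<close>.\<close>

lemma tangent_config:
  assumes r0: "1 \<le> r0" and q: "q \<in> cdom s N c"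
  shows "\<exists>v\<in>tangent_space (config_mfd s N) q. \<forall>i\<in>I1. v (cdom s N c, cmap s N c) i = \<xi> i"
proof -
  let ?M = "config_mfd s N" and ?\<Phi> = "cmap s N c" and ?D = "cdom s N c"
  define x0 where "x0 = ?\<Phi> q"
  define X where "X = xline x0 \<xi>"
  define \<gamma> where "\<gamma> t = (\<lambda>k\<in>{1..s}. cinv s N c k (X t))" for t
  have X0: "X 0 = x0" by (auto simp: X_def xline_def)
  have "x0 \<in> ?\<Phi> ` ?D" using q by (simp add: x0_def)
  have X0': "X t p = x0 p" if "p \<notin> I1" for t p using that by (simp add: X_def xline_def)
  have "filterlim X (nbhd I1 x0) (nhds 0)"
  proof (rule filterlim_nbhd[OF fin1])
    show "\<forall>p\<in>I1. ((\<lambda>t. X t p) \<longlongrightarrow> x0 p) (nhds 0)"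
      unfolding X_def xline_def by (auto intro!: tendsto_eq_intros filterlim_ident)
    show "\<forall>\<^sub>F t in nhds 0. \<forall>p. p \<notin> I1 \<longrightarrow> X t p = x0 p" using X0' by auto
  qed
  then have "\<forall>\<^sub>F t in nhds 0. X t \<in> ?\<Phi> ` ?D"
    using iopen_eventually[OF iopen_cmap_image \<open>x0 \<in> ?\<Phi> ` ?D\<close>] unfolding filterlim_iff by blast
  then obtain \<epsilon> where "\<epsilon> > 0" and \<epsilon>': "\<And>t. dist t 0 < \<epsilon> \<Longrightarrow> X t \<in> ?\<Phi> ` ?D"
    unfolding eventually_nhds_metric by blast
  have \<epsilon>: "X t \<in> ?\<Phi> ` ?D" if "t \<in> {-\<epsilon><..<\<epsilon>}" for t using that \<epsilon>'[of t] by (auto simp: dist_real_def)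
  have \<gamma>D: "\<gamma> t \<in> ?D" "?\<Phi> (\<gamma> t) = X t" if t: "t \<in> {-\<epsilon><..<\<epsilon>}" for t
  proof -
    obtain p where p: "p \<in> ?D" "X t = ?\<Phi> p" using \<epsilon>[OF t] by blast
    have "\<gamma> t k = p k" if "k \<in> {1..s}" for k using cinv_cmap[OF p(1) that] p(2) that by (simp add: \<gamma>_def)
    moreover have "p \<in> extensional {1..s}" using p(1) by (auto simp: cdom_def PiE_iff)
    ultimately have "\<gamma> t = p" by (intro extensionalityI[of _ "{1..s}"]) (auto simp: \<gamma>_def)
    with p show "\<gamma> t \<in> ?D" "?\<Phi> (\<gamma> t) = X t" by auto
  qed
  have bl: "block I0 k (X t) \<in> snd (c k) ` fst (c k)" if "t \<in> {-\<epsilon><..<\<epsilon>}" "k \<in> {1..s}" for t k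
    using \<epsilon>[OF that(1)] that(2) unfolding cmap_image by blast
  have blim: "filterlim (\<lambda>t. block I0 k (X t)) (nbhd I0 (block I0 k (X t0))) (at t0)" if k: "k \<in> {1..s}" for k t0
  proof (rule filterlim_nbhd[OF fin0])
    show "\<forall>i\<in>I0. ((\<lambda>t. block I0 k (X t) i) \<longlongrightarrow> block I0 k (X t0) i) (at t0)"
      using DERIV_isCont[OF block_xline_deriv[OF k]] unfolding X_def isCont_def by blast
  qed (auto simp: block_def)
  have \<gamma>0: "\<gamma> 0 = q"
  proof (rule extensionalityI[of _ "{1..s}"])
    show "q \<in> extensional {1..s}" using q by (auto simp: cdom_def PiE_iff)
    show "\<gamma> 0 k = q k" if "k \<in> {1..s}" for k using cinv_cmap[OF q that] that by (simp add: \<gamma>_def X0 x0_def)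
  qed (simp add: \<gamma>_def)
  have cont: "continuous_map (top_of_set {-\<epsilon><..<\<epsilon>}) (mtop ?M) \<gamma>"
    unfolding config_simps continuous_map_in_subtopology continuous_map_componentwise
  proof (intro conjI ballI)
    show "\<gamma> ` topspace (top_of_set {-\<epsilon><..<\<epsilon>}) \<subseteq> extensional {1..s}" by (auto simp: \<gamma>_def)
    show "\<gamma> \<in> topspace (top_of_set {-\<epsilon><..<\<epsilon>}) \<rightarrow> distinct_tuples s (mpoints N)"
      using \<gamma>D(1) by (auto simp: cdom_def)
    fix k assume k: "k \<in> {1..s}"
    have "continuous_map (top_of_set {-\<epsilon><..<\<epsilon>}) (subtopology (powertop_real I0) (snd (c k) ` fst (c k)))
        (\<lambda>t. block I0 k (X t))"
      unfolding continuous_map_in_subtopology continuous_map_componentwise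
    proof (intro conjI ballI)
      show "(\<lambda>t. block I0 k (X t)) ` topspace (top_of_set {-\<epsilon><..<\<epsilon>}) \<subseteq> extensional I0" by (auto simp: block_def)
      show "(\<lambda>t. block I0 k (X t)) \<in> topspace (top_of_set {-\<epsilon><..<\<epsilon>}) \<rightarrow> snd (c k) ` fst (c k)"
        using bl k by auto
      fix i assume "i \<in> I0"
      then show "continuous_map (top_of_set {-\<epsilon><..<\<epsilon>}) euclideanreal (\<lambda>t. block I0 k (X t) i)"
        unfolding X_def continuous_map_iff_continuous
        using DERIV_isCont[OF block_xline_deriv[OF k]] by (intro continuous_at_imp_continuous_on) blast
    qed
    from continuous_map_compose[OF this chart_inverse_continuous[OF N ck[OF k]]]
    show "continuous_map (top_of_set {-\<epsilon><..<\<epsilon>}) (mtop N) (\<lambda>t. \<gamma> t k)"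
      using k by (simp add: comp_def \<gamma>_def cinv_def)
  qed
  \<comment> \<open>In another product chart, component (k, i) of the curve is a transition function
    of \<open>N\<close> along a straight line in block \<open>k\<close>.\<close>
  have C1d: "(\<lambda>t. cmap s N c2 (\<gamma> t) j) C1_differentiable_on {t \<in> {-\<epsilon><..<\<epsilon>}. \<gamma> t \<in> cdom s N c2}"
    if c2: "c2 \<in> {1..s} \<rightarrow>\<^sub>E atlas N" and "j \<in> I1" for c2 j
  proof -
    obtain k i where j: "j = (k, i)" "k \<in> {1..s}" "i \<in> I0" using \<open>j \<in> I1\<close> by auto
    define T where "T x = snd (c2 k) (inv_into (fst (c k)) (snd (c k)) x) i" for x
    define W where "W = snd (c k) ` (fst (c k) \<inter> fst (c2 k))"
    have c2k: "(fst (c2 k), snd (c2 k)) \<in> atlas N" using c2 j(2) by (auto simp: PiE_iff)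
    have Wo: "iopen I0 W" unfolding W_def by (rule chart_open_image[OF N ck[OF j(2)] chartD(2)[OF N c2k]])
    have "W \<subseteq> I0 \<rightarrow>\<^sub>E UNIV" using ckD(6)[OF j(2)] unfolding W_def by blast
    with Wo have Wop: "openin (powertop_real I0) W" using openin_powertop_iff[OF fin0] by blast
    have "C_on r0 I0 I0 W (snd (c2 k) \<circ> inv_into (fst (c k)) (snd (c k)))"
      unfolding W_def by (rule transition_C_on[OF N ck[OF j(2)] c2k])
    moreover have "enat (Suc 0) \<le> r0" using r0 by (simp add: one_enat_def)
    ultimately have "C_nat_on (Suc 0) I0 W (\<lambda>x. (snd (c2 k) \<circ> inv_into (fst (c k)) (snd (c k))) x i)"
      using j(3) unfolding C_on_def by blast
    then have "Ck (Suc 0) I0 W T" unfolding T_def C_nat_on_iff_Ck[OF fin0 Wop] comp_def .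
    then have TC: "C1 I0 W T" by (rule Ck_Suc_C1)
    have eq: "cmap s N c2 (\<gamma> t) j = T (block I0 k (X t))" for t
      using j by (simp add: cmap_def \<gamma>_def T_def cinv_def)
    let ?S = "{t \<in> {-\<epsilon><..<\<epsilon>}. \<gamma> t \<in> cdom s N c2}"
    have inW: "block I0 k (X t) \<in> W" if t: "t \<in> ?S" for t
    proof -
      have b: "block I0 k (X t) \<in> snd (c k) ` fst (c k)" using bl t j(2) by blast
      have "\<gamma> t k \<in> fst (c2 k)" using t j(2) by (auto simp: cdom_def PiE_iff)
      then have "inv_into (fst (c k)) (snd (c k)) (block I0 k (X t)) \<in> fst (c k) \<inter> fst (c2 k)"
        using inv_into_into[OF b] j(2) by (simp add: \<gamma>_def cinv_def)
      then show ?thesis unfolding W_def using f_inv_into_f[OF b] by (metis image_eqI)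
    qed
    define dT where "dT t = (\<Sum>i'\<in>I0. partial i' T (block I0 k (X t)) * \<xi> (k, i'))" for t
    have "((\<lambda>t. T (block I0 k (X t))) has_real_derivative dT t) (at t)" if "t \<in> ?S" for t
      unfolding dT_def
    proof (rule chain_rule_curve[where c = "\<lambda>t. block I0 k (X t)" and h = T and v = "\<lambda>i'. \<xi> (k, i')"
          and ?t0.0 = t, OF fin0 Wo inW[OF that]])
      show "idiff I0 W T" "\<forall>i\<in>I0. icont I0 W (partial i T)" using TC by (auto simp: C1_def)
      show "\<forall>i'\<in>I0. ((\<lambda>t. block I0 k (X t) i') has_real_derivative \<xi> (k, i')) (at t)"
        using block_xline_deriv[OF j(2)] unfolding X_def by blast
    qed (auto simp: block_def)
    moreover have "continuous_on ?S dT"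
    proof (rule continuous_at_imp_continuous_on, rule ballI)
      fix t assume t: "t \<in> ?S"
      have "((\<lambda>t. partial i' T (block I0 k (X t))) \<longlongrightarrow> partial i' T (block I0 k (X t))) (at t)" if "i' \<in> I0" for i'
      proof (rule filterlim_compose[OF _ blim[OF j(2)]])
        show "(partial i' T \<longlongrightarrow> partial i' T (block I0 k (X t))) (nbhd I0 (block I0 k (X t)))"
          using TC that inW[OF t] by (auto simp: C1_def icont_def)
      qed
      then show "isCont dT t" unfolding isCont_def dT_def by (intro tendsto_sum tendsto_mult_right)
    qed
    ultimately show ?thesis unfolding C1_differentiable_on_def eq
      by (intro exI[of _ dT]) (auto simp: has_real_derivative_iff_has_vector_derivative)
  qed
  have curve: "curve_at ?M (mpoints ?M) q \<gamma>"
    unfolding curve_at_def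
  proof (intro conjI exI[of _ \<epsilon>] \<gamma>0 cont \<open>\<epsilon> > 0\<close>)
    show "\<gamma> ` {-\<epsilon><..<\<epsilon>} \<subseteq> mpoints ?M" using \<gamma>D(1) unfolding mpoints_config by (auto simp: cdom_def)
    show "\<forall>(D, \<phi>)\<in>atlas ?M. \<forall>i\<in>idx ?M. (\<lambda>t. \<phi> (\<gamma> t) i) C1_differentiable_on {t \<in> {-\<epsilon><..<\<epsilon>}. \<gamma> t \<in> D}"
      unfolding config_simps(2,3) using C1d by blast
  qed
  have "velocity ?M q \<gamma> (?D, ?\<Phi>) i = \<xi> i" if i: "i \<in> I1" for i
  proof -
    have "(?D, ?\<Phi>) \<in> charts_at ?M q" unfolding charts_at_def config_simps(3) using c q by auto
    then have "velocity ?M q \<gamma> (?D, ?\<Phi>) i = deriv (\<lambda>t. ?\<Phi> (\<gamma> t) i) 0"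
      using i by (simp add: velocity_def config_simps(2))
    also have "\<dots> = deriv (\<lambda>t. X t i) 0"
    proof (rule deriv_cong_ev)
      have "\<forall>\<^sub>F t in nhds 0. t \<in> {-\<epsilon><..<\<epsilon>}" using \<open>\<epsilon> > 0\<close> by (intro eventually_nhds_in_open) auto
      then show "\<forall>\<^sub>F t in nhds 0. ?\<Phi> (\<gamma> t) i = X t i" by eventually_elim (simp add: \<gamma>D(2))
    qed simp
    also have "\<dots> = \<xi> i" unfolding X_def by (rule DERIV_imp_deriv[OF xline_deriv[OF i]])
    finally show ?thesis .
  qed
  moreover have "velocity ?M q \<gamma> \<in> tangent_space ?M q" unfolding tangent_to_def using curve by blast
  ultimately show ?thesis by blast
qed

text \<open>\<open>differential\<close> picks some curve that represents \<open>v\<close>. By the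
  chain rule the result depends only on the velocity of that curve in the chart, to which the
  Jacobian of the coordinate expression is applied.\<close>

lemma differential_config:
  fixes g :: "'a \<Rightarrow> real ^ 'l"
  assumes q: "q \<in> cdom s N c" and v: "v \<in> tangent_space (config_mfd s N) q"
    and g: "\<And>k a. k \<in> {1..s} \<Longrightarrow> C1 I1 (cmap s N c ` cdom s N c) (\<lambda>x. g (cinv s N c k x) $ a)"
  shows "differential (config_mfd s N) (pow_euclid s) (tuple_map s g) q v
    = ptan s (\<lambda>(k, a). \<Sum>i\<in>I1. partial i (\<lambda>x. g (cinv s N c k x) $ a) (cmap s N c q) * v (cdom s N c, cmap s N c) i)"
proof -
  let ?M = "config_mfd s N" and ?\<Phi> = "cmap s N c" and ?D = "cdom s N c"
  define \<gamma> where "\<gamma> = (SOME \<gamma>. curve_at ?M (mpoints ?M) q \<gamma> \<and> velocity ?M q \<gamma> = v)"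
  have "\<exists>\<gamma>. curve_at ?M (mpoints ?M) q \<gamma> \<and> velocity ?M q \<gamma> = v" using v unfolding tangent_to_def by blast
  then have "curve_at ?M (mpoints ?M) q \<gamma> \<and> velocity ?M q \<gamma> = v" unfolding \<gamma>_def by (rule someI_ex)
  note \<gamma> = conjunct1[OF this] conjunct2[OF this]
  have \<gamma>0: "\<gamma> 0 = q" using \<gamma>(1) unfolding curve_at_def by (rule conjunct1)
  obtain \<epsilon> where eps: "\<epsilon> > 0 \<and> continuous_map (top_of_set {-\<epsilon><..<\<epsilon>}) (mtop ?M) \<gamma> \<and> \<gamma> ` {-\<epsilon><..<\<epsilon>} \<subseteq> mpoints ?M \<and>
      (\<forall>(D, \<phi>)\<in>atlas ?M. \<forall>i\<in>idx ?M. (\<lambda>t. \<phi> (\<gamma> t) i) C1_differentiable_on {t \<in> {-\<epsilon><..<\<epsilon>}. \<gamma> t \<in> D})"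
    using conjunct2[OF \<gamma>(1)[unfolded curve_at_def]] by (rule exE)
  then have "\<epsilon> > 0" and cont: "continuous_map (top_of_set {-\<epsilon><..<\<epsilon>}) (mtop ?M) \<gamma>" by simp_all
  have atl: "(?D, ?\<Phi>) \<in> atlas ?M" unfolding config_simps(3) using c by (rule imageI)
  have "\<forall>(D, \<phi>)\<in>atlas ?M. \<forall>i\<in>idx ?M. (\<lambda>t. \<phi> (\<gamma> t) i) C1_differentiable_on {t \<in> {-\<epsilon><..<\<epsilon>}. \<gamma> t \<in> D}"
    using eps by (elim conjE)
  note C1d = bspec[OF bspec[OF this atl, unfolded case_prod_conv config_simps(2)]]
  \<comment> \<open>For small times the chosen curve stays in the chart domain, where the coordinate
    expression of the mapping is valid.\<close>
  have "openin (top_of_set {-\<epsilon><..<\<epsilon>}) {t \<in> topspace (top_of_set {-\<epsilon><..<\<epsilon>}). \<gamma> t \<in> ?D}"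
    using cont openin_cdom by (rule openin_continuous_map_preimage)
  then have "open {t \<in> {-\<epsilon><..<\<epsilon>}. \<gamma> t \<in> ?D}"
    using openin_open_trans[of "{-\<epsilon><..<\<epsilon>}"] by simp
  moreover have S0: "0 \<in> {t \<in> {-\<epsilon><..<\<epsilon>}. \<gamma> t \<in> ?D}" using \<open>\<epsilon> > 0\<close> \<gamma>0 q by simp
  ultimately have ev: "\<forall>\<^sub>F t in nhds 0. t \<in> {t \<in> {-\<epsilon><..<\<epsilon>}. \<gamma> t \<in> ?D}"
    by (rule eventually_nhds_in_open)
  have vd: "((\<lambda>t. ?\<Phi> (\<gamma> t) i) has_real_derivative v (?D, ?\<Phi>) i) (at 0)" if i: "i \<in> I1" for i
  proof -
    obtain d where "((\<lambda>t. ?\<Phi> (\<gamma> t) i) has_vector_derivative d) (at 0)"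
      using C1d[OF i] S0 unfolding C1_differentiable_on_def by blast
    then have d: "((\<lambda>t. ?\<Phi> (\<gamma> t) i) has_real_derivative d) (at 0)"
      by (simp add: has_real_derivative_iff_has_vector_derivative)
    have "(?D, ?\<Phi>) \<in> charts_at ?M q" unfolding charts_at_def config_simps(3) using c q by auto
    then have "velocity ?M q \<gamma> (?D, ?\<Phi>) i = deriv (\<lambda>t. ?\<Phi> (\<gamma> t) i) 0"
      using i by (simp add: velocity_def config_simps(2))
    also have "\<dots> = d" by (rule DERIV_imp_deriv[OF d])
    finally show ?thesis using d \<gamma>(2) by simp
  qed
  have gq: "tuple_map s g q \<in> ({1..s} \<rightarrow>\<^sub>E UNIV)" by (simp add: tuple_map_def)
  have "differential ?M (pow_euclid s) (tuple_map s g) q v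
      = ptan s (\<lambda>(k, a). deriv (\<lambda>t. (tuple_map s g \<circ> \<gamma>) t k $ a) 0)"
    unfolding differential_def \<gamma>_def[symmetric] velocity_pow[OF gq] ..
  also have "\<dots> = ptan s (\<lambda>(k, a). \<Sum>i\<in>I1. partial i (\<lambda>x. g (cinv s N c k x) $ a) (?\<Phi> q) * v (?D, ?\<Phi>) i)"
  proof (rule ptan_cong)
    fix j :: "nat \<times> 'l" assume "j \<in> {1..s} \<times> UNIV"
    then obtain k a where j: "j = (k, a)" "k \<in> {1..s}" by auto
    let ?G = "\<lambda>x. g (cinv s N c k x) $ a"
    have "((\<lambda>t. ?G (?\<Phi> (\<gamma> t))) has_real_derivative (\<Sum>i\<in>I1. partial i ?G (?\<Phi> (\<gamma> 0)) * v (?D, ?\<Phi>) i)) (at 0)"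
    proof (rule chain_rule_curve[where c = "\<lambda>t. ?\<Phi> (\<gamma> t)" and h = ?G and v = "v (?D, ?\<Phi>)"
          and ?t0.0 = 0, OF fin1 iopen_cmap_image])
      show "?\<Phi> (\<gamma> 0) \<in> ?\<Phi> ` ?D" using q \<gamma>0 by simp
      show "idiff I1 (?\<Phi> ` ?D) ?G" "\<forall>i\<in>I1. icont I1 (?\<Phi> ` ?D) (partial i ?G)"
        using g[OF j(2)] by (auto simp: C1_def)
      show "\<forall>\<^sub>F t in at 0. \<forall>p. p \<notin> I1 \<longrightarrow> ?\<Phi> (\<gamma> t) p = ?\<Phi> (\<gamma> 0) p" by (simp add: cmap_def restrict_def)
      show "\<forall>i\<in>I1. ((\<lambda>t. ?\<Phi> (\<gamma> t) i) has_real_derivative v (?D, ?\<Phi>) i) (at 0)" using vd by blast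
    qed
    then have "deriv (\<lambda>t. ?G (?\<Phi> (\<gamma> t))) 0 = (\<Sum>i\<in>I1. partial i ?G (?\<Phi> q) * v (?D, ?\<Phi>) i)"
      unfolding \<gamma>0 by (rule DERIV_imp_deriv)
    moreover have "deriv (\<lambda>t. (tuple_map s g \<circ> \<gamma>) t k $ a) 0 = deriv (\<lambda>t. ?G (?\<Phi> (\<gamma> t))) 0"
    proof (rule deriv_cong_ev)
      show "\<forall>\<^sub>F t in nhds 0. (tuple_map s g \<circ> \<gamma>) t k $ a = ?G (?\<Phi> (\<gamma> t))"
        using ev
      proof eventually_elim
        case (elim t)
        then show ?case using cinv_cmap[of "\<gamma> t" k] j(2) by (simp add: tuple_map_def)
      qed
    qed simp
    ultimately show "(case j of (k, a) \<Rightarrow> deriv (\<lambda>t. (tuple_map s g \<circ> \<gamma>) t k $ a) 0) =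
        (case j of (k, a) \<Rightarrow> \<Sum>i\<in>I1. partial i (\<lambda>x. g (cinv s N c k x) $ a) (?\<Phi> q) * v (?D, ?\<Phi>) i)"
      unfolding j(1) by simp
  qed
  finally show ?thesis .
qed

end

text \<open>Modulo the tangent space of the diagonal, a target vector amounts to the differences of
  its blocks \<open>k \<ge> 2\<close> with block 1. Independence of the rows of the gaps makes the
  differential surjective onto these differences, and one chart at each tuple is enough to see
  this.\<close>

lemma transverse_diagonalI:
  fixes g :: "'a \<Rightarrow> real ^ 'l" and N :: "('a, 'i) mfd"
  assumes N: "C_manifold r0 n N" and r0: "1 \<le> r0" and g: "C_map 1 N euclid g" and "1 \<le> s"
    and indep: "\<And>q. q \<in> distinct_tuples s (mpoints N) \<Longrightarrow> \<forall>k\<in>{1..s}. g (q k) = g (q 1) \<Longrightarrow>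
      \<exists>c. c \<in> {1..s} \<rightarrow>\<^sub>E atlas N \<and> q \<in> cdom s N c \<and>
        \<not> row_dep ({1..s} \<times> idx N) ({2..s} \<times> UNIV)
          (jac (\<lambda>(k, a) x. g (cinv s N c k x) $ a - g (cinv s N c 1 x) $ a) (cmap s N c q))"
  shows "transverse (config_mfd s N) (pow_euclid s) (diagonal s) (tuple_map s g)"
  unfolding transverse_def
proof (intro conjI ballI impI C_map_tuple[OF N g])
  let ?M = "config_mfd s N" and ?P = "pow_euclid s :: (nat \<Rightarrow> real ^ 'l, nat \<times> 'l) mfd" and ?t = "tuple_map s g"
  fix q assume "q \<in> mpoints ?M" and diag: "?t q \<in> diagonal s"
  then have q: "q \<in> distinct_tuples s (mpoints N)" unfolding mpoints_config by blast
  from diag obtain y where y: "?t q = (\<lambda>k\<in>{1..s}. y)" unfolding diagonal_def by blast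
  have gy: "g (q k) = y" if "k \<in> {1..s}" for k using fun_cong[OF y, of k] that by (simp add: tuple_map_def)
  then obtain c where c: "c \<in> {1..s} \<rightarrow>\<^sub>E atlas N" and qc: "q \<in> cdom s N c"
    and nd: "\<not> row_dep ({1..s} \<times> idx N) ({2..s} \<times> UNIV)
      (jac (\<lambda>(k, a) x. g (cinv s N c k x) $ a - g (cinv s N c 1 x) $ a) (cmap s N c q))"
    using indep[OF q] \<open>1 \<le> s\<close> by auto
  interpret config_chart r0 n N s c using N c by unfold_locales
  let ?\<Phi> = "cmap s N c" and ?D = "cdom s N c"
  let ?G = "\<lambda>k a x. g (cinv s N c k x) $ a"
  have gC: "C1 I1 (?\<Phi> ` ?D) (?G k a)" if k: "k \<in> {1..s}" for k a
  proof -
    have "enat (Suc 0) \<le> 1" by (simp add: one_enat_def)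
    then have "Ck (Suc 0) I0 (snd (c k) ` fst (c k)) (\<lambda>x. g (inv_into (fst (c k)) (snd (c k)) x) $ a)"
      using g ck[OF k] unfolding C_map_euclid_iff[OF N] by blast
    then have "Ck (Suc 0) I1 (?\<Phi> ` ?D) (?G k a)"
      by (rule Ck_component[OF k _ iopen_cmap_image]) (use k in \<open>auto simp: cmap_image\<close>)
    then show ?thesis by (rule Ck_Suc_C1)
  qed
  have P: "?t q \<in> ({1..s} \<rightarrow>\<^sub>E UNIV)" by (simp add: tuple_map_def)
  have diff: "differential ?M ?P ?t q v = ptan s (\<lambda>(k, a). \<Sum>i\<in>I1. partial i (?G k a) (?\<Phi> q) * v (?D, ?\<Phi>) i)"
    if "v \<in> tangent_space ?M q" for v by (rule differential_config[OF qc that gC])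
  have tanP: "tangent_space ?P (?t q) = range (ptan s)"
  proof (intro equalityI subsetI)
    fix u assume "u \<in> tangent_space ?P (?t q)"
    then show "u \<in> range (ptan s)" unfolding tangent_to_def using velocity_pow[OF P] by auto
  next
    fix u :: "(nat \<Rightarrow> real ^ 'l, nat \<times> 'l) tvec" assume "u \<in> range (ptan s)"
    then obtain a where "u = ptan s a" by blast
    then show "u \<in> tangent_space ?P (?t q)"
      using tangent_line[OF P, of a "mpoints ?P"] by (simp add: power_euclid_simps)
  qed
  show "{tvec_add ?P (?t q) v w | v w. v \<in> differential ?M ?P ?t q ` tangent_space ?M q \<and> w \<in> tangent_to ?P (diagonal s) (?t q)}
    = tangent_space ?P (?t q)" (is "?L = _")
    unfolding tanP
  proof (intro equalityI subsetI)
    fix u assume "u \<in> ?L"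
    then obtain v w where u: "u = tvec_add ?P (?t q) (differential ?M ?P ?t q v) w"
      and v: "v \<in> tangent_space ?M q" and w: "w \<in> tangent_to ?P (diagonal s) (?t q)" by blast
    obtain b where "w = ptan s b" using w velocity_pow[OF P] unfolding tangent_to_def by auto
    then show "u \<in> range (ptan s)" unfolding u using diff[OF v] tvec_add_pow[OF P] by simp
  next
    fix u :: "(nat \<Rightarrow> real ^ 'l, nat \<times> 'l) tvec" assume "u \<in> range (ptan s)"
    then obtain a where u: "u = ptan s a" by blast
    let ?J = "{2..s} \<times> (UNIV :: 'l set)"
    let ?H = "\<lambda>(k, b) x. ?G k b x - ?G 1 b x"
    have "finite ?J" by simp
    \<comment> \<open>A source vector whose image has the same block differences as
      \<open>a\<close>.\<close>
    from indep_surj[OF this fin1 nd, of "\<lambda>(k, b). a (k, b) - a (1, b)"]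
    obtain \<xi> where \<xi>: "\<And>j. j \<in> ?J \<Longrightarrow> (\<Sum>i\<in>I1. jac ?H (?\<Phi> q) j i * \<xi> i) = (case j of (k, b) \<Rightarrow> a (k, b) - a (1, b))"
      by blast
    obtain v where v: "v \<in> tangent_space ?M q" "\<forall>i\<in>I1. v (?D, ?\<Phi>) i = \<xi> i"
      using tangent_config[OF r0 qc] by blast
    define \<omega> where "\<omega> k b = (\<Sum>i\<in>I1. partial i (?G k b) (?\<Phi> q) * \<xi> i)" for k b
    have dv: "differential ?M ?P ?t q v = ptan s (\<lambda>(k, b). \<omega> k b)"
      unfolding diff[OF v(1)] \<omega>_def using v(2) by (intro ptan_cong) (auto intro!: sum.cong)
    \<comment> \<open>The remainder of \<open>a\<close> in block 1. By the choice of
      \<open>\<xi>\<close> it is the same in every block, hence tangent to the diagonal.\<close>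
    define \<beta> where "\<beta> b = a (1, b) - \<omega> 1 b" for b
    have key: "a (k, b) - \<omega> k b = \<beta> b" if k: "k \<in> {1..s}" for k b
    proof (cases "k = 1")
      case True then show ?thesis by (simp add: \<beta>_def)
    next
      case False
      then have kJ: "(k, b) \<in> ?J" using k by auto
      have one: "1 \<in> {1..s}" using \<open>1 \<le> s\<close> by simp
      have x0: "?\<Phi> q \<in> ?\<Phi> ` ?D" using qc by blast
      have "partial i (\<lambda>x. ?G k b x - ?G 1 b x) (?\<Phi> q) = partial i (?G k b) (?\<Phi> q) - partial i (?G 1 b) (?\<Phi> q)"
        if "i \<in> I1" for i
        by (rule partialI, rule DERIV_diff)
          (rule idiff_partial[OF C1_idiff[OF gC[OF k]] that x0], rule idiff_partial[OF C1_idiff[OF gC[OF one]] that x0])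
      then have "(\<Sum>i\<in>I1. jac ?H (?\<Phi> q) (k, b) i * \<xi> i) = \<omega> k b - \<omega> 1 b"
        unfolding \<omega>_def sum_subtractf[symmetric] by (intro sum.cong) (auto simp: left_diff_distrib)
      with \<xi>[OF kJ] show ?thesis by (simp add: \<beta>_def)
    qed
    have "ptan s (\<lambda>(k, b). \<beta> b) \<in> tangent_to ?P (diagonal s) (?t q)"
    proof (rule tangent_line[OF P])
      fix t
      show "(\<lambda>k\<in>{1..s}. ?t q k + t *\<^sub>R (\<chi> b. case (k, b) of (k, b) \<Rightarrow> \<beta> b)) \<in> diagonal s"
        unfolding diagonal_def y by (intro CollectI exI[of _ "y + t *\<^sub>R (\<chi> b. \<beta> b)"] conjI) (auto intro: restrict_ext)
    qed
    moreover have "u = tvec_add ?P (?t q) (differential ?M ?P ?t q v) (ptan s (\<lambda>(k, b). \<beta> b))"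
      unfolding u dv tvec_add_pow[OF P] using key by (intro ptan_cong) (auto simp: algebra_simps)
    ultimately show "u \<in> ?L" using v(1) by blast
  qed
qed

section \<open>Ingredients of the main theorem\<close>

text \<open>A chart at \<open>p\<close> contains a nondegenerate coordinate segment. Infinitely many
  points ensure distinct tuples of every length, without which the condition defining
  \<open>s_inj\<close> would hold vacuously for long tuples.\<close>

lemma infinite_manifold:
  assumes N: "C_manifold r n N" and "0 < n" and p: "p \<in> mpoints N"
  shows "infinite (mpoints N)"
proof -
  have "p \<in> (\<Union>(D, \<phi>)\<in>atlas N. D)" using p N unfolding C_manifold_def by simp
  then obtain D \<phi> where c: "(D, \<phi>) \<in> atlas N" "p \<in> D" by blast
  note cD = chartD[OF N c(1)]
  have "card (idx N) = n" using N unfolding C_manifold_def by simp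
  then obtain i where i: "i \<in> idx N" using \<open>0 < n\<close> by fastforce
  obtain d where d: "d > 0" "\<And>y. near (idx N) d (\<phi> p) y \<Longrightarrow> y \<in> \<phi> ` D"
    using iopenD[OF cD(7), of "\<phi> p"] c(2) by blast
  let ?h = "\<lambda>t. (\<phi> p)(i := t)"
  have "inj_on ?h {\<phi> p i<..<\<phi> p i + d}" by (rule inj_onI) (metis fun_upd_same)
  moreover have "infinite {\<phi> p i<..<\<phi> p i + d}" using d(1) by (simp add: infinite_Ioo)
  ultimately have "infinite (?h ` {\<phi> p i<..<\<phi> p i + d})" using finite_imageD by blast
  moreover have "?h ` {\<phi> p i<..<\<phi> p i + d} \<subseteq> \<phi> ` D"
  proof (rule image_subsetI, rule d(2))
    fix t assume "t \<in> {\<phi> p i<..<\<phi> p i + d}"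
    then show "near (idx N) d (\<phi> p) (?h t)" using near_upd[OF i d(1)] by auto
  qed
  ultimately have "infinite (\<phi> ` D)" using finite_subset by blast
  then show ?thesis using cD(8) finite_subset finite_imageI by blast
qed

text \<open>Affine independence of the points, stated for the indexed family of differences; in
  contrast to independence of the set of differences this excludes repetitions.\<close>

definition indep_tuple :: "nat \<Rightarrow> (nat \<Rightarrow> 'b::real_vector) \<Rightarrow> bool"
  where "indep_tuple s v \<longleftrightarrow> (\<forall>c. (\<Sum>k\<in>{2..s}. c k *\<^sub>R (v k - v 1)) = 0 \<longrightarrow> (\<forall>k\<in>{2..s}. c k = 0))"

text \<open>At most s - 1 vectors that span a space of dimension s - 1 are distinct and
  independent.\<close>

lemma dim_indep_tuple:
  fixes v :: "nat \<Rightarrow> 'b::euclidean_space"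
  assumes "1 \<le> s" "dim (span {v i - v 1 | i. i \<in> {2..s}}) = s - 1"
  shows "indep_tuple s v"
proof -
  let ?w = "\<lambda>i. v i - v 1" and ?S = "(\<lambda>i. v i - v 1) ` {2..s}"
  have S: "{v i - v 1 | i. i \<in> {2..s}} = ?S" by blast
  have dimS: "dim ?S = s - 1" using assms(2) unfolding S by simp
  have le: "card ?S \<le> s - 1" using card_image_le[of "{2..s}" ?w] by simp
  have ge: "dim ?S \<le> card ?S" by (rule dim_le_card') simp
  have c: "card ?S = card {2..s}" using le ge dimS assms(1) by simp
  then have inj: "inj_on ?w {2..s}" by (simp add: eq_card_imp_inj_on)
  have ind: "independent ?S"
    by (rule card_le_dim_spanning[of ?S ?S]) (use le dimS in \<open>auto simp: span_superset\<close>)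
  show ?thesis
    unfolding indep_tuple_def
  proof (intro allI impI ballI)
    fix c k assume 0: "(\<Sum>k\<in>{2..s}. c k *\<^sub>R (v k - v 1)) = 0" and k: "k \<in> {2..s}"
    define u where "u x = c (the_inv_into {2..s} ?w x)" for x
    have u: "u (?w k) = c k" if "k \<in> {2..s}" for k
      using the_inv_into_f_f[OF inj that] by (simp add: u_def)
    have "(\<Sum>x\<in>?S. u x *\<^sub>R x) = (\<Sum>k\<in>{2..s}. u (?w k) *\<^sub>R ?w k)"
      by (rule sum.reindex[OF inj, unfolded comp_def])
    also have "\<dots> = (\<Sum>k\<in>{2..s}. c k *\<^sub>R (v k - v 1))" using u by (intro sum.cong) auto
    finally have "(\<Sum>x\<in>?S. u x *\<^sub>R x) = 0" using 0 by simp
    from independentD[OF ind _ order_refl this, of "?w k"] k have "u (?w k) = 0" by auto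
    with u[OF k] show "c k = 0" by simp
  qed
qed

text \<open>As a maximum, \<open>s_inj\<close> gives independence for tuples of exactly that length.
  A shorter tuple is extended by further distinct points of the infinite set
  \<open>mpoints N\<close>, and a part of an independent family is independent.\<close>

lemma s_inj_indep:
  fixes f :: "'a \<Rightarrow> real ^ 'm"
  assumes inf: "infinite (mpoints N)" and s: "s \<le> s_inj N f" and q: "q \<in> distinct_tuples s (mpoints N)"
  shows "indep_tuple s (\<lambda>k. f (q k))"
proof -
  define S where "S = {s. 1 \<le> s \<and> (\<forall>q\<in>distinct_tuples s (mpoints N).
    dim (span {f (q i) - f (q 1) | i. i \<in> {2..s}}) = s - 1)}"
  obtain e :: "nat \<Rightarrow> 'a" where e: "inj e" "range e \<subseteq> mpoints N"
    using infinite_countable_subset[OF inf] by blast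
  \<comment> \<open>\<open>Max\<close> belongs to \<open>S\<close> only if \<open>S\<close> is
    finite; an actual tuple of \<open>t\<close> distinct points bounds \<open>t - 1\<close> by the
    dimension of the space.\<close>
  have "S \<subseteq> {..CARD('m) + 1}"
  proof
    fix t assume t: "t \<in> S"
    have et: "restrict e {1..t} \<in> distinct_tuples t (mpoints N)"
      using e by (auto simp: distinct_tuples_def inj_on_def)
    have "\<forall>q\<in>distinct_tuples t (mpoints N).
        dim (span {f (q i) - f (q 1) | i. i \<in> {2..t}}) = t - 1" using t unfolding S_def by blast
    from bspec[OF this et]
    have "t - 1 = dim (span {f (restrict e {1..t} i) - f (restrict e {1..t} 1) | i. i \<in> {2..t}})" by (rule sym)
    also have "\<dots> \<le> DIM(real ^ 'm)" by (rule dim_subset_UNIV)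
    also have "\<dots> = CARD('m)" by simp
    finally show "t \<in> {..CARD('m) + 1}" by simp
  qed
  then have "finite S" by (rule finite_subset) simp
  moreover have "1 \<in> S"
  proof -
    have "{f (q i) - f (q 1) | i. i \<in> {2..1}} = {}" for q :: "nat \<Rightarrow> 'a" by auto
    then show ?thesis unfolding S_def by auto
  qed
  ultimately have "Max S \<in> S" by (intro Max_in) auto
  then have t: "s_inj N f \<in> S" unfolding S_def s_inj_def .
  let ?t = "s_inj N f"
  have "infinite (mpoints N - q ` {1..s})" using inf by (intro Diff_infinite_finite) auto
  then obtain h :: "nat \<Rightarrow> 'a" where h: "inj h" "range h \<subseteq> mpoints N - q ` {1..s}"
    using infinite_countable_subset by blast
  define p where "p = (\<lambda>k\<in>{1..?t}. if k \<le> s then q k else h k)"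
  have qi: "inj_on q {1..s}" and qN: "\<And>k. k \<in> {1..s} \<Longrightarrow> q k \<in> mpoints N"
    using q by (auto simp: distinct_tuples_def)
  have hk: "h k \<in> mpoints N" "h k \<notin> q ` {1..s}" for k using h(2) by blast+
  have "p \<in> distinct_tuples ?t (mpoints N)"
    unfolding distinct_tuples_def
  proof (intro CollectI conjI)
    show "p \<in> {1..?t} \<rightarrow>\<^sub>E mpoints N" using qN hk by (auto simp: p_def)
    show "inj_on p {1..?t}"
    proof (rule inj_onI)
      fix k l assume kl: "k \<in> {1..?t}" "l \<in> {1..?t}" "p k = p l"
      show "k = l"
      proof (cases "k \<le> s"; cases "l \<le> s")
        assume "k \<le> s" "l \<le> s"
        then show ?thesis using kl inj_onD[OF qi, of k l] by (simp add: p_def)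
      next
        assume "k \<le> s" "\<not> l \<le> s"
        then have "q k = h l" using kl by (simp add: p_def)
        moreover have "q k \<in> q ` {1..s}" using kl(1) \<open>k \<le> s\<close> by simp
        ultimately show ?thesis using hk(2)[of l] by simp
      next
        assume "\<not> k \<le> s" "l \<le> s"
        then have "q l = h k" using kl by (simp add: p_def)
        moreover have "q l \<in> q ` {1..s}" using kl(2) \<open>l \<le> s\<close> by simp
        ultimately show ?thesis using hk(2)[of k] by simp
      next
        assume "\<not> k \<le> s" "\<not> l \<le> s"
        then show ?thesis using kl injD[OF h(1)] by (simp add: p_def)
      qed
    qed
  qed
  then have "dim (span {f (p i) - f (p 1) | i. i \<in> {2..?t}}) = ?t - 1" and t1: "1 \<le> ?t"
    using t unfolding S_def by blast+
  then have ip: "indep_tuple ?t (\<lambda>k. f (p k))" using dim_indep_tuple[OF t1, of "\<lambda>k. f (p k)"] by simp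
  show ?thesis
    unfolding indep_tuple_def
  proof (intro allI impI ballI)
    fix c k assume 0: "(\<Sum>k\<in>{2..s}. c k *\<^sub>R (f (q k) - f (q 1))) = 0" and k: "k \<in> {2..s}"
    define c' where "c' k = (if k \<le> s then c k else 0)" for k
    have s1: "1 \<le> s" using k by simp
    have pq: "p k = q k" if "k \<in> {1..s}" for k using that s by (simp add: p_def)
    have "(\<Sum>k\<in>{2..?t}. c' k *\<^sub>R (f (p k) - f (p 1))) = (\<Sum>k\<in>{2..s}. c k *\<^sub>R (f (q k) - f (q 1)))"
    proof (rule sum.mono_neutral_cong_right)
      show "{2..s} \<subseteq> {2..?t}" using s by auto
      show "\<forall>i\<in>{2..?t} - {2..s}. c' i *\<^sub>R (f (p i) - f (p 1)) = 0" by (auto simp: c'_def)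
      show "c' x *\<^sub>R (f (p x) - f (p 1)) = c x *\<^sub>R (f (q x) - f (q 1))" if "x \<in> {2..s}" for x
        using that pq[of x] pq[of 1] s1 by (simp add: c'_def)
    qed simp
    then have "c' k = 0" using ip 0 k s unfolding indep_tuple_def by auto
    then show "c k = 0" using k by (simp add: c'_def)
  qed
qed

text \<open>Second countability enters through the Lindelof property: the exceptional set is a union
  over tuples of charts, which has to be countable.\<close>

lemma countable_subatlas:
  assumes N: "C_manifold r n N"
  shows "\<exists>A0\<subseteq>atlas N. countable A0 \<and> mpoints N \<subseteq> (\<Union>ch\<in>A0. fst ch)"
proof -
  have L: "Lindelof_space (mtop N)" using N unfolding C_manifold_def by (blast intro: second_countable_imp_Lindelof_space)
  have op: "\<forall>U\<in>fst ` atlas N. openin (mtop N) U" using chartD(2)[OF N] by fastforce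
  have "\<Union> (fst ` atlas N) = (\<Union>(D, \<phi>)\<in>atlas N. D)" by force
  also have "\<dots> = mpoints N" using N unfolding C_manifold_def by blast
  finally have "\<Union> (fst ` atlas N) = mpoints N" .
  with L op obtain \<V> where V: "countable \<V>" "\<V> \<subseteq> fst ` atlas N" "\<Union>\<V> = mpoints N"
    unfolding Lindelof_space_def by meson
  from V(2) obtain A0 where A0: "A0 \<subseteq> atlas N" "inj_on fst A0" "\<V> = fst ` A0"
    by (meson subset_image_inj)
  have "countable A0" using V(1) A0(2,3) countable_image_inj_on by blast
  moreover have "mpoints N \<subseteq> (\<Union>ch\<in>A0. fst ch)" using V(3) A0(3) by simp
  ultimately show ?thesis using A0(1) by blast
qed

section \<open>Lebesgue measure on matrices\<close>

definition to_matrix :: "(('l \<times> 'm) + 'c \<Rightarrow> real) \<Rightarrow> real ^ 'm ^ 'l"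
  where "to_matrix w = (\<chi> a b. w (Inl (a, b)))"

lemma Basis_matrix: "(Basis :: (real ^ 'm ^ 'l) set) = range (\<lambda>(a, b). axis a (axis b 1))"
  by (auto simp: Basis_vec_def)

lemma inner_axis_axis_matrix: "(A :: real ^ 'm ^ 'l) \<bullet> axis a (axis b 1) = A $ a $ b"
  by (simp add: inner_axis)

lemma inj_matrix_axis: "inj (\<lambda>(a :: 'l::finite, b :: 'm::finite). axis a (axis b (1::real)))"
  by (auto simp: inj_on_def axis_eq_axis)

lemma to_matrix_measurable:
  "(to_matrix :: (('l \<times> 'm) + 'c \<Rightarrow> real) \<Rightarrow> real ^ 'm ^ 'l) \<in> borel_measurable (PiM (Inl ` UNIV) (\<lambda>_. lborel))"
  unfolding borel_measurable_euclidean_space[of to_matrix] Basis_matrix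
  by (auto simp: inner_axis_axis_matrix to_matrix_def intro!: measurable_component_singleton[THEN measurable_compose, OF _ measurable_ident_sets])

text \<open>Lebesgue measure is determined by the volumes of boxes, and the preimage of a box of
  matrices is a box of the product with the same volume.\<close>

lemma distr_to_matrix:
  "lborel = distr (PiM (Inl ` UNIV) (\<lambda>_. lborel)) borel
    (to_matrix :: (('l::finite \<times> 'm::finite) + 'c \<Rightarrow> real) \<Rightarrow> real ^ 'm ^ 'l)"
proof (rule lborel_eqI)
  let ?K = "Inl ` UNIV :: (('l \<times> 'm) + 'c) set" and ?T = "to_matrix :: (('l \<times> 'm) + 'c \<Rightarrow> real) \<Rightarrow> real ^ 'm ^ 'l"
  fix l u :: "real ^ 'm ^ 'l" assume le: "\<And>b. b \<in> Basis \<Longrightarrow> l \<bullet> b \<le> u \<bullet> b"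
  define co :: "real ^ 'm ^ 'l \<Rightarrow> ('l \<times> 'm) + 'c \<Rightarrow> real" where "co x j = (case j of Inl (a, b) \<Rightarrow> x $ a $ b | Inr _ \<Rightarrow> 0)" for x j
  have le': "l $ a $ b \<le> u $ a $ b" for a b
  proof -
    have "axis a (axis b 1) \<in> (Basis :: (real ^ 'm ^ 'l) set)"
      unfolding Basis_matrix by (rule image_eqI[of _ _ "(a, b)"]) auto
    from le[OF this] show ?thesis by (simp add: inner_axis_axis_matrix)
  qed
  have pre: "?T -` box l u \<inter> space (PiM ?K (\<lambda>_. lborel)) = (\<Pi>\<^sub>E j\<in>?K. {co l j<..<co u j})"
    by (auto simp: mem_box Basis_matrix inner_axis_axis_matrix space_PiM PiE_iff to_matrix_def co_def)
  have "emeasure (distr (PiM ?K (\<lambda>_. lborel)) borel ?T) (box l u)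
      = emeasure (PiM ?K (\<lambda>_. lborel)) (\<Pi>\<^sub>E j\<in>?K. {co l j<..<co u j})"
    unfolding pre[symmetric] by (rule emeasure_distr[OF to_matrix_measurable]) simp
  also have "\<dots> = (\<Prod>j\<in>?K. emeasure lborel {co l j<..<co u j})" by (intro lb.emeasure_PiM) auto
  also have "\<dots> = (\<Prod>j\<in>?K. ennreal (co u j - co l j))"
    using le' by (intro prod.cong) (auto simp: co_def)
  also have "\<dots> = ennreal (\<Prod>j\<in>?K. co u j - co l j)"
    using le' by (intro prod_ennreal) (auto simp: co_def)
  also have "(\<Prod>j\<in>?K. co u j - co l j) = (\<Prod>(a, b)\<in>UNIV. u $ a $ b - l $ a $ b)"
    by (subst prod.reindex) (auto simp: co_def intro!: prod.cong)
  also have "\<dots> = (\<Prod>b\<in>Basis. (u - l) \<bullet> b)"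
    unfolding Basis_matrix by (subst prod.reindex[OF inj_matrix_axis]) (auto simp: inner_axis_axis_matrix intro!: prod.cong)
  finally show "emeasure (distr (PiM ?K (\<lambda>_. lborel)) borel ?T) (box l u) = ennreal (\<Prod>b\<in>Basis. (u - l) \<bullet> b)" .
qed simp

text \<open>On extensional functions \<open>to_matrix\<close> has the inverse \<open>R\<close>,
  which is measurable; pulling a null cover of \<open>E\<close> back along \<open>R\<close> gives a
  Borel null set that covers the image.\<close>

lemma prod_null_to_matrix:
  assumes "prod_null (Inl ` UNIV) E" "E \<subseteq> (Inl ` UNIV \<rightarrow>\<^sub>E UNIV)"
  shows "(to_matrix :: (('l::finite \<times> 'm::finite) + 'c \<Rightarrow> real) \<Rightarrow> real ^ 'm ^ 'l) ` E \<in> null_sets lebesgue"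
proof -
  let ?K = "Inl ` UNIV :: (('l \<times> 'm) + 'c) set" and ?T = "to_matrix :: (('l \<times> 'm) + 'c \<Rightarrow> real) \<Rightarrow> real ^ 'm ^ 'l"
  define R :: "real ^ 'm ^ 'l \<Rightarrow> ('l \<times> 'm) + 'c \<Rightarrow> real" where "R A = (\<lambda>j\<in>?K. case j of Inl (a, b) \<Rightarrow> A $ a $ b | Inr _ \<Rightarrow> 0)" for A
  have RT: "R (?T w) = w" if "w \<in> ?K \<rightarrow>\<^sub>E UNIV" for w
    using that by (intro extensionalityI[of _ ?K]) (auto simp: R_def to_matrix_def PiE_iff)
  obtain Z where Z: "Z \<in> null_sets (PiM ?K (\<lambda>_. lborel))" "E \<subseteq> Z" using assms(1) unfolding prod_null_def by blast
  have Rm: "R \<in> measurable borel (PiM ?K (\<lambda>_. lborel))"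
    unfolding R_def by (intro measurable_restrict) (auto intro!: borel_measurable_continuous_onI continuous_intros)
  have "R -` Z \<inter> space borel \<in> sets borel"
    by (rule measurable_sets[OF Rm]) (use Z in auto)
  then have Sb: "R -` Z \<in> sets borel" by simp
  have "emeasure lborel (R -` Z) = emeasure (PiM ?K (\<lambda>_. lborel)) (?T -` (R -` Z) \<inter> space (PiM ?K (\<lambda>_. lborel)))"
    by (subst distr_to_matrix[where 'c = 'c], rule emeasure_distr[OF to_matrix_measurable Sb])
  also have "?T -` (R -` Z) \<inter> space (PiM ?K (\<lambda>_. lborel)) = Z \<inter> space (PiM ?K (\<lambda>_. lborel))"
    using RT by (auto simp: space_PiM)
  also have "\<dots> = Z" using sets.sets_into_space[of Z] Z(1) by (auto simp: null_sets_def)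
  also have "emeasure (PiM ?K (\<lambda>_. lborel)) Z = 0" using Z(1) by (simp add: null_sets_def)
  finally have "R -` Z \<in> null_sets lborel" using Sb by (simp add: null_sets_def)
  then have "R -` Z \<in> null_sets lebesgue" by (rule null_sets_completionI)
  moreover have "?T ` E \<subseteq> R -` Z"
  proof (rule image_subsetI)
    fix w assume w: "w \<in> E"
    then have "R (?T w) = w" using RT assms(2) by blast
    with w Z(2) show "?T w \<in> R -` Z" by auto
  qed
  ultimately show ?thesis using null_sets_completion_subset by blast
qed

section \<open>Smoothness of the perturbed mapping\<close>

lemma openin_vec_nth_image:
  assumes "open U"
  shows "openin (powertop_real UNIV) (vec_nth ` (U :: (real ^ 'm) set))"
proof -
  have "iopen UNIV (vec_nth ` U)"
    unfolding iopen_def eventually_nbhd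
  proof
    fix u assume "u \<in> vec_nth ` U"
    then obtain x where x: "x \<in> U" "u = vec_nth x" by blast
    obtain e where e: "e > 0" "ball x e \<subseteq> U" using openE[OF assms x(1)] by blast
    \<comment> \<open>Coordinate deviations below \<open>d\<close> have l1-norm below
      \<open>e\<close>, and the l1-norm dominates the Euclidean norm.\<close>
    define d where "d = e / real CARD('m)"
    have "d > 0" using e by (simp add: d_def)
    have "v \<in> vec_nth ` U" if v: "near UNIV d u v" for v
    proof -
      have "dist x (vec_lambda v) = norm (vec_lambda v - x)" by (simp add: dist_norm norm_minus_commute)
      also have "\<dots> \<le> (\<Sum>i\<in>UNIV. \<bar>(vec_lambda v - x) $ i\<bar>)" by (rule norm_le_l1_cart)
      also have "\<dots> < (\<Sum>i\<in>(UNIV :: 'm set). d)"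
        using v x(2) by (intro sum_strict_mono) (auto simp: near_def)
      also have "\<dots> = e" by (simp add: d_def)
      finally have "vec_lambda v \<in> U" using e by auto
      then show ?thesis by (metis image_eqI vec_lambda_inverse UNIV_I)
    qed
    with \<open>d > 0\<close> show "\<exists>d>0. \<forall>y. near UNIV d u y \<longrightarrow> y \<in> vec_nth ` U" by blast
  qed
  then show ?thesis using openin_powertop_iff[of UNIV "vec_nth ` U"] by auto
qed

lemma open_euclid_simps:
  "mtop (open_submanifold euclid U) = top_of_set U" "idx (open_submanifold euclid U) = UNIV"
  "atlas (open_submanifold euclid U) = {(U, vec_nth)}"
  by (simp_all add: open_submanifold_def)

lemma C_map_vec_Ck:
  fixes F :: "real ^ 'm \<Rightarrow> real ^ 'l"
  assumes U: "open U" and F: "C_map r (open_submanifold euclid U) euclid F" and k: "enat k \<le> r"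
  shows "Ck k UNIV (vec_nth ` U) (\<lambda>u. F (vec_lambda u) $ a)"
proof -
  note o = openin_vec_nth_image[OF U]
  have io: "iopen UNIV (vec_nth ` U)" using o openin_powertop_iff[of UNIV "vec_nth ` U"] by auto
  have "C_on r UNIV UNIV (vec_nth ` U) (vec_nth \<circ> F \<circ> inv_into U vec_nth)"
    using F unfolding C_map_def open_euclid_simps by simp
  then have "Ck k UNIV (vec_nth ` U) (\<lambda>u. (vec_nth \<circ> F \<circ> inv_into U vec_nth) u a)"
    using k unfolding C_on_def C_nat_on_iff_Ck[OF finite o] by blast
  then show ?thesis
  proof (rule Ck_cong[OF io, rotated], intro ballI)
    fix u assume "u \<in> vec_nth ` U"
    then obtain x where x: "x \<in> U" "u = vec_nth x" by blast
    have "inv_into U vec_nth (vec_nth x) = x"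
      using x(1) by (intro inv_into_f_f) (auto simp: inj_on_def vec_nth_inject)
    then show "(vec_nth \<circ> F \<circ> inv_into U vec_nth) u a = F (vec_lambda u) $ a"
      using x(2) by (simp add: vec_nth_inverse)
  qed
qed

lemma C_map_into_open_Ck:
  fixes f :: "'a \<Rightarrow> real ^ 'm"
  assumes N: "C_manifold r0 n N" and f: "C_map r N (open_submanifold euclid U) f" and k: "enat k \<le> r"
    and c: "(D, \<phi>) \<in> atlas N"
  shows "Ck k (idx N) (\<phi> ` D) (\<lambda>x. f (inv_into D \<phi> x) $ a)" and "f ` mpoints N \<subseteq> U"
proof -
  show fU: "f ` mpoints N \<subseteq> U"
    using f unfolding C_map_def open_euclid_simps continuous_map_in_subtopology by auto
  have "C_on r (idx N) UNIV (\<phi> ` {x\<in>D. f x \<in> U}) (vec_nth \<circ> f \<circ> inv_into D \<phi>)"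
    using f c unfolding C_map_def open_euclid_simps by auto
  moreover have "{x\<in>D. f x \<in> U} = D" using fU chartD(8)[OF N c] by blast
  ultimately have "Ck k (idx N) (\<phi> ` D) (\<lambda>x. (vec_nth \<circ> f \<circ> inv_into D \<phi>) x a)"
    using k unfolding C_on_def by (simp add: C_nat_on_iff_Ck[OF chartD(1,3)[OF N c]])
  then show "Ck k (idx N) (\<phi> ` D) (\<lambda>x. f (inv_into D \<phi> x) $ a)" by simp
qed

lemma Ck_compose_vec:
  fixes f :: "'a \<Rightarrow> real ^ 'm" and F :: "real ^ 'm \<Rightarrow> real ^ 'l"
  assumes N: "C_manifold r0 n N" and U: "open U" and f: "C_map r N (open_submanifold euclid U) f"
    and F: "C_map r (open_submanifold euclid U) euclid F" and k: "enat k \<le> r" and c: "(D, \<phi>) \<in> atlas N"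
  shows "Ck k (idx N) (\<phi> ` D) (\<lambda>x. F (f (inv_into D \<phi> x)) $ a)"
proof -
  have io: "iopen UNIV (vec_nth ` U)" using openin_vec_nth_image[OF U] openin_powertop_iff[of UNIV "vec_nth ` U"] by auto
  have m: "\<forall>x\<in>\<phi> ` D. vec_nth (f (inv_into D \<phi> x)) \<in> vec_nth ` U"
    using C_map_into_open_Ck(2)[OF N f k c] chartD(8)[OF N c] inv_into_into[of _ \<phi> D] by blast
  have "Ck k (idx N) (\<phi> ` D) (\<lambda>x. F (vec_lambda (vec_nth (f (inv_into D \<phi> x)))) $ a)"
  proof (rule Ck_compose[OF finite chartD(7)[OF N c] io _ m _ C_map_vec_Ck[OF U F k]])
    show "compat (idx N) (\<phi> ` D) UNIV (\<lambda>x. vec_nth (f (inv_into D \<phi> x)))" by (simp add: compat_def)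
    show "\<forall>j\<in>UNIV. Ck k (idx N) (\<phi> ` D) (\<lambda>x. f (inv_into D \<phi> x) $ j)"
      using C_map_into_open_Ck(1)[OF N f k c] by blast
  qed
  then show ?thesis by (simp add: vec_nth_inverse)
qed

lemma linear_component:
  fixes \<pi> :: "real ^ 'm \<Rightarrow> real ^ 'l"
  assumes "linear \<pi>"
  shows "\<pi> v $ a = (\<Sum>b\<in>UNIV. matrix \<pi> $ a $ b * v $ b)"
proof -
  have "\<pi> v = matrix \<pi> *v v" using matrix_works[of \<pi> v] assms by simp
  then show ?thesis by (simp add: matrix_vector_mult_def)
qed

lemma C_map_perturbed:
  fixes f :: "'a \<Rightarrow> real ^ 'm" and F :: "real ^ 'm \<Rightarrow> real ^ 'l"
  assumes N: "C_manifold r0 n N" and U: "open U" and f: "C_map r N (open_submanifold euclid U) f"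
    and F: "C_map r (open_submanifold euclid U) euclid F" and \<pi>: "linear \<pi>"
  shows "C_map r N euclid (\<lambda>x. F (f x) + \<pi> (f x))"
  unfolding C_map_euclid_iff[OF N]
proof (intro conjI allI impI)
  have fc: "continuous_map (mtop N) (top_of_set U) f" using f unfolding C_map_def open_euclid_simps by simp
  have Fc: "continuous_map (top_of_set U) euclidean F" using F unfolding C_map_def open_euclid_simps by simp
  have "continuous_map (top_of_set U) euclidean (\<lambda>x. F x + \<pi> x)"
    using Fc linear_continuous_on[of \<pi> U] \<pi>
    by (auto intro!: continuous_on_add simp: linear_conv_bounded_linear)
  from continuous_map_compose[OF fc this]
  show "continuous_map (mtop N) euclidean (\<lambda>x. F (f x) + \<pi> (f x))" by (simp add: comp_def)
  fix D \<phi> k a assume c: "(D, \<phi>) \<in> atlas N" and k: "enat k \<le> r"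
  note io = chartD(7)[OF N c]
  have "Ck k (idx N) (\<phi> ` D) (\<lambda>x. F (f (inv_into D \<phi> x)) $ a
      + (\<Sum>b\<in>UNIV. matrix \<pi> $ a $ b * f (inv_into D \<phi> x) $ b))"
    by (intro Ck_add[OF io] Ck_sum[OF io] Ck_mult[OF io] Ck_const Ck_compose_vec[OF N U f F k c]
        C_map_into_open_Ck(1)[OF N f k c])
  then show "Ck k (idx N) (\<phi> ` D) (\<lambda>x. (F (f (inv_into D \<phi> x)) + \<pi> (f (inv_into D \<phi> x))) $ a)"
    by (simp add: linear_component[OF \<pi>])
qed

section \<open>Negligibility of the degenerate perturbations\<close>

definition tuple_gap :: "nat \<Rightarrow> ('a, 'i) mfd \<Rightarrow> (nat \<Rightarrow> ('a, 'i) chart) \<Rightarrow> ('a \<Rightarrow> real ^ 'l) \<Rightarrow>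
    nat \<times> 'l \<Rightarrow> (nat \<times> 'i \<Rightarrow> real) \<Rightarrow> real"
  where "tuple_gap s N c g = (\<lambda>(k, a) x. g (cinv s N c k x) $ a - g (cinv s N c 1 x) $ a)"

context config_chart
begin

text \<open>
  \<open>degenerate_null\<close> treats \<open>\<pi>\<close> as part of the variables: both the variables and the equations
  have an index type in which the summand \<open>'l \<times> 'm\<close> carries the entries of the matrix of \<open>\<pi>\<close>, and
  \<open>sard_fiber\<close> is applied to the projection to these entries.
\<close>

definition degenerate :: "('a \<Rightarrow> real ^ 'l) \<Rightarrow> bool"
  where "degenerate g \<longleftrightarrow> (\<exists>q\<in>cdom s N c. (\<forall>k\<in>{1..s}. g (q k) = g (q 1)) \<and>
    row_dep I1 ({2..s} \<times> UNIV) (jac (tuple_gap s N c g) (cmap s N c q)))"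

lemma degenerate_null:
  fixes f :: "'a \<Rightarrow> real ^ 'm" and F :: "real ^ 'm \<Rightarrow> real ^ 'l"
  assumes U: "open U" and f: "C_map r N (open_submanifold euclid U) f"
    and F: "C_map r (open_submanifold euclid U) euclid F" and r: "enat (Suc d) \<le> r" and s: "1 \<le> s"
    and dim: "s * n \<le> (s - 1) * CARD('l) + d"
    and indep: "\<And>q. q \<in> distinct_tuples s (mpoints N) \<Longrightarrow> indep_tuple s (\<lambda>k. f (q k))"
  shows "matrix ` {\<pi>. linear \<pi> \<and> degenerate (\<lambda>x. F (f x) + \<pi> (f x))} \<in> null_sets lebesgue"
proof -
  define V where "V = (\<Inter>k\<in>{1..s}. {x. block I0 k x \<in> snd (c k) ` fst (c k)})"
  have Vo: "iopen I1 V" unfolding V_def using ckD(7) fin0 by (intro iopen_INT iopen_block) auto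
  have Vb: "\<forall>x\<in>V. block I0 k x \<in> snd (c k) ` fst (c k)" if "k \<in> {1..s}" for k using that unfolding V_def by blast
  define fk where "fk k b x = f (cinv s N c k x) $ b" for k b x
  define Fk where "Fk k a x = F (f (cinv s N c k x)) $ a" for k a x
  have fkC: "Ck (Suc d) I1 V (fk k b)" if "k \<in> {1..s}" for k b
    unfolding fk_def by (rule Ck_component[OF that C_map_into_open_Ck(1)[OF N f r ck[OF that]] Vo Vb[OF that]])
  have FkC: "Ck (Suc d) I1 V (Fk k a)" if "k \<in> {1..s}" for k a
    unfolding Fk_def
    by (rule Ck_component[where g = "\<lambda>x. F (f x) $ a", OF that Ck_compose_vec[OF N U f F r ck[OF that]] Vo Vb[OF that]])
  define I where "I = Inl ` I1 \<union> range (Inr :: 'l \<times> 'm \<Rightarrow> (nat \<times> 'i) + ('l \<times> 'm))"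
  define K where "K = range (Inl :: 'l \<times> 'm \<Rightarrow> ('l \<times> 'm) + (nat \<times> 'l))"
  define J where "J = (Inr :: nat \<times> 'l \<Rightarrow> ('l \<times> 'm) + (nat \<times> 'l)) ` ({2..s} \<times> UNIV)"
  define pr where "pr X = (\<lambda>p. X (Inl p))" for X :: "(nat \<times> 'i) + ('l \<times> 'm) \<Rightarrow> real"
  define W where "W = {X \<in> UNIV. pr X \<in> V}"
  define val where "val k a X = Fk k a (pr X) + (\<Sum>b\<in>UNIV. X (Inr (a, b)) * fk k b (pr X))"
    for k a and X :: "(nat \<times> 'i) + ('l \<times> 'm) \<Rightarrow> real"
  \<comment> \<open>On the common zero set of the functions of \<open>J\<close>, those of
    \<open>K\<close> take as values the matrices whose perturbation sends the tuple to the
    diagonal.\<close>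
  define ff where "ff j X = (case j of Inl ab \<Rightarrow> X (Inr ab) | Inr (k, a) \<Rightarrow> val k a X - val 1 a X)"
    for j :: "('l \<times> 'm) + (nat \<times> 'l)" and X :: "(nat \<times> 'i) + ('l \<times> 'm) \<Rightarrow> real"
  have finI: "finite I" unfolding I_def using fin1 by simp
  have finK: "finite K" and finJ: "finite J" unfolding K_def J_def by simp_all
  have "Inl p \<notin> I" if "p \<notin> I1" for p using that unfolding I_def by blast
  then have pc: "compat I A I1 pr" for A unfolding compat_def pr_def by blast
  have Wo: "iopen I W"
    unfolding W_def by (rule iopen_vimage[OF fin1 _ pc _ Vo]) (auto simp: iopen_def pr_def icont_coord)
  have prC: "Ck l I W (\<lambda>X. h (pr X))" if "Ck l I1 V h" for l h
  proof (rule Ck_compose[OF fin1 Wo Vo pc _ _ that])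
    show "\<forall>X\<in>W. pr X \<in> V" by (simp add: W_def)
    show "\<forall>j\<in>I1. Ck l I W (\<lambda>X. pr X j)" by (simp add: pr_def Ck_coord)
  qed
  have valC: "Ck (Suc d) I W (val k a)" if "k \<in> {1..s}" for k a
    unfolding val_def by (intro Ck_add[OF Wo] Ck_sum[OF Wo] Ck_mult[OF Wo] Ck_coord prC FkC fkC that)
  have one: "1 \<in> {1..s}" using s by simp
  have ffC: "\<forall>j\<in>K \<union> J. Ck (Suc d) I W (ff j)"
  proof
    fix j assume "j \<in> K \<union> J"
    then consider ab where "j = Inl ab" | k a where "j = Inr (k, a)" "k \<in> {2..s}" unfolding K_def J_def by auto
    then show "Ck (Suc d) I W (ff j)"
    proof cases
      case 1 then show ?thesis unfolding ff_def by (simp add: Ck_coord del: Ck.simps)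
    next
      case 2
      then have "k \<in> {1..s}" by simp
      then show ?thesis unfolding ff_def 2(1) using Ck_diff[OF Wo valC valC[OF one]] by simp
    qed
  qed
  have cardI: "card I = s * n + CARD('l) * CARD('m)"
  proof -
    have "card I0 = n" using N unfolding C_manifold_def by blast
    then have "card (Inl ` I1 :: ((nat \<times> 'i) + ('l \<times> 'm)) set) = s * n" by (simp add: card_image card_cartesian_product)
    moreover have "card (range (Inr :: 'l \<times> 'm \<Rightarrow> (nat \<times> 'i) + ('l \<times> 'm))) = CARD('l) * CARD('m)"
      by (simp add: card_image)
    ultimately show ?thesis unfolding I_def using fin1 by (subst card_Un_disjoint) auto
  qed
  have cardKJ: "card (K \<union> J) = CARD('l) * CARD('m) + (s - 1) * CARD('l)"
  proof -
    have "card K = CARD('l) * CARD('m)" unfolding K_def by (simp add: card_image)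
    moreover have "card J = (s - 1) * CARD('l)" unfolding J_def by (simp add: card_image card_cartesian_product)
    ultimately show ?thesis using finK finJ by (subst card_Un_disjoint) (auto simp: K_def J_def)
  qed
  \<comment> \<open>The slice value is \<open>undefined\<close> because chart coordinates are
    extensional functions.\<close>
  define E where "E = (\<lambda>X. \<lambda>j\<in>K. ff j X) ` {X\<in>W. (\<forall>k. k \<notin> I \<longrightarrow> X k = undefined) \<and> (\<forall>j\<in>J. ff j X = 0) \<and>
    \<not> row_dep I J (jac ff X) \<and> row_dep I (K \<union> J) (jac ff X)}"
  have "prod_null K E"
    unfolding E_def
  proof (rule sard_fiber[where r = d, OF finK finJ finI Wo _ ffC])
    show "K \<inter> J = {}" unfolding K_def J_def by auto
    \<comment> \<open>The matrix entries count both as variables and as functions and cancel, which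
      leaves \<open>dim\<close>.\<close>
    show "card I \<le> card (K \<union> J) + d" unfolding cardI cardKJ using dim by simp
  qed
  moreover have "E \<subseteq> K \<rightarrow>\<^sub>E UNIV" unfolding E_def by auto
  ultimately have null: "(to_matrix ` E :: (real ^ 'm ^ 'l) set) \<in> null_sets lebesgue"
    unfolding K_def by (rule prod_null_to_matrix)
  have "matrix ` {\<pi>. linear \<pi> \<and> degenerate (\<lambda>x. F (f x) + \<pi> (f x))} \<subseteq> to_matrix ` E"
  proof (rule image_subsetI)
    fix \<pi> :: "real ^ 'm \<Rightarrow> real ^ 'l" assume "\<pi> \<in> {\<pi>. linear \<pi> \<and> degenerate (\<lambda>x. F (f x) + \<pi> (f x))}"
    then have \<pi>: "linear \<pi>" and "degenerate (\<lambda>x. F (f x) + \<pi> (f x))" by auto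
    define g where "g x = F (f x) + \<pi> (f x)" for x
    obtain q where q: "q \<in> cdom s N c" and gq: "\<And>k. k \<in> {1..s} \<Longrightarrow> g (q k) = g (q 1)"
      and dg: "row_dep I1 ({2..s} \<times> UNIV) (jac (tuple_gap s N c g) (cmap s N c q))"
      using \<open>degenerate (\<lambda>x. F (f x) + \<pi> (f x))\<close> unfolding degenerate_def g_def by blast
    define x where "x = cmap s N c q"
    define A where "A = matrix \<pi>"
    define X where "X = case_sum x (\<lambda>(a, b). A $ a $ b)"
    have prX: "pr X = x" and Xr: "X (Inr (a, b)) = A $ a $ b" for a b by (simp_all add: pr_def X_def)
    have gval: "g (cinv s N c k y) $ a = val k a (case_sum y (\<lambda>(a, b). A $ a $ b))" for k a y
      by (simp add: g_def val_def pr_def Fk_def fk_def linear_component[OF \<pi>] A_def)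
    have xim: "x \<in> cmap s N c ` cdom s N c" using q by (simp add: x_def)
    have "x \<in> V" using xim unfolding V_def cmap_image by blast
    then have XW: "X \<in> W" by (simp add: W_def prX)
    have Xoff: "X k = undefined" if "k \<notin> I" for k
    proof (cases k)
      case (Inl p)
      then have p: "p \<notin> I1" using that unfolding I_def by blast
      have "x \<in> I1 \<rightarrow>\<^sub>E UNIV" using xim unfolding cmap_image by blast
      from PiE_arb[OF this p] have "x p = undefined" .
      with Inl show ?thesis by (simp add: X_def)
    next
      case (Inr p) then show ?thesis using that unfolding I_def by simp
    qed
    have Xzero: "\<forall>j\<in>J. ff j X = 0"
    proof
      fix j assume "j \<in> J"
      then obtain k a where j: "j = Inr (k, a)" "k \<in> {2..s}" unfolding J_def by auto
      have v: "val k a X = g (q k) $ a" if "k \<in> {1..s}" for k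
        using gval[of k x a] cinv_cmap[OF q that] unfolding X_def x_def by simp
      have "k \<in> {1..s}" using j(2) by simp
      then show "ff j X = 0" unfolding ff_def j(1) using v[of k] v[OF one] gq[of k] by simp
    qed
    \<comment> \<open>The gaps are affine in the matrix, with the coordinates of
      \<open>f (q k) - f (q 1)\<close> as coefficients, and component \<open>a\<close> involves row
      \<open>a\<close> only.\<close>
    have p1: "partial (Inr (a', b')) (ff (Inr (k, a))) X = (if a = a' then fk k b' x - fk 1 b' x else 0)" for a' b' k a
    proof (rule partialI)
      have pru: "pr (X(Inr (a', b') := t)) = x" for t by (simp add: pr_def X_def)
      have der: "((\<lambda>t. val k a (X(Inr (a', b') := t))) has_real_derivative (if a = a' then fk k b' x else 0)) (at (X (Inr (a', b'))))" for k
      proof -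
        have "((\<lambda>t. Fk k a x + (\<Sum>b\<in>UNIV. (X(Inr (a', b') := t)) (Inr (a, b)) * fk k b x)) has_real_derivative
            0 + (\<Sum>b\<in>UNIV. (if (a, b) = (a', b') then 1 else 0) * fk k b x)) (at (X (Inr (a', b'))))"
          by (intro DERIV_add DERIV_const DERIV_sum DERIV_cmult_right) (auto simp: fun_upd_apply)
        moreover have "0 + (\<Sum>b\<in>UNIV. (if (a, b) = (a', b') then 1 else 0) * fk k b x) = (if a = a' then fk k b' x else 0)"
          by (simp add: if_distrib[of "\<lambda>y. y * _"] cong: if_cong)
        ultimately show ?thesis unfolding val_def pru by simp
      qed
      have "((\<lambda>t. val k a (X(Inr (a', b') := t)) - val 1 a (X(Inr (a', b') := t))) has_real_derivative
        (if a = a' then fk k b' x else 0) - (if a = a' then fk 1 b' x else 0)) (at (X (Inr (a', b'))))"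
        by (rule DERIV_diff[OF der der])
      then show "((\<lambda>t. ff (Inr (k, a)) (X(Inr (a', b') := t))) has_real_derivative
        (if a = a' then fk k b' x - fk 1 b' x else 0)) (at (X (Inr (a', b'))))"
        unfolding ff_def by (simp split: if_splits)
    qed
    have p2: "partial (Inl p) (ff (Inr (k, a))) X = partial p (tuple_gap s N c g (k, a)) x" for p k a
    proof -
      have "X(Inl p := t) = case_sum (x(p := t)) (\<lambda>(a, b). A $ a $ b)" for t
        by (auto simp: X_def fun_eq_iff split: sum.splits)
      then have "ff (Inr (k, a)) (X(Inl p := t)) = tuple_gap s N c g (k, a) (x(p := t))" for t
        unfolding ff_def tuple_gap_def by (simp add: gval)
      then show ?thesis unfolding partial_def by (simp add: X_def)
    qed
    have p3: "partial (Inl p) (ff (Inl ab)) X = 0" for p ab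
      by (rule partialI) (simp add: ff_def)
    have p4: "partial (Inr cd) (ff (Inl ab)) X = (if ab = cd then 1 else 0)" for cd ab
      by (rule partialI) (auto simp: ff_def fun_upd_apply)
    \<comment> \<open>A relation between the gap rows, read in the columns of the matrix row
      \<open>a0\<close>, is a relation between the vectors \<open>f (q k) - f (q 1)\<close>.\<close>
    have nd: "\<not> row_dep I J (jac ff X)"
    proof
      assume "row_dep I J (jac ff X)"
      then obtain e where e: "\<exists>j\<in>J. e j \<noteq> 0" "\<forall>i\<in>I. (\<Sum>j\<in>J. e j * partial i (ff j) X) = 0" unfolding row_dep_def by blast
      obtain k0 a0 where k0: "k0 \<in> {2..s}" "e (Inr (k0, a0)) \<noteq> 0" using e(1) unfolding J_def by auto
      have "(\<Sum>k\<in>{2..s}. e (Inr (k, a0)) *\<^sub>R (f (q k) - f (q 1))) = 0"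
        unfolding vec_eq_iff
      proof
        fix b
        have fq: "fk k b x = f (q k) $ b" if "k \<in> {1..s}" for k
          unfolding fk_def x_def using cinv_cmap[OF q that] by simp
        have "0 = (\<Sum>j\<in>J. e j * partial (Inr (a0, b)) (ff j) X)" using e(2) unfolding I_def by simp
        also have "\<dots> = (\<Sum>(k, a)\<in>{2..s} \<times> UNIV. e (Inr (k, a)) * (if a = a0 then fk k b x - fk 1 b x else 0))"
          unfolding J_def by (subst sum.reindex) (auto simp: p1 intro!: sum.cong)
        also have "\<dots> = (\<Sum>k\<in>{2..s}. \<Sum>a\<in>UNIV. if a = a0 then e (Inr (k, a0)) * (fk k b x - fk 1 b x) else 0)"
          unfolding sum.cartesian_product[symmetric] by (intro sum.cong) auto
        also have "\<dots> = (\<Sum>k\<in>{2..s}. e (Inr (k, a0)) * (f (q k) $ b - f (q 1) $ b))"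
          using fq one by (intro sum.cong) auto
        finally show "(\<Sum>k\<in>{2..s}. e (Inr (k, a0)) *\<^sub>R (f (q k) - f (q 1))) $ b = 0 $ b" by simp
      qed
      moreover have "q \<in> distinct_tuples s (mpoints N)" using q by (simp add: cdom_def)
      then have "(\<Sum>k\<in>{2..s}. e (Inr (k, a0)) *\<^sub>R (f (q k) - f (q 1))) = 0 \<longrightarrow>
          (\<forall>k\<in>{2..s}. e (Inr (k, a0)) = 0)"
        by (rule spec[OF indep[unfolded indep_tuple_def]])
      ultimately have "e (Inr (k0, a0)) = 0" using k0(1) by blast
      with k0(2) show False by simp
    qed
    have dKJ: "row_dep I (K \<union> J) (jac ff X)"
    proof -
      obtain e where e: "\<exists>j\<in>{2..s} \<times> UNIV. e j \<noteq> 0"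
        "\<forall>p\<in>I1. (\<Sum>j\<in>{2..s} \<times> UNIV. e j * partial p (tuple_gap s N c g j) x) = 0"
        using dg unfolding row_dep_def x_def by blast
      \<comment> \<open>The rows of \<open>K\<close> are unit vectors in the matrix columns and zero
        in the tuple columns. Their coefficients are chosen to cancel the gap rows in the matrix
        columns; in the tuple columns the relation \<open>e\<close> already gives zero.\<close>
      define e' where "e' j = (case j of Inr ka \<Rightarrow> e ka
        | Inl ab \<Rightarrow> - (\<Sum>ka\<in>{2..s} \<times> UNIV. e ka * partial (Inr ab) (ff (Inr ka)) X))" for j
      have s1: "(\<Sum>j\<in>K \<union> J. e' j * partial i (ff j) X) = (\<Sum>ab\<in>UNIV. e' (Inl ab) * partial i (ff (Inl ab)) X)
          + (\<Sum>ka\<in>{2..s} \<times> UNIV. e ka * partial i (ff (Inr ka)) X)" for i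
      proof -
        have "(\<Sum>j\<in>K \<union> J. e' j * partial i (ff j) X) = (\<Sum>j\<in>K. e' j * partial i (ff j) X) + (\<Sum>j\<in>J. e' j * partial i (ff j) X)"
          using finK finJ by (intro sum.union_disjoint) (auto simp: K_def J_def)
        moreover have "(\<Sum>j\<in>K. e' j * partial i (ff j) X) = (\<Sum>ab\<in>UNIV. e' (Inl ab) * partial i (ff (Inl ab)) X)"
          unfolding K_def by (subst sum.reindex) auto
        moreover have "(\<Sum>j\<in>J. e' j * partial i (ff j) X) = (\<Sum>ka\<in>{2..s} \<times> UNIV. e ka * partial i (ff (Inr ka)) X)"
          unfolding J_def by (subst sum.reindex) (auto simp: e'_def)
        ultimately show ?thesis by simp
      qed
      have "(\<Sum>j\<in>K \<union> J. e' j * partial i (ff j) X) = 0" if "i \<in> I" for i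
      proof (cases i)
        case (Inl p)
        then have p: "p \<in> I1" using that unfolding I_def by auto
        have "(\<Sum>ka\<in>{2..s} \<times> UNIV. e ka * partial i (ff (Inr ka)) X) = (\<Sum>j\<in>{2..s} \<times> UNIV. e j * partial p (tuple_gap s N c g j) x)"
          unfolding Inl by (intro sum.cong) (auto simp: p2)
        then have z: "(\<Sum>ka\<in>{2..s} \<times> UNIV. e ka * partial (Inl p) (ff (Inr ka)) X) = 0"
          unfolding Inl using bspec[OF e(2) p] by (rule trans)
        show ?thesis unfolding s1 Inl z by (simp add: p3)
      next
        case (Inr cd)
        have "(\<Sum>ab\<in>UNIV. e' (Inl ab) * partial i (ff (Inl ab)) X) = e' (Inl cd)"
          unfolding Inr by (simp add: p4 if_distrib cong: if_cong)
        then show ?thesis unfolding s1 Inr by (simp add: e'_def)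
      qed
      moreover have "\<exists>j\<in>K \<union> J. e' j \<noteq> 0"
      proof -
        obtain ka where "ka \<in> {2..s} \<times> UNIV" "e ka \<noteq> 0" using e(1) by blast
        then show ?thesis unfolding J_def by (intro bexI[of _ "Inr ka"]) (auto simp: e'_def)
      qed
      ultimately show ?thesis unfolding row_dep_def by blast
    qed
    have "(\<lambda>j\<in>K. ff j X) \<in> E" unfolding E_def using XW Xoff Xzero nd dKJ by blast
    moreover have "to_matrix (\<lambda>j\<in>K. ff j X) = matrix \<pi>"
      by (simp add: to_matrix_def K_def ff_def X_def A_def)
    ultimately show "matrix \<pi> \<in> to_matrix ` E" by (metis image_eqI)
  qed
  with null show ?thesis using null_sets_completion_subset by blast
qed

end

lemma C_map_le:
  assumes "C_map r M P g" "r' \<le> r"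
  shows "C_map r' M P g"
proof -
  have "C_on r' I J W h" if "C_on r I J W h" for I J W h
    using that assms(2) unfolding C_on_def by (meson order_trans)
  with assms(1) show ?thesis unfolding C_map_def by blast
qed

theorem theorem2:
  fixes N :: "('a, 'i) mfd"
    and f :: "'a \<Rightarrow> real ^ 'm"
    and U :: "(real ^ 'm) set"
    and F :: "real ^ 'm \<Rightarrow> real ^ 'l"
    and n :: nat
    and s0 :: int
    and r :: enat
  assumes "1 \<le> r"
    and "0 < n"
    and "C_manifold r n N"
    and "open U"
    and "C_map r N (open_submanifold euclid U) f"
    and "inj_on f (mpoints N)"
    and "C_map r (open_submanifold euclid U) euclid F"
    and "s0 = Max ((\<lambda>s. int s * (int n - int CARD('l)) + int CARD('l)) ` {2..s_inj N f})"
    and "enat (nat (max s0 0)) < r"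
  shows "\<exists>\<Sigma> :: (real ^ 'm \<Rightarrow> real ^ 'l) set.
    \<Sigma> \<subseteq> {\<pi>. linear \<pi>} \<and>
    matrix ` \<Sigma> \<in> null_sets lebesgue \<and>
    (\<forall>\<pi>. linear \<pi> \<and> \<pi> \<notin> \<Sigma> \<longrightarrow>
      (let F\<^sub>\<pi> = (\<lambda>x. F x + \<pi> x) in
        (\<forall>s. 2 \<le> s \<and> s \<le> s_inj N f \<longrightarrow>
          C_map r (config_mfd s N) (power_mfd s euclid) (tuple_map s (F\<^sub>\<pi> \<circ> f)) \<and>
          transverse (config_mfd s N) (power_mfd s euclid) (diagonal s) (tuple_map s (F\<^sub>\<pi> \<circ> f))) \<and>
        ((\<forall>y. finite {x\<in>U. F\<^sub>\<pi> x = y} \<and> card {x\<in>U. F\<^sub>\<pi> x = y} \<le> s_inj N f) \<longrightarrow>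
          C_map r N euclid (F\<^sub>\<pi> \<circ> f) \<and> normal_crossings N (F\<^sub>\<pi> \<circ> f))))"
proof -
  note N = assms(3) and U = assms(4) and f = assms(5) and inj = assms(6) and F = assms(7)
  \<comment> \<open>Sard's theorem is applied in class C^(d + 1); the truncation at 0 keeps class
    C^1 when \<open>s0\<close> is negative.\<close>
  define d where "d = nat (max s0 0)"
  have rd: "enat (Suc d) \<le> r" using assms(9) unfolding d_def by (simp add: Suc_ile_eq)
  obtain A0 where A0: "A0 \<subseteq> atlas N" "countable A0" "mpoints N \<subseteq> (\<Union>ch\<in>A0. fst ch)"
    using countable_subatlas[OF N] by blast
  define pert where "pert \<pi> x = F (f x) + \<pi> (f x)" for \<pi> :: "real ^ 'm \<Rightarrow> real ^ 'l" and x
  define B where "B s c = {\<pi> :: real ^ 'm \<Rightarrow> real ^ 'l. linear \<pi> \<and> config_chart.degenerate N s c (pert \<pi>)}" for s c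
  \<comment> \<open>A countable union, because the charts are drawn from \<open>A0\<close>.\<close>
  define \<Sigma> where "\<Sigma> = (\<Union>s\<in>{2..s_inj N f}. \<Union>c\<in>({1..s} \<rightarrow>\<^sub>E A0). B s c)"
  have cc: "config_chart r n N s c" if "c \<in> {1..s} \<rightarrow>\<^sub>E A0" for s c
    using N that A0(1) PiE_mono[of "{1..s}" "\<lambda>_. A0" "\<lambda>_. atlas N"] by unfold_locales blast+
  have Bnull: "matrix ` B s c \<in> null_sets lebesgue" if s: "s \<in> {2..s_inj N f}" and c: "c \<in> {1..s} \<rightarrow>\<^sub>E A0" for s c
    unfolding B_def pert_def
  proof (rule config_chart.degenerate_null[OF cc[OF c] U f F rd])
    show "1 \<le> s" using s by simp
    have "int s * (int n - int CARD('l)) + int CARD('l) \<le> s0"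
      unfolding assms(8) using s by (intro Max_ge) auto
    then have "int s * int n - int s * int CARD('l) + int CARD('l) \<le> int d"
      unfolding d_def by (simp add: right_diff_distrib)
    \<comment> \<open>The inequality s(n - \<ell>) + \<ell> \<le> d, rearranged so that it makes
      sense in natural numbers.\<close>
    then have "int (s * n) \<le> int ((s - 1) * CARD('l) + d)"
      using s by (simp add: of_nat_diff left_diff_distrib)
    then show "s * n \<le> (s - 1) * CARD('l) + d" by linarith
    fix q assume q: "q \<in> distinct_tuples s (mpoints N)"
    \<comment> \<open>The given tuple shows that \<open>N\<close> is nonempty, which together with
      \<open>0 < n\<close> makes it infinite.\<close>
    then have "q 1 \<in> mpoints N" using s by (auto simp: distinct_tuples_def)
    from infinite_manifold[OF N assms(2) this] show "indep_tuple s (\<lambda>k. f (q k))"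
      by (rule s_inj_indep) (use s q in auto)
  qed
  have "matrix ` \<Sigma> = (\<Union>s\<in>{2..s_inj N f}. \<Union>c\<in>({1..s} \<rightarrow>\<^sub>E A0). matrix ` B s c)"
    unfolding \<Sigma>_def by (simp add: image_UN)
  also have "\<dots> \<in> null_sets lebesgue"
    using Bnull A0(2) by (intro null_sets_UN' countable_PiE) auto
  finally have null: "matrix ` \<Sigma> \<in> null_sets lebesgue" .
  have main: "C_map r N euclid (pert \<pi>)" "C_map r (config_mfd s N) (power_mfd s euclid) (tuple_map s (pert \<pi>))"
    if "linear \<pi>" for \<pi> s
  proof -
    show g: "C_map r N euclid (pert \<pi>)" unfolding pert_def by (rule C_map_perturbed[OF N U f F that])
    show "C_map r (config_mfd s N) (power_mfd s euclid) (tuple_map s (pert \<pi>))" by (rule C_map_tuple[OF N g])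
  qed
  have trans: "transverse (config_mfd s N) (power_mfd s euclid) (diagonal s) (tuple_map s (pert \<pi>))"
    if \<pi>: "linear \<pi>" "\<pi> \<notin> \<Sigma>" and s: "s \<in> {2..s_inj N f}" for \<pi> s
  proof (rule transverse_diagonalI[OF N assms(1) C_map_le[OF main(1)[OF \<pi>(1)] assms(1)]])
    show "1 \<le> s" using s by simp
    fix q assume q: "q \<in> distinct_tuples s (mpoints N)" and gq: "\<forall>k\<in>{1..s}. pert \<pi> (q k) = pert \<pi> (q 1)"
    have "\<forall>k\<in>{1..s}. \<exists>ch. ch \<in> A0 \<and> q k \<in> fst ch"
    proof
      fix k assume "k \<in> {1..s}"
      then have "q k \<in> mpoints N" using q by (auto simp: distinct_tuples_def)
      then show "\<exists>ch. ch \<in> A0 \<and> q k \<in> fst ch" using A0(3) by blast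
    qed
    from bchoice[OF this] obtain c0 where c0: "\<forall>k\<in>{1..s}. c0 k \<in> A0 \<and> q k \<in> fst (c0 k)" by blast
    define c where "c = restrict c0 {1..s}"
    have cA: "c \<in> {1..s} \<rightarrow>\<^sub>E A0" using c0 by (auto simp: c_def)
    then have cN: "c \<in> {1..s} \<rightarrow>\<^sub>E atlas N" using A0(1) PiE_mono[of "{1..s}" "\<lambda>_. A0" "\<lambda>_. atlas N"] by blast
    have "q \<in> (\<Pi>\<^sub>E k\<in>{1..s}. fst (c k))"
    proof (rule PiE_I)
      show "q k \<in> fst (c k)" if "k \<in> {1..s}" for k using bspec[OF c0 that] that by (simp add: c_def)
      have "q \<in> {1..s} \<rightarrow>\<^sub>E mpoints N" using q unfolding distinct_tuples_def by blast
      then show "q k = undefined" if "k \<notin> {1..s}" for k using that by (rule PiE_arb)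
    qed
    with q have qc: "q \<in> cdom s N c" unfolding cdom_def by blast
    interpret config_chart r n N s c by (rule cc[OF cA])
    have "\<pi> \<notin> B s c" using \<pi>(2) s cA unfolding \<Sigma>_def by blast
    then have "\<not> degenerate (pert \<pi>)" using \<pi>(1) unfolding B_def by blast
    then have "\<not> row_dep I1 ({2..s} \<times> UNIV) (jac (tuple_gap s N c (pert \<pi>)) (cmap s N c q))"
      using qc gq unfolding degenerate_def by blast
    then show "\<exists>c. c \<in> {1..s} \<rightarrow>\<^sub>E atlas N \<and> q \<in> cdom s N c \<and> \<not> row_dep ({1..s} \<times> idx N) ({2..s} \<times> UNIV)
        (jac (\<lambda>(k, a) x. pert \<pi> (cinv s N c k x) $ a - pert \<pi> (cinv s N c 1 x) $ a) (cmap s N c q))"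
      using qc cN unfolding tuple_gap_def by blast
  qed
  have nc: "normal_crossings N (pert \<pi>)"
    if \<pi>: "linear \<pi>" "\<pi> \<notin> \<Sigma>" and fib: "\<forall>y. finite {x\<in>U. F x + \<pi> x = y} \<and> card {x\<in>U. F x + \<pi> x = y} \<le> s_inj N f" for \<pi>
    unfolding normal_crossings_def
  proof (intro conjI allI impI)
    show g1: "C_map 1 N euclid (pert \<pi>)" by (rule C_map_le[OF main(1)[OF \<pi>(1)] assms(1)])
    fix s :: nat assume "2 \<le> s"
    show "transverse (config_mfd s N) (power_mfd s euclid) (diagonal s) (tuple_map s (pert \<pi>))"
    proof (cases "s \<le> s_inj N f")
      case True then show ?thesis using trans[OF \<pi>] \<open>2 \<le> s\<close> by simp
    next
      case False
      \<comment> \<open>For these \<open>s\<close> the condition holds vacuously: a tuple mapped to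
        the diagonal would give, by injectivity of \<open>f\<close>, \<open>s\<close> distinct
        points in one fibre of F + \<pi>, more than the assumed bound.\<close>
      show ?thesis
      proof (rule transverse_diagonalI[OF N assms(1) g1])
        show "1 \<le> s" using \<open>2 \<le> s\<close> by simp
        fix q assume q: "q \<in> distinct_tuples s (mpoints N)" and gq: "\<forall>k\<in>{1..s}. pert \<pi> (q k) = pert \<pi> (q 1)"
        let ?Y = "{x\<in>U. F x + \<pi> x = pert \<pi> (q 1)}"
        have qN: "q k \<in> mpoints N" if "k \<in> {1..s}" for k using q that by (auto simp: distinct_tuples_def)
        have "f ` mpoints N \<subseteq> U" using f unfolding C_map_def open_euclid_simps continuous_map_in_subtopology by auto
        then have "(\<lambda>k. f (q k)) ` {1..s} \<subseteq> ?Y" using qN gq unfolding pert_def by auto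
        moreover have "inj_on (\<lambda>k. f (q k)) {1..s}"
        proof (rule inj_onI)
          fix k l assume kl: "k \<in> {1..s}" "l \<in> {1..s}" "f (q k) = f (q l)"
          then have "q k = q l" using inj_onD[OF inj] qN by blast
          with kl q show "k = l" unfolding distinct_tuples_def by (blast dest: inj_onD)
        qed
        ultimately have "s \<le> card ?Y" using fib card_mono[of ?Y "(\<lambda>k. f (q k)) ` {1..s}"] by (simp add: card_image)
        also have "\<dots> \<le> s_inj N f" using fib by blast
        finally have False using \<open>\<not> s \<le> s_inj N f\<close> by simp
        then show "\<exists>c. c \<in> {1..s} \<rightarrow>\<^sub>E atlas N \<and> q \<in> cdom s N c \<and> \<not> row_dep ({1..s} \<times> idx N) ({2..s} \<times> UNIV)
          (jac (\<lambda>(k, a) x. pert \<pi> (cinv s N c k x) $ a - pert \<pi> (cinv s N c 1 x) $ a) (cmap s N c q))" ..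
      qed
    qed
  qed
  have pe: "(\<lambda>x. F x + \<pi> x) \<circ> f = pert \<pi>" for \<pi> by (auto simp: pert_def)
  show ?thesis
  proof (intro exI[of _ \<Sigma>] conjI allI impI)
    show "\<Sigma> \<subseteq> {\<pi>. linear \<pi>}" unfolding \<Sigma>_def B_def by blast
    show "matrix ` \<Sigma> \<in> null_sets lebesgue" by (rule null)
  qed (use main trans nc in \<open>auto simp: Let_def pe\<close>)
qed

end
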